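(* There is an algorithm for the Jump System Intersection problem whose running time is polynomial in $\sum_{v \in V} \sum_{\alpha \in B(v)} \log (| \alpha| +1) + \sum_{v \in V} \log ( |c(v)| +1)$ if the following properties hold: (C1) a feasible solution $x_0 \in J \cap B$ is given, (C2) $J$ satisfies (SBO-JUMP), and (C3) for any direct product $B' \subseteq \mathbb Z^V$ of parity intervals, there is an oracle for finding a vector $x \in J \cap B'$ maximizing $c^\top x$.
   Context: Let $V$ be a finite set. For $x, y \in \mathbb{Z}^V$, $s \in \mathbb{Z}^V$ is an $(x,y)$-step if $\|s\|_1 = 1$ and $\|(x+s)-y\|_1 = \|x-y\|_1 - 1$. A non-empty $J \subseteq \mathbb{Z}^V$ is a jump system if for any $x, y \in J$ and any $(x,y)$-step $s$, either $x+s \in J$ or there is an $(x+s,y)$-step $t$ with $x+s+t \in J$. A one-dimensional set $B(v)\subseteq\mathbb Z$ is a jump system iff it has no gap of length more than one (a gap of length $p$ means some $\alpha \in B(v)$ with $\alpha+1,\dots,\alpha+p \notin B(v)$ and $\alpha+p+1 \in B(v)$). The Jump System Intersection problem: given a jump system $J \subseteq \mathbb Z^V$, a finite one-dimensional jump system $B(v) \subseteq \mathbb{Z}$ for each $v \in V$, and a vector $c \in \mathbb{Z}^V$, find a vector $x \in J \cap B$ maximizing $c^\top x$, where $B \subseteq \mathbb Z^V$ is the direct product of the $B(v)$'s. For $x, y \in \mathbb Z^V$, a multiset $\{p_1,\dots,p_\ell\}$ is a $2$-step decomposition of $y-x$ if $p_i \in \mathbb Z^V$, $\|p_i\|_1 =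 2$ for each $i \in [\ell]$, $\|y-x\|_1 = 2\ell$, and $y-x = \sum_{i\in[\ell]} p_i$. Property (SBO-JUMP) of $J$: for any $x, y \in J$ there exists a $2$-step decomposition $\{p_1,\dots,p_\ell\}$ of $y-x$ such that $x + \sum_{i \in I} p_i \in J$ for any $I \subseteq [\ell]$. A parity interval is a set $\{\alpha, \alpha+2, \dots, \beta-2, \beta\}$ for integers $\alpha \le \beta$ of the same parity.
   Formalization: The running time is polynomial in |V| plus the stated sum of logarithms, not in that sum alone: coordinates with B(v)={0} and c(v)=0 contribute 0 to the sum, so |V| can be arbitrarily large at bounded sum, and even writing the output takes |V| steps. *)

theory Defs
  imports
    Complex_Main
    "HOL-Library.Function_Algebras"
    "HOL-Library.Log_Nat"
    "HOL-Computational_Algebra.Polynomial"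
begin

section \<open>Jump systems\<close>

text \<open>The lattice of integer vectors indexed by \<open>V\<close> is modelled by the functions that vanish
  outside \<open>V\<close>; addition and subtraction are pointwise.\<close>

definition int_vecs :: "'v set \<Rightarrow> ('v \<Rightarrow> int) set" where
  "int_vecs V = {x. \<forall>v. v \<notin> V \<longrightarrow> x v = 0}"

definition l1 :: "'v set \<Rightarrow> ('v \<Rightarrow> int) \<Rightarrow> int" where
  "l1 V x = (\<Sum>v\<in>V. \<bar>x v\<bar>)"

definition is_step :: "'v set \<Rightarrow> ('v \<Rightarrow> int) \<Rightarrow> ('v \<Rightarrow> int) \<Rightarrow> ('v \<Rightarrow> int) \<Rightarrow> bool" where
  "is_step V x y s \<longleftrightarrow>
     s \<in> int_vecs V \<and> l1 V s = 1 \<and> l1 V ((x + s) - y) = l1 V (x - y) - 1"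

definition jump_system :: "'v set \<Rightarrow> ('v \<Rightarrow> int) set \<Rightarrow> bool" where
  "jump_system V J \<longleftrightarrow>
     J \<noteq> {} \<and> J \<subseteq> int_vecs V \<and>
     (\<forall>x\<in>J. \<forall>y\<in>J. \<forall>s. is_step V x y s \<longrightarrow>
        x + s \<in> J \<or> (\<exists>t. is_step V (x + s) y t \<and> x + s + t \<in> J))"

text \<open>A set of integers is regarded as a set of vectors over a one-element index set.\<close>

definition jump_system_1d :: "int set \<Rightarrow> bool" where
  "jump_system_1d B \<longleftrightarrow> jump_system {()} {x. x () \<in> B}"

definition has_gap :: "int set \<Rightarrow> nat \<Rightarrow> bool" where
  "has_gap B p \<longleftrightarrow> (\<exists>\<alpha>\<in>B. (\<forall>i\<in>{1..int p}. \<alpha> + i \<notin> B) \<and> \<alpha> + int p + 1 \<in> B)"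

definition direct_product :: "'v set \<Rightarrow> ('v \<Rightarrow> int set) \<Rightarrow> ('v \<Rightarrow> int) set" where
  "direct_product V B = {x \<in> int_vecs V. \<forall>v\<in>V. x v \<in> B v}"

definition two_step_decomposition ::
    "'v set \<Rightarrow> ('v \<Rightarrow> int) \<Rightarrow> ('v \<Rightarrow> int) list \<Rightarrow> bool" where
  "two_step_decomposition V d ps \<longleftrightarrow>
     (\<forall>p\<in>set ps. p \<in> int_vecs V \<and> l1 V p = 2) \<and>
     l1 V d = 2 * int (length ps) \<and> d = (\<Sum>i<length ps. ps ! i)"

definition sbo_jump :: "'v set \<Rightarrow> ('v \<Rightarrow> int) set \<Rightarrow> bool" where
  "sbo_jump V J \<longleftrightarrow>
     (\<forall>x\<in>J. \<forall>y\<in>J. \<exists>ps. two_step_decomposition V (y - x) ps \<and>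
        (\<forall>I\<subseteq>{..<length ps}. x + (\<Sum>i\<in>I. ps ! i) \<in> J))"

definition is_maximizer ::
    "'v set \<Rightarrow> ('v \<Rightarrow> int) \<Rightarrow> ('v \<Rightarrow> int) set \<Rightarrow> ('v \<Rightarrow> int) \<Rightarrow> bool" where
  "is_maximizer V c S x \<longleftrightarrow> x \<in> S \<and> (\<forall>y\<in>S. (\<Sum>v\<in>V. c v * y v) \<le> (\<Sum>v\<in>V. c v * x v))"

definition parity_interval :: "int \<Rightarrow> int \<Rightarrow> int set" where
  "parity_interval \<alpha> \<beta> = {\<gamma>. \<alpha> \<le> \<gamma> \<and> \<gamma> \<le> \<beta> \<and> even (\<gamma> - \<alpha>)}"

text \<open>An oracle maps a direct product of parity intervals to a maximizer over its intersection
  with \<open>J\<close>, or to \<^term>\<open>None\<close> if this intersection is empty. Its behaviour on other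
  sets is unconstrained.\<close>

definition optimization_oracle ::
    "'v set \<Rightarrow> ('v \<Rightarrow> int) set \<Rightarrow> ('v \<Rightarrow> int) \<Rightarrow>
     (('v \<Rightarrow> int) set \<Rightarrow> ('v \<Rightarrow> int) option) \<Rightarrow> bool" where
  "optimization_oracle V J c orc \<longleftrightarrow>
     (\<forall>lo hi. (\<forall>v\<in>V. lo v \<le> hi v \<and> even (hi v - lo v)) \<longrightarrow>
        (let B' = direct_product V (\<lambda>v. parity_interval (lo v) (hi v)) in
         case orc B' of
           None \<Rightarrow> J \<inter> B' = {}
         | Some x \<Rightarrow> is_maximizer V c (J \<inter> B') x))"


section \<open>Machine model\<close>

text \<open>Structured programs for a random access machine with logarithmic cost. A program manipulates
  finitely many integer arrays, each indexed by all integers (a scalar is cell \<open>0\<close> of an array).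
  Every evaluation of a constant, of an array cell or of an arithmetic operation is charged the
  bit length of its value, and every command at least one unit.\<close>

type_synonym array_name = string
type_synonym state = "array_name \<Rightarrow> int \<Rightarrow> int"

definition int_len :: "int \<Rightarrow> nat" where
  "int_len k = 1 + floorlog 2 (nat \<bar>k\<bar>)"

datatype aexp =
    Const int
  | Cell array_name aexp
  | Plus aexp aexp
  | Minus aexp aexp
  | Times aexp aexp

datatype bexp =
    Less aexp aexp
  | Neg bexp
  | Conj bexp bexp

datatype com =
    Skip
  | Assign array_name aexp aexp
  | Seq com com
  | Cond bexp com com
  | While bexp com
  | Query array_name array_name array_name array_name

fun aval :: "aexp \<Rightarrow> state \<Rightarrow> int" where
  "aval (Const k) s = k"
| "aval (Cell a e) s = s a (aval e s)"
| "aval (Plus e f) s = aval e s + aval f s"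
| "aval (Minus e f) s = aval e s - aval f s"
| "aval (Times e f) s = aval e s * aval f s"

fun acost :: "aexp \<Rightarrow> state \<Rightarrow> nat" where
  "acost (Const k) s = int_len k"
| "acost (Cell a e) s = acost e s + int_len (aval (Cell a e) s)"
| "acost (Plus e f) s = acost e s + acost f s + int_len (aval (Plus e f) s)"
| "acost (Minus e f) s = acost e s + acost f s + int_len (aval (Minus e f) s)"
| "acost (Times e f) s = acost e s + acost f s + int_len (aval (Times e f) s)"

fun bval :: "bexp \<Rightarrow> state \<Rightarrow> bool" where
  "bval (Less e f) s \<longleftrightarrow> aval e s < aval f s"
| "bval (Neg b) s \<longleftrightarrow> \<not> bval b s"
| "bval (Conj b d) s \<longleftrightarrow> bval b s \<and> bval d s"

fun bcost :: "bexp \<Rightarrow> state \<Rightarrow> nat" where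
  "bcost (Less e f) s = acost e s + acost f s + 1"
| "bcost (Neg b) s = bcost b s + 1"
| "bcost (Conj b d) s = bcost b s + bcost d s + 1"

definition store :: "array_name \<Rightarrow> int \<Rightarrow> int \<Rightarrow> state \<Rightarrow> state" where
  "store a i k s = s(a := (s a)(i := k))"

text \<open>The first \<open>n\<close> cells of an array, as a vector over the index set \<^term>\<open>{..<n}\<close>.\<close>

definition read_vec :: "nat \<Rightarrow> state \<Rightarrow> array_name \<Rightarrow> nat \<Rightarrow> int" where
  "read_vec n s a = (\<lambda>v. if v < n then s a (int v) else 0)"

definition store_vec :: "nat \<Rightarrow> array_name \<Rightarrow> (nat \<Rightarrow> int) \<Rightarrow> state \<Rightarrow> state" where
  "store_vec n a x s = s(a := (\<lambda>i. if 0 \<le> i \<and> i < int n then x (nat i) else s a i))"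

definition vec_len :: "nat \<Rightarrow> (nat \<Rightarrow> int) \<Rightarrow> nat" where
  "vec_len n x = (\<Sum>v<n. int_len (x v))"

definition query_set :: "nat \<Rightarrow> state \<Rightarrow> array_name \<Rightarrow> array_name \<Rightarrow> (nat \<Rightarrow> int) set" where
  "query_set n s lo hi =
     direct_product {..<n} (\<lambda>v. parity_interval (read_vec n s lo v) (read_vec n s hi v))"

text \<open>\<open>exec n orc p s t s'\<close>: started in state \<open>s\<close>, program \<open>p\<close> halts in state \<open>s'\<close> after time \<open>t\<close>.
  The command \<open>Query lo hi ans flag\<close> presents to the oracle the product of the parity intervals
  whose endpoints are stored in the arrays \<open>lo\<close> and \<open>hi\<close>. It sets the scalar \<open>flag\<close> to \<open>1\<close> and
  stores the answer in \<open>ans\<close>, or sets \<open>flag\<close> to \<open>0\<close> if there is no answer; it is charged the bit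
  length of query and answer.\<close>

inductive exec ::
    "nat \<Rightarrow> ((nat \<Rightarrow> int) set \<Rightarrow> (nat \<Rightarrow> int) option) \<Rightarrow> com \<Rightarrow> state \<Rightarrow> nat \<Rightarrow> state \<Rightarrow> bool"
  for n orc where
  exec_Skip: "exec n orc Skip s 1 s"
| exec_Assign: "exec n orc (Assign a e f) s (1 + acost e s + acost f s)
     (store a (aval e s) (aval f s) s)"
| exec_Seq: "exec n orc p s t s' \<Longrightarrow> exec n orc q s' u s'' \<Longrightarrow>
     exec n orc (Seq p q) s (1 + t + u) s''"
| exec_CondTrue: "bval b s \<Longrightarrow> exec n orc p s t s' \<Longrightarrow>
     exec n orc (Cond b p q) s (1 + bcost b s + t) s'"
| exec_CondFalse: "\<not> bval b s \<Longrightarrow> exec n orc q s t s' \<Longrightarrow>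
     exec n orc (Cond b p q) s (1 + bcost b s + t) s'"
| exec_WhileFalse: "\<not> bval b s \<Longrightarrow> exec n orc (While b p) s (1 + bcost b s) s"
| exec_WhileTrue: "bval b s \<Longrightarrow> exec n orc p s t s' \<Longrightarrow> exec n orc (While b p) s' u s'' \<Longrightarrow>
     exec n orc (While b p) s (1 + bcost b s + t + u) s''"
| exec_QuerySome: "orc (query_set n s lo hi) = Some x \<Longrightarrow>
     exec n orc (Query lo hi ans flag) s
       (1 + vec_len n (read_vec n s lo) + vec_len n (read_vec n s hi) + vec_len n x)
       (store flag 0 1 (store_vec n ans x s))"
| exec_QueryNone: "orc (query_set n s lo hi) = None \<Longrightarrow>
     exec n orc (Query lo hi ans flag) s
       (1 + vec_len n (read_vec n s lo) + vec_len n (read_vec n s hi))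
       (store flag 0 0 s)"

inductive_cases exec_SkipE: "exec n orc Skip s t s'"
inductive_cases exec_AssignE: "exec n orc (Assign a e f) s t s'"
inductive_cases exec_SeqE: "exec n orc (Seq p q) s t s'"
inductive_cases exec_CondE: "exec n orc (Cond b p q) s t s'"
inductive_cases exec_WhileE: "exec n orc (While b p) s t s'"
inductive_cases exec_QueryE: "exec n orc (Query lo hi ans flag) s t s'"

lemma exec_deterministic:
  assumes "exec n orc p s t s'" and "exec n orc p s u s''"
  shows "u = t \<and> s'' = s'"
  using assms
proof (induction arbitrary: u s'' rule: exec.induct)
  case (exec_Seq p s t s' q t' s\<^sub>2)
  from exec_Seq.prems show ?case
    by (rule exec_SeqE) (auto dest!: exec_Seq.IH)
next
  case (exec_WhileTrue b s p t s' t' s\<^sub>2)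
  from exec_WhileTrue.prems show ?case
    by (rule exec_WhileE) (use exec_WhileTrue.hyps(1) in \<open>auto dest!: exec_WhileTrue.IH\<close>)
next
  case (exec_CondTrue b s p t s' q)
  from exec_CondTrue.prems show ?case
    by (rule exec_CondE) (use exec_CondTrue.hyps(1) in \<open>auto dest!: exec_CondTrue.IH\<close>)
next
  case (exec_CondFalse b s q t s' p)
  from exec_CondFalse.prems show ?case
    by (rule exec_CondE) (use exec_CondFalse.hyps(1) in \<open>auto dest!: exec_CondFalse.IH\<close>)
next
  case (exec_WhileFalse b s p)
  from exec_WhileFalse.prems show ?case
    by (rule exec_WhileE) (use exec_WhileFalse.hyps(1) in auto)
qed (auto elim: exec_SkipE exec_AssignE exec_QueryE)


section \<open>Input encoding and size\<close>

definition array_of :: "int list \<Rightarrow> int \<Rightarrow> int" where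
  "array_of xs = (\<lambda>i. if 0 \<le> i \<and> i < int (length xs) then xs ! nat i else 0)"

text \<open>The array \<open>B\<close> holds the sorted lists of the elements of \<open>B 0, \<dots>, B (n - 1)\<close>, one after the
  other, and the array \<open>len\<close> holds their lengths. All arrays not mentioned are zero.\<close>

definition input_state ::
    "nat \<Rightarrow> (nat \<Rightarrow> int set) \<Rightarrow> (nat \<Rightarrow> int) \<Rightarrow> (nat \<Rightarrow> int) \<Rightarrow> state" where
  "input_state n B c x\<^sub>0 = (\<lambda>_ _. 0)
     (''n'' := array_of [int n],
      ''c'' := array_of (map c [0..<n]),
      ''x0'' := array_of (map x\<^sub>0 [0..<n]),
      ''len'' := array_of (map (\<lambda>v. int (card (B v))) [0..<n]),
      ''B'' := array_of (concat (map (\<lambda>v. sorted_list_of_set (B v)) [0..<n])))"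

text \<open>Zero entries do not contribute to this sum, so that the length of the input is bounded by a
  linear function of the size and the number of coordinates together, but not of the size alone.
  Running times are therefore measured in terms of both.\<close>

definition instance_size :: "'v set \<Rightarrow> ('v \<Rightarrow> int set) \<Rightarrow> ('v \<Rightarrow> int) \<Rightarrow> real" where
  "instance_size V B c =
     (\<Sum>v\<in>V. \<Sum>\<alpha>\<in>B v. log 2 (real_of_int \<bar>\<alpha>\<bar> + 1)) + (\<Sum>v\<in>V. log 2 (real_of_int \<bar>c v\<bar> + 1))"


section \<open>One-dimensional jump systems and gaps\<close>

lemma jump_system_1d_alt:
  "jump_system_1d B \<longleftrightarrow> B \<noteq> {} \<and>
     (\<forall>x\<in>B. \<forall>y\<in>B. \<forall>s. \<bar>s\<bar> = 1 \<and> \<bar>x + s - y\<bar> = \<bar>x - y\<bar> - 1 \<longrightarrow>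
        x + s \<in> B \<or> (\<exists>t. \<bar>t\<bar> = 1 \<and> \<bar>x + s + t - y\<bar> = \<bar>x + s - y\<bar> - 1 \<and> x + s + t \<in> B))"
  (is "_ \<longleftrightarrow> _ \<and> ?R")
proof -
  have step: "is_step {()} f g h \<longleftrightarrow> \<bar>h ()\<bar> = 1 \<and> \<bar>f () + h () - g ()\<bar> = \<bar>f () - g ()\<bar> - 1"
    for f g h :: "unit \<Rightarrow> int"
    by (simp add: is_step_def int_vecs_def l1_def)
  let ?J = "{x :: unit \<Rightarrow> int. x () \<in> B}"
  let ?S = "\<forall>x\<in>?J. \<forall>y\<in>?J. \<forall>s. is_step {()} x y s \<longrightarrow>
        x + s \<in> ?J \<or> (\<exists>t. is_step {()} (x + s) y t \<and> x + s + t \<in> ?J)"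
  have "?J \<noteq> {} \<longleftrightarrow> B \<noteq> {}"
  proof
    assume "B \<noteq> {}"
    then obtain b where "b \<in> B" by auto
    then have "(\<lambda>_. b) \<in> ?J" by simp
    then show "?J \<noteq> {}" by (metis empty_iff)
  qed auto
  moreover have "?J \<subseteq> int_vecs {()}" by (simp add: int_vecs_def)
  moreover have "?S \<longleftrightarrow> ?R"
  proof
    assume S: ?S
    show ?R
    proof (intro ballI allI impI)
      fix x y s :: int
      assume "x \<in> B" "y \<in> B" "\<bar>s\<bar> = 1 \<and> \<bar>x + s - y\<bar> = \<bar>x - y\<bar> - 1"
      then have "(\<lambda>_. x) \<in> ?J" "(\<lambda>_. y) \<in> ?J" "is_step {()} (\<lambda>_. x) (\<lambda>_. y) (\<lambda>_. s)"
        by (simp_all add: step)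
      then have "(\<lambda>_. x) + (\<lambda>_. s) \<in> ?J \<or>
          (\<exists>t. is_step {()} ((\<lambda>_. x) + (\<lambda>_. s)) (\<lambda>_. y) t \<and> (\<lambda>_. x) + (\<lambda>_. s) + t \<in> ?J)"
        by (rule S[rule_format])
      then show "x + s \<in> B \<or>
          (\<exists>t. \<bar>t\<bar> = 1 \<and> \<bar>x + s + t - y\<bar> = \<bar>x + s - y\<bar> - 1 \<and> x + s + t \<in> B)"
        by (auto simp: step)
    qed
  next
    assume R: ?R
    show ?S
    proof (intro ballI allI impI)
      fix x y s
      assume "x \<in> ?J" "y \<in> ?J" "is_step {()} x y s"
      then have "x () \<in> B" "y () \<in> B"
        "\<bar>s ()\<bar> = 1 \<and> \<bar>x () + s () - y ()\<bar> = \<bar>x () - y ()\<bar> - 1"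
        by (simp_all add: step)
      with R consider "x () + s () \<in> B"
        | t where "\<bar>t\<bar> = 1" "\<bar>x () + s () + t - y ()\<bar> = \<bar>x () + s () - y ()\<bar> - 1"
            "x () + s () + t \<in> B"
        by blast
      then show "x + s \<in> ?J \<or> (\<exists>t. is_step {()} (x + s) y t \<and> x + s + t \<in> ?J)"
      proof cases
        case 1
        then show ?thesis by simp
      next
        case 2
        then have "is_step {()} (x + s) y (\<lambda>_. t) \<and> x + s + (\<lambda>_. t) \<in> ?J"
          by (simp add: step)
        then show ?thesis by blast
      qed
    qed
  qed
  ultimately show ?thesis
    unfolding jump_system_1d_def jump_system_def by (simp only: simp_thms)
qed

lemma jump_system_1d_iff_gaps:
  "jump_system_1d B \<longleftrightarrow> B \<noteq> {} \<and> (\<forall>p>1. \<not> has_gap B p)"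
proof (intro iffI conjI)
  assume J: "jump_system_1d B"
  then show "B \<noteq> {}" by (simp add: jump_system_1d_alt)
  show "\<forall>p>1. \<not> has_gap B p"
  proof (intro allI impI notI)
    fix p :: nat
    assume "1 < p" and "has_gap B p"
    then obtain \<alpha> where \<alpha>: "\<alpha> \<in> B" "\<alpha> + int p + 1 \<in> B"
      and gap: "\<And>i. i \<in> {1..int p} \<Longrightarrow> \<alpha> + i \<notin> B"
      by (auto simp: has_gap_def)
    have "\<alpha> + 1 \<notin> B" "\<alpha> + 2 \<notin> B"
      using gap[of 1] gap[of 2] \<open>1 < p\<close> by auto
    moreover have "\<bar>1 :: int\<bar> = 1 \<and>
        \<bar>\<alpha> + 1 - (\<alpha> + int p + 1)\<bar> = \<bar>\<alpha> - (\<alpha> + int p + 1)\<bar> - 1"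
      by simp
    ultimately obtain t :: int where "\<bar>t\<bar> = 1"
      "\<bar>\<alpha> + 1 + t - (\<alpha> + int p + 1)\<bar> = \<bar>\<alpha> + 1 - (\<alpha> + int p + 1)\<bar> - 1" "\<alpha> + 1 + t \<in> B"
      using J \<alpha> unfolding jump_system_1d_alt by blast
    moreover from this(1,2) have "t = 1" using \<open>1 < p\<close> by linarith
    ultimately show False using \<open>\<alpha> + 2 \<notin> B\<close> by (simp add: add.commute)
  qed
next
  assume R: "B \<noteq> {} \<and> (\<forall>p>1. \<not> has_gap B p)"
  have no_gap: False if "a \<in> B" "b \<in> B" "a + 3 \<le> b" "\<forall>k. a < k \<and> k < b \<longrightarrow> k \<notin> B" for a b
  proof -
    have "has_gap B (nat (b - a - 1))"
      unfolding has_gap_def by (rule bexI[of _ a]) (use that in auto)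
    then show False using R that(3) by auto
  qed
  have up: "x + 1 \<in> B \<or> x + 2 \<in> B" if "x \<in> B" "y \<in> B" "x < y" for x y
  proof (rule ccontr)
    assume N: "\<not> ?thesis"
    have "finite ({x<..y} \<inter> B)" "{x<..y} \<inter> B \<noteq> {}" using that by auto
    note S = Min_in[OF this] Min_le[OF this(1)]
    define m where "m = Min ({x<..y} \<inter> B)"
    have m: "m \<in> B" "x < m" "m \<le> y" using S(1) by (simp_all add: m_def)
    have min: "k \<notin> B" if "x < k" "k < m" for k
    proof
      assume "k \<in> B"
      then have "m \<le> k" unfolding m_def by (intro S(2)) (use that m(3) in auto)
      then show False using that by simp
    qed
    have "m \<noteq> x + 1" "m \<noteq> x + 2" using N m(1) by auto
    then have "x + 3 \<le> m" using m(2) by linarith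
    then show False using no_gap[OF that(1) m(1)] min by blast
  qed
  have down: "x - 1 \<in> B \<or> x - 2 \<in> B" if "x \<in> B" "y \<in> B" "y < x" for x y
  proof (rule ccontr)
    assume N: "\<not> ?thesis"
    have "finite ({y..<x} \<inter> B)" "{y..<x} \<inter> B \<noteq> {}" using that by auto
    note S = Max_in[OF this] Max_ge[OF this(1)]
    define m where "m = Max ({y..<x} \<inter> B)"
    have m: "m \<in> B" "m < x" "y \<le> m" using S(1) by (simp_all add: m_def)
    have max: "k \<notin> B" if "m < k" "k < x" for k
    proof
      assume "k \<in> B"
      then have "k \<le> m" unfolding m_def by (intro S(2)) (use that m(3) in auto)
      then show False using that by simp
    qed
    have "m \<noteq> x - 1" "m \<noteq> x - 2" using N m(1) by auto
    then have "m + 3 \<le> x" using m(2) by linarith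
    then show False using no_gap[OF m(1) that(1)] max by blast
  qed
  show "jump_system_1d B"
    unfolding jump_system_1d_alt
  proof (intro conjI ballI allI impI)
    show "B \<noteq> {}" using R by simp
    fix x y s :: int
    assume xy: "x \<in> B" "y \<in> B" and s: "\<bar>s\<bar> = 1 \<and> \<bar>x + s - y\<bar> = \<bar>x - y\<bar> - 1"
    show "x + s \<in> B \<or> (\<exists>t. \<bar>t\<bar> = 1 \<and> \<bar>x + s + t - y\<bar> = \<bar>x + s - y\<bar> - 1 \<and> x + s + t \<in> B)"
    proof (cases "x + s \<in> B")
      case False
      then have ne: "x + s \<noteq> y" using xy by auto
      have "x + s + s \<in> B"
      proof (cases "x < y")
        case True
        then have "s = 1" using s by linarith
        then show ?thesis using up[OF xy True] False by (simp add: add.commute)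
      next
        case False': False
        then have "s = -1" "y < x" using s by linarith+
        then show ?thesis using down[OF xy] False by simp
      qed
      moreover have "\<bar>x + s + s - y\<bar> = \<bar>x + s - y\<bar> - 1" using s ne by linarith
      ultimately show ?thesis using s by blast
    qed simp
  qed
qed

end

theory Submission
  imports Defs
begin

text \<open>Local search. Around a feasible \<open>x\<close> the oracle maximizes over every product of parity intervals
  in which at most two coordinates are pinned to elements of \<open>B\<close> and every other coordinate \<open>v\<close> ranges
  over the maximal parity interval of \<open>B v\<close> containing \<open>x v\<close>. The best answer closes at least a
  fraction \<open>1 / L\<close> of the gap to the optimum, where \<open>L\<close> is the total number of elements of the
  sets \<open>B v\<close>; hence the number of rounds is of order \<open>L\<close> times the logarithm of the initial gap.

  For this estimate, a 2-step decomposition of \<open>y - x\<close> is read as a multigraph on the coordinates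
  whose edges carry weights. An edge set yields a point of \<open>B\<close> iff its degrees lie in
  sets \<open>D u\<close> of numbers that contain \<open>0\<close> and the full degree and have no two consecutive
  holes. One has to show: if at least three vertices are bad (their full degree is not reached
  through even numbers of \<open>D u\<close>) and the total weight is positive, then some proper feasible subset has
  positive weight. In a minimal counterexample, consider the edge sets that violate the degree
  constraint at a single vertex, and among those choose \<open>Q\<close> of maximal weight and then of minimal size.
  Exchanging along an alternating trail between \<open>Q\<close> and the empty set, the full edge set, or another
  such set (which exists by minimality, after filling a hole) preserves the sum of the weights
  and yields two feasible sets or a better choice of \<open>Q\<close>, unless the trail closes up. In the latter
  case, deleting or contracting \<open>Q\<close> gives a smaller counterexample.\<close>

section \<open>Multigraphs with degree constraints and alternating trails\<close>

text \<open>Two pinned coordinates suffice because a trail has two ends. It passes through a vertex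
  only when the degrees there are holes; holes are isolated, so the next edge repairs the vertex.
  Between nested sets this even certifies that all even degrees up to the one attained are
  admissible, so if one trail uses up all edges, only its ends can be bad. The obstacle is a trail
  that returns to its start \<open>v\<close> with the two degrees at \<open>v\<close> merely
  exchanged. Parity excludes this, or else an admissible value between the two degrees that steps of
  two cannot cross. A trail between \<open>Q\<close> and the empty or the full set can close up only
  by using all of \<open>Q\<close> or all of its complement; then the vertices other than
  \<open>v\<close> are good on that side, and the bad ones persist on the other. The induction
  measure is the number of edges plus the number of holes at bad vertices: restricting to one side
  of \<open>Q\<close> lowers the first summand, filling a hole the second. The fraction
  \<open>1 / L\<close> comes from subtracting the best local gain from every edge weight, which
  bounds the total gain by that gain times the number of edges; there are at most \<open>L\<close>
  edges since \<open>x\<close> and \<open>y\<close> differ at \<open>v\<close> by at most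
  \<open>2 * card (B v)\<close>.\<close>

definition deg :: "('e \<Rightarrow> 'v \<Rightarrow> nat) \<Rightarrow> 'e set \<Rightarrow> 'v \<Rightarrow> nat" where
  "deg inc X u = (\<Sum>e\<in>X. inc e u)"

text \<open>A loop \<open>a = b\<close> has incidence 2 at \<open>a\<close>: a summand of a 2-step
  decomposition may move a single coordinate by two.\<close>

definition joins :: "('e \<Rightarrow> 'v \<Rightarrow> nat) \<Rightarrow> 'e \<Rightarrow> 'v \<Rightarrow> 'v \<Rightarrow> bool" where
  "joins inc e a b \<longleftrightarrow> (\<forall>u. inc e u = of_bool (u = a) + of_bool (u = b))"

definition jumpy :: "nat \<Rightarrow> nat set \<Rightarrow> bool" where
  "jumpy d S \<longleftrightarrow> 0 \<in> S \<and> d \<in> S \<and> (\<forall>k\<le>d. k \<notin> S \<longrightarrow> k - 1 \<in> S \<and> k + 1 \<in> S)"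

definition good :: "nat \<Rightarrow> nat set \<Rightarrow> bool" where
  "good d S \<longleftrightarrow> even d \<and> (\<forall>k\<le>d. even k \<longrightarrow> k \<in> S)"

definition feas :: "'v set \<Rightarrow> ('e \<Rightarrow> 'v \<Rightarrow> nat) \<Rightarrow> ('v \<Rightarrow> nat set) \<Rightarrow> 'e set \<Rightarrow> bool" where
  "feas V inc D X \<longleftrightarrow> (\<forall>u\<in>V. deg inc X u \<in> D u)"

definition bad :: "'v set \<Rightarrow> ('v \<Rightarrow> nat) \<Rightarrow> ('v \<Rightarrow> nat set) \<Rightarrow> 'v set" where
  "bad V d D = {u \<in> V. \<not> good (d u) (D u)}"

text \<open>Counted at bad vertices only, so that replacing \<open>D u\<close> by the set of all
  even numbers at a good vertex leaves the measure unchanged.\<close>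

definition holes :: "'v set \<Rightarrow> ('v \<Rightarrow> nat) \<Rightarrow> ('v \<Rightarrow> nat set) \<Rightarrow> nat" where
  "holes V d D = (\<Sum>u\<in>bad V d D. card {k. k \<le> d u \<and> k \<notin> D u})"

abbreviation flip :: "'e set \<Rightarrow> 'e set \<Rightarrow> 'e set" where
  "flip P X \<equiv> (P - X) \<union> (X - P)"

text \<open>Every element of \<open>X\<close> lies in exactly one of \<open>P\<close> and
  \<open>P'\<close> and moves to the other one. Applied to the weights and, through
  \<open>inc\<close>, to the degrees.\<close>

lemma sum_flip:
  fixes f :: "'e \<Rightarrow> 'a::comm_monoid_add"
  assumes "finite P" "finite P'" "X \<subseteq> flip P P'"
  shows "sum f (flip P X) + sum f (flip P' X) = sum f P + sum f P'"
proof -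
  define A where "A = P - P'"
  define B where "B = P' - P"
  define C where "C = P \<inter> P'"
  have fin: "finite A" "finite B" "finite C" "finite X"
    using assms finite_subset[OF assms(3)] by (auto simp: A_def B_def C_def)
  have 1: "flip P X = C \<union> ((A - X) \<union> (B \<inter> X))" "flip P' X = C \<union> ((B - X) \<union> (A \<inter> X))"
    "P = C \<union> ((A - X) \<union> (A \<inter> X))" "P' = C \<union> ((B - X) \<union> (B \<inter> X))"
    using assms(3) by (auto simp: A_def B_def C_def)
  have AB: "A \<inter> B = {}" "A \<inter> C = {}" "B \<inter> C = {}"
    by (auto simp: A_def B_def C_def)
  have "sum f (flip P X) = sum f C + (sum f (A - X) + sum f (B \<inter> X))"
    unfolding 1(1) using fin AB by (subst sum.union_disjoint; (subst sum.union_disjoint)?; auto)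
  moreover have "sum f (flip P' X) = sum f C + (sum f (B - X) + sum f (A \<inter> X))"
    unfolding 1(2) using fin AB by (subst sum.union_disjoint; (subst sum.union_disjoint)?; auto)
  moreover have "sum f P = sum f C + (sum f (A - X) + sum f (A \<inter> X))"
    unfolding arg_cong[OF 1(3), of "sum f"]
    using fin AB by (subst sum.union_disjoint; (subst sum.union_disjoint)?; auto)
  moreover have "sum f P' = sum f C + (sum f (B - X) + sum f (B \<inter> X))"
    unfolding arg_cong[OF 1(4), of "sum f"]
    using fin AB by (subst sum.union_disjoint; (subst sum.union_disjoint)?; auto)
  ultimately show ?thesis by (simp add: ac_simps)
qed

lemma deg_insert: "finite X \<Longrightarrow> e \<notin> X \<Longrightarrow> deg inc (insert e X) u = inc e u + deg inc X u"
  by (simp add: deg_def)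

lemma deg_empty [simp]: "deg inc {} u = 0"
  by (simp add: deg_def)

lemma deg_mono: "finite Y \<Longrightarrow> X \<subseteq> Y \<Longrightarrow> deg inc X u \<le> deg inc Y u"
  unfolding deg_def by (rule sum_mono2) auto

lemma deg_Un: "finite X \<Longrightarrow> finite Y \<Longrightarrow> X \<inter> Y = {} \<Longrightarrow> deg inc (X \<union> Y) u = deg inc X u + deg inc Y u"
  unfolding deg_def by (rule sum.union_disjoint)

lemma deg_Diff: "finite Y \<Longrightarrow> X \<subseteq> Y \<Longrightarrow> deg inc (Y - X) u = deg inc Y u - deg inc X u"
  unfolding deg_def by (rule sum_diff_nat) (auto intro: finite_subset)

lemma deg_flip_insert:
  assumes "finite P" "finite X" "e \<notin> X"
  shows "if e \<in> P then deg inc (flip P X) u = inc e u + deg inc (flip P (insert e X)) u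
    else deg inc (flip P (insert e X)) u = inc e u + deg inc (flip P X) u"
proof (cases "e \<in> P")
  case True
  then have "flip P X = insert e (flip P (insert e X))" "e \<notin> flip P (insert e X)"
    using assms(3) by auto
  then show ?thesis
    using True assms by (metis deg_insert finite_Diff finite_UnI finite_insert)
next
  case False
  then have "flip P (insert e X) = insert e (flip P X)" "e \<notin> flip P X"
    using assms(3) by auto
  then show ?thesis
    using False assms by (metis deg_insert finite_Diff finite_UnI finite_insert)
qed

lemma even_deg_flip:
  assumes "finite P" "finite X"
  shows "even (deg inc (flip P X) u + deg inc P u + deg inc X u)"
proof -
  have "deg inc P u = deg inc (P - X) u + deg inc (P \<inter> X) u"
    "deg inc X u = deg inc (X - P) u + deg inc (P \<inter> X) u"
    "deg inc (flip P X) u = deg inc (P - X) u + deg inc (X - P) u"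
    using assms by (subst deg_Un[symmetric]; auto intro!: arg_cong[where f = "\<lambda>A. deg inc A u"])+
  then show ?thesis by presburger
qed

lemma deg_pos_ex: "finite X \<Longrightarrow> 0 < deg inc X u \<Longrightarrow> \<exists>e\<in>X. 0 < inc e u"
  unfolding deg_def by (metis not_gr_zero sum.neutral)

text \<open>\<open>X\<close> is flipped in \<open>P\<close> and in \<open>P'\<close> at once. The
  walk goes on only while both degrees at its current end \<open>t\<close> are holes, except that
  the first edge may leave \<open>v\<close> unconditionally. Edges need not alternate between
  \<open>P\<close> and \<open>P'\<close>, since only the degrees matter.\<close>

inductive trail :: "('e \<Rightarrow> 'v \<Rightarrow> nat) \<Rightarrow> ('v \<Rightarrow> nat set) \<Rightarrow> 'e set \<Rightarrow> 'e set \<Rightarrow> 'v \<Rightarrow> 'e set \<Rightarrow> 'v \<Rightarrow> bool"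
  for inc D P P' v where
  trail_start: "trail inc D P P' v {} v"
| trail_step: "trail inc D P P' v X t \<Longrightarrow>
    X = {} \<or> deg inc (flip P X) t \<notin> D t \<and> deg inc (flip P' X) t \<notin> D t \<Longrightarrow>
    e \<in> flip P P' \<Longrightarrow> e \<notin> X \<Longrightarrow> joins inc e t t' \<Longrightarrow> trail inc D P P' v (insert e X) t'"

locale jump_graph =
  fixes V :: "'v set" and E :: "'e set" and inc :: "'e \<Rightarrow> 'v \<Rightarrow> nat" and D :: "'v \<Rightarrow> nat set"
  assumes finV: "finite V" and finE: "finite E"
    and edge: "\<And>e. e \<in> E \<Longrightarrow> \<exists>a\<in>V. \<exists>b\<in>V. joins inc e a b"
    and jmp: "\<And>u. u \<in> V \<Longrightarrow> jumpy (deg inc E u) (D u)"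
begin

lemma finite_sub: "X \<subseteq> E \<Longrightarrow> finite X"
  using finE finite_subset by blast

lemma deg_le: "X \<subseteq> E \<Longrightarrow> deg inc X u \<le> deg inc E u"
  using finE by (rule deg_mono)

lemma hole_nbr:
  assumes "u \<in> V" "X \<subseteq> E" "deg inc X u \<notin> D u"
  shows "deg inc X u - 1 \<in> D u" "deg inc X u + 1 \<in> D u" "0 < deg inc X u" "deg inc X u < deg inc E u"
proof -
  note j = jmp[OF assms(1), unfolded jumpy_def]
  show "deg inc X u - 1 \<in> D u" "deg inc X u + 1 \<in> D u"
    using j deg_le[OF assms(2), of u] assms(3) by blast+
  show "0 < deg inc X u" using j assms(3) by (metis gr0I)
  show "deg inc X u < deg inc E u"
    using j deg_le[OF assms(2), of u] assms(3) by (metis le_neq_implies_less)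
qed

lemma edge_other:
  assumes "e \<in> E" "0 < inc e t"
  obtains t' where "t' \<in> V" "joins inc e t t'"
proof -
  obtain a b where ab: "a \<in> V" "b \<in> V" "joins inc e a b" using edge[OF assms(1)] by blast
  then have "t = a \<or> t = b" using assms(2) by (auto simp: joins_def)
  moreover have "joins inc e b a" using ab(3) by (auto simp: joins_def)
  ultimately show thesis using that ab by blast
qed

lemma joins_in_V: "e \<in> E \<Longrightarrow> joins inc e a b \<Longrightarrow> b \<in> V"
proof -
  assume e: "e \<in> E" "joins inc e a b"
  then have "0 < inc e b" by (simp add: joins_def)
  obtain c d where cd: "c \<in> V" "d \<in> V" "joins inc e c d" using edge[OF e(1)] by blast
  have "inc e b = of_bool (b = c) + of_bool (b = d)" using cd(3) by (simp add: joins_def)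
  with \<open>0 < inc e b\<close> have "b = c \<or> b = d" by (auto split: if_splits)
  then show "b \<in> V" using cd by blast
qed

text \<open>Holes are isolated, so any non-loop edge at a hole repairs it, whether the flip adds or
  removes the edge.\<close>

lemma unit_step:
  assumes "u \<in> V" "Y \<subseteq> E" "X \<subseteq> E" "e \<notin> X" "finite Y" "deg inc (flip Y X) u \<notin> D u" "inc e u = 1"
  shows "deg inc (flip Y (insert e X)) u \<in> D u"
proof -
  have "flip Y X \<subseteq> E" using assms by auto
  note h = hole_nbr[OF assms(1) this assms(6)]
  show ?thesis
    using deg_flip_insert[OF assms(5) finite_sub[OF assms(3)] assms(4), of inc u] h assms(7)
    by (auto split: if_splits)
qed

end

text \<open>The degrees at \<open>v\<close> itself are not constrained; \<open>first\<close> only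
  asks that the first edge, unless it is a loop, leads to admissible degrees in both sets. This
  covers two holes at \<open>v\<close>, the empty or full set paired with a set that has a hole at
  \<open>v\<close>, and the empty set paired with the full one.\<close>

locale exchange = jump_graph +
  fixes P P' :: "'b set" and v :: 'a
  assumes PE: "P \<subseteq> E" "P' \<subseteq> E" and vV: "v \<in> V"
    and others: "\<And>u. u \<in> V \<Longrightarrow> u \<noteq> v \<Longrightarrow> deg inc P u \<in> D u \<and> deg inc P' u \<in> D u"
    and first: "\<And>e t'. e \<in> flip P P' \<Longrightarrow> joins inc e v t' \<Longrightarrow> t' \<noteq> v \<Longrightarrow>
      deg inc (flip P {e}) v \<in> D v \<and> deg inc (flip P' {e}) v \<in> D v"
begin

abbreviation "tr \<equiv> trail inc D P P' v"

lemma tr_basic: "tr X t \<Longrightarrow> X \<subseteq> flip P P' \<and> t \<in> V"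
proof (induction rule: trail.induct)
  case trail_start
  then show ?case using vV by simp
next
  case (trail_step X t e t')
  moreover have "e \<in> E" using trail_step.hyps(3) PE by auto
  ultimately show ?case using joins_in_V[of e t t'] trail_step.hyps by simp
qed

lemma tr_flips: assumes "tr X t" shows "flip P X \<subseteq> E" "flip P' X \<subseteq> E" "finite X" "X \<subseteq> E"
  using tr_basic[OF assms] PE finite_sub[of X] by blast+

lemma finP: "finite P" "finite P'"
  using PE finite_sub by blast+

lemma tr_parity: "tr X t \<Longrightarrow> even (deg inc X u + of_bool (u = v) + of_bool (u = t))"
proof (induction rule: trail.induct)
  case trail_start
  then show ?case by simp
next
  case (trail_step X t e t')
  have "deg inc (insert e X) u = inc e u + deg inc X u"
    by (rule deg_insert[OF tr_flips(3)[OF trail_step.hyps(1)] trail_step.hyps(4)])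
  moreover have "inc e u = of_bool (u = t) + of_bool (u = t')"
    using trail_step.hyps by (simp add: joins_def)
  ultimately show ?case using trail_step.IH by (auto split: if_splits)
qed

lemma unit_zero:
  assumes "Y \<subseteq> E" "X \<subseteq> E" "e \<notin> X" "inc e u = 0"
  shows "deg inc (flip Y (insert e X)) u = deg inc (flip Y X) u"
  using deg_flip_insert[OF finite_sub[OF assms(1)] finite_sub[OF assms(2)] assms(3), of inc u] assms(4)
  by (auto split: if_splits)

text \<open>A vertex is left only when it is a hole for both sets, and a non-loop edge then changes
  both degrees by one, into \<open>D u\<close>; the first departure from \<open>v\<close> is covered
  by \<open>first\<close>. Hence all defects sit at the current end.\<close>

lemma tr_fine:
  "tr X t \<Longrightarrow> u \<in> V \<Longrightarrow> u \<noteq> t \<Longrightarrow> deg inc (flip P X) u \<in> D u \<and> deg inc (flip P' X) u \<in> D u"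
proof (induction arbitrary: u rule: trail.induct)
  case trail_start
  then show ?case using others by simp
next
  case (trail_step X t e t')
  note X = tr_flips[OF trail_step.hyps(1)]
  show ?case
  proof (cases "u = t")
    case False
    then have "inc e u = 0" using trail_step.hyps(5) trail_step.prems(2) by (simp add: joins_def)
    then show ?thesis
      using unit_zero[OF PE(1) X(4) trail_step.hyps(4)] unit_zero[OF PE(2) X(4) trail_step.hyps(4)]
        trail_step.IH[OF trail_step.prems(1) False] by simp
  next
    case True
    then have i: "inc e u = 1" using trail_step.hyps(5) trail_step.prems(2) by (simp add: joins_def)
    from trail_step.hyps(2) show ?thesis
    proof
      assume "X = {}"
      then have "t = v" using trail_step.hyps(1) by (auto elim: trail.cases)
      then show ?thesis using first[of e t'] trail_step.hyps(3,5) trail_step.prems(2) \<open>X = {}\<close> True by auto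
    next
      assume "deg inc (flip P X) t \<notin> D t \<and> deg inc (flip P' X) t \<notin> D t"
      then show ?thesis
        using unit_step[OF trail_step.prems(1) PE(1) X(4) trail_step.hyps(4) finP(1)]
          unit_step[OF trail_step.prems(1) PE(2) X(4) trail_step.hyps(4) finP(2)] i True by simp
    qed
  qed
qed

lemma deg_exhausted:
  assumes "X \<subseteq> flip P P'" "\<And>e. e \<in> flip P P' - X \<Longrightarrow> inc e t = 0"
  shows "deg inc (flip P X) t = deg inc P' t" "deg inc (flip P' X) t = deg inc P t"
proof -
  have "deg inc (flip P X) t = deg inc (flip P X \<inter> P') t"
    unfolding deg_def
    by (rule sum.mono_neutral_right) (use assms(1) assms(2)[unfolded Diff_iff] finP finite_sub[of X] PE in blast)+
  also have "\<dots> = deg inc P' t"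
    unfolding deg_def
    by (rule sum.mono_neutral_left) (use assms(1) assms(2)[unfolded Diff_iff] finP finite_sub[of X] PE in blast)+
  finally show 1: "deg inc (flip P X) t = deg inc P' t" .
  have "deg inc (flip P X) t + deg inc (flip P' X) t = deg inc P t + deg inc P' t"
    unfolding deg_def by (rule sum_flip) (use finP assms in auto)
  with 1 show "deg inc (flip P' X) t = deg inc P t" by simp
qed

text \<open>Take a trail with as many edges as possible. If both degrees at its end \<open>t\<close>
  are holes, all edges of the difference at \<open>t\<close> are used, so the two degrees at
  \<open>t\<close> have been exchanged; for \<open>t \<noteq> v\<close> they would be admissible.
  Hence a trail can get stuck only at \<open>v\<close>.\<close>

lemma tr_final:
  assumes "e0 \<in> flip P P'" "0 < inc e0 v"
  obtains X t where "tr X t" "X \<noteq> {}"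
    "\<not> (deg inc (flip P X) t \<notin> D t \<and> deg inc (flip P' X) t \<notin> D t) \<or>
     t = v \<and> deg inc P v \<notin> D v \<and> deg inc P' v \<notin> D v \<and>
       deg inc (flip P X) v = deg inc P' v \<and> deg inc (flip P' X) v = deg inc P v \<and>
       deg inc (flip P X) v \<notin> D v \<and> deg inc (flip P' X) v \<notin> D v"
proof -
  let ?S = "{X. \<exists>t. tr X t}"
  have fin: "finite ?S"
    by (rule finite_subset[of _ "Pow E"]) (use tr_flips(4) finE in auto)
  have "{} \<in> ?S" by (auto intro: trail_start)
  obtain X where X: "X \<in> ?S" and mx: "\<And>Y. Y \<in> ?S \<Longrightarrow> card Y \<le> card X"
  proof -
    have "Max (card ` ?S) \<in> card ` ?S" using fin \<open>{} \<in> ?S\<close> by (intro Max_in) auto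
    then obtain X where "Max (card ` ?S) = card X" "X \<in> ?S" by (rule imageE)
    then show ?thesis using that[of X] fin by (metis Max_ge finite_imageI imageI)
  qed
  then obtain t where t: "tr X t" by blast
  have stop: "inc e t = 0" if "X = {} \<or> deg inc (flip P X) t \<notin> D t \<and> deg inc (flip P' X) t \<notin> D t"
    "e \<in> flip P P' - X" for e
  proof (rule ccontr)
    assume "inc e t \<noteq> 0"
    moreover have "e \<in> E" using that(2) PE by auto
    ultimately obtain t' where "joins inc e t t'" using edge_other[of e t] by blast
    then have "tr (insert e X) t'" using trail_step[OF t that(1), of e t'] that(2) by blast
    then have "card (insert e X) \<le> card X" using mx by blast
    then show False using that(2) tr_flips(3)[OF t] by simp
  qed
  have "X \<noteq> {}"
  proof
    assume "X = {}"
    then have "t = v" using t by (auto elim: trail.cases)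
    then show False using stop[of e0] assms \<open>X = {}\<close> by auto
  qed
  moreover have "t = v \<and> deg inc P v \<notin> D v \<and> deg inc P' v \<notin> D v \<and>
       deg inc (flip P X) v = deg inc P' v \<and> deg inc (flip P' X) v = deg inc P v"
    if b: "deg inc (flip P X) t \<notin> D t \<and> deg inc (flip P' X) t \<notin> D t"
  proof -
    have "deg inc (flip P X) t = deg inc P' t" "deg inc (flip P' X) t = deg inc P t"
      using deg_exhausted[of X t] stop tr_basic[OF t] b by blast+
    with b others[of t] tr_basic[OF t] show ?thesis by metis
  qed
  ultimately show thesis using that[OF t] by metis
qed

text \<open>For nested sets the degree in \<open>P \<union> X\<close> only grows. Each departure
  from \<open>u\<close> happens at a hole whose offset from \<open>deg inc P u\<close> is odd by
  \<open>tr_parity\<close>, so the next even offset is admissible. This is how a trail certifies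
  \<open>good\<close>.\<close>

lemma tr_run:
  assumes "P \<subseteq> P'"
  shows "tr X t \<Longrightarrow> u \<in> V \<Longrightarrow> u \<noteq> v \<Longrightarrow> even j \<Longrightarrow> j \<le> deg inc X u \<Longrightarrow> (u = t \<Longrightarrow> j < deg inc X u) \<Longrightarrow>
    deg inc P u + j \<in> D u"
proof (induction arbitrary: u j rule: trail.induct)
  case trail_start
  then show ?case using others by simp
next
  case (trail_step X t e t')
  note X = tr_flips[OF trail_step.hyps(1)]
  have d: "deg inc (insert e X) u = inc e u + deg inc X u"
    by (rule deg_insert[OF X(3) trail_step.hyps(4)])
  have i: "inc e u = of_bool (u = t) + of_bool (u = t')"
    using trail_step.hyps by (simp add: joins_def)
  have XP: "X \<inter> P = {}" using tr_basic[OF trail_step.hyps(1)] assms by blast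
  have fl: "flip P X = P \<union> X" using XP by blast
  show ?case
  proof (cases "u = t")
    case False
    then have "j \<le> deg inc X u"
      using trail_step.prems(4,5) d i by (cases "u = t'") simp_all
    then show ?thesis using trail_step.IH[of u j] trail_step.prems False by blast
  next
    case True
    have "X \<noteq> {}" using trail_step.prems(2) True trail_step.hyps(1) by (auto elim: trail.cases)
    then have "deg inc (P \<union> X) t \<notin> D t" using trail_step.hyps(2) fl by auto
    then have "deg inc P t + deg inc X t + 1 \<in> D t"
      using hole_nbr(2)[of t "P \<union> X"] tr_basic[OF trail_step.hyps(1)] X(3,4) PE deg_Un[of P X inc t] finP XP
      by (metis Int_commute Un_least)
    moreover have "odd (deg inc X t)"
      using tr_parity[OF trail_step.hyps(1), of t] trail_step.prems(2) True by auto
    moreover have "j < deg inc X t \<or> j = deg inc X t \<or> j = deg inc X t + 1"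
      using trail_step.prems(4,5) d i True by (cases "t = t'") auto
    ultimately show ?thesis
      using trail_step.IH[of u j] trail_step.prems True by (auto simp: add.assoc)
  qed
qed

text \<open>While both degrees at \<open>v\<close> are holes of odd parity, they move in steps of at most two and
  cannot jump over the element \<open>g - 1\<close> of \<open>D v\<close>.\<close>

lemma tr_barrier:
  assumes Y: "Y = P \<or> Y = P'" and st: "deg inc Y v \<notin> D v" "odd (deg inc Y v)" "deg inc Y v < g"
    and g: "even g" "g - 1 \<in> D v"
  shows "tr X t \<Longrightarrow> deg inc (flip Y X) v + 2 \<le> g + of_bool (t = v)"
proof (induction rule: trail.induct)
  case trail_start
  have "deg inc Y v \<noteq> g - 1" using st g by metis
  then show ?case using st by simp
next
  case (trail_step X t e t')
  have YE: "Y \<subseteq> E" using Y PE by blast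
  note X = tr_flips[OF trail_step.hyps(1)]
  note f = deg_flip_insert[OF finite_sub[OF YE] X(3) trail_step.hyps(4), of inc v]
  have i: "inc e v = of_bool (v = t) + of_bool (v = t')"
    using trail_step.hyps(5) by (simp add: joins_def)
  show ?case
  proof (cases "t = v")
    case True
    have "odd (deg inc (flip Y X) v)"
      using tr_parity[OF trail_step.hyps(1), of v] even_deg_flip[OF finite_sub[OF YE] X(3), of inc v] st(2) True
      by simp
    moreover have "deg inc (flip Y X) v \<notin> D v"
      using trail_step.hyps(1,2) st(1) Y True by auto
    ultimately have "odd (deg inc (flip Y X) v)" "deg inc (flip Y X) v \<noteq> g - 1"
      using g(2) by metis+
    moreover have "r + 3 \<le> g" if "odd r" "r \<noteq> g - 1" "r + 2 \<le> g + 1" for r :: nat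
      using that g(1) by presburger
    ultimately have "deg inc (flip Y X) v + 3 \<le> g"
      using trail_step.IH True by simp
    then show ?thesis using f i True by (auto split: if_splits)
  next
    case False
    then show ?thesis using f i trail_step.IH by (auto split: if_splits)
  qed
qed

end

section \<open>Minimal counterexamples\<close>

lemma sum_upd:
  fixes w :: "'e \<Rightarrow> int"
  assumes "finite X"
  shows "sum (w(e := w e + a)) X = sum w X + (if e \<in> X then a else 0)"
proof (cases "e \<in> X")
  case True
  have "sum (w(e := w e + a)) X = (w e + a) + sum (w(e := w e + a)) (X - {e})"
    using assms True by (subst sum.remove[of X e]) auto
  also have "sum (w(e := w e + a)) (X - {e}) = sum w (X - {e})" by (rule sum.cong) auto
  also have "(w e + a) + sum w (X - {e}) = sum w X + a" using assms True by (subst sum.remove[of X e w]) auto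
  finally show ?thesis using True by simp
next
  case False
  then have "sum (w(e := w e + a)) X = sum w X" by (intro sum.cong) auto
  then show ?thesis using False by simp
qed

lemma holes_mono:
  assumes "finite V" "bad V d' D' \<subseteq> bad V d D"
    and "\<And>u. u \<in> bad V d' D' \<Longrightarrow> card {k. k \<le> d' u \<and> k \<notin> D' u} \<le> card {k. k \<le> d u \<and> k \<notin> D u}"
  shows "holes V d' D' \<le> holes V d D"
proof -
  have "holes V d' D' \<le> (\<Sum>u\<in>bad V d' D'. card {k. k \<le> d u \<and> k \<notin> D u})"
    unfolding holes_def using assms(3) by (rule sum_mono)
  also have "\<dots> \<le> holes V d D"
    unfolding holes_def using assms(1,2) by (intro sum_mono2) (auto simp: bad_def)
  finally show ?thesis .
qed

text \<open>\<open>evens\<close> is a normalization of the good vertices. In \<open>IH\<close> the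
  constraints and the weights are arbitrary, which allows filling a hole, shifting the degrees and
  changing the weight of a single edge.\<close>

locale minimal_cex = jump_graph V E inc D for V :: "'v set" and E :: "'e set" and inc D +
  fixes w :: "'e \<Rightarrow> int"
  assumes bad3: "3 \<le> card (bad V (deg inc E) D)"
    and pos: "0 < sum w E"
    and NP: "\<And>I. I \<subset> E \<Longrightarrow> feas V inc D I \<Longrightarrow> sum w I \<le> 0"
    and evens: "\<And>u. u \<in> V \<Longrightarrow> good (deg inc E u) (D u) \<Longrightarrow> D u = {k. even k}"
    and IH: "\<And>E' D' w'. E' \<subseteq> E \<Longrightarrow>
      card E' + holes V (deg inc E') D' < card E + holes V (deg inc E) D \<Longrightarrow>
      (\<And>u. u \<in> V \<Longrightarrow> jumpy (deg inc E' u) (D' u)) \<Longrightarrow>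
      3 \<le> card (bad V (deg inc E') D') \<Longrightarrow> 0 < sum w' E' \<Longrightarrow>
      \<exists>I\<subset>E'. feas V inc D' I \<and> 0 < sum (w' :: 'e \<Rightarrow> int) I"
begin

abbreviation "d \<equiv> deg inc E"
abbreviation "dg \<equiv> deg inc"
abbreviation "BD \<equiv> bad V d D"

definition near :: "'v \<Rightarrow> 'e set \<Rightarrow> bool" where
  "near v Q \<longleftrightarrow> v \<in> BD \<and> Q \<subseteq> E \<and> dg Q v \<notin> D v \<and> (\<forall>u\<in>V - {v}. dg Q u \<in> D u)"

lemma feas_E: "feas V inc D E"
  using jmp by (auto simp: feas_def jumpy_def)

lemma D0: "u \<in> V \<Longrightarrow> 0 \<in> D u" "u \<in> V \<Longrightarrow> d u \<in> D u"
  using jmp by (auto simp: jumpy_def)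

lemma near_not_feas: "near v Q \<Longrightarrow> \<not> feas V inc D Q"
  by (auto simp: near_def feas_def bad_def)

lemma near_psub: "near v Q \<Longrightarrow> Q \<subset> E"
  using near_not_feas feas_E by (auto simp: near_def)

lemma BD_V: "v \<in> BD \<Longrightarrow> v \<in> V"
  by (simp add: bad_def)

text \<open>Flipping preserves the sum of the two degrees at \<open>t\<close>. At a vertex that is
  not bad, \<open>D t\<close> consists of the even numbers and both original degrees are even, so
  the new ones are admissible together or not at all. A one-sided failure therefore occurs at a bad
  vertex, as \<open>near\<close> requires.\<close>

lemma exchange_outcome:
  assumes ex: "exchange V E inc D P P' v" and v: "v \<in> BD"
    and tr: "trail inc D P P' v X t"
    and nb: "dg (flip P X) t \<in> D t \<or> dg (flip P' X) t \<in> D t"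
    and X0: "X \<noteq> {}"
  obtains "feas V inc D (flip P X)" "feas V inc D (flip P' X)"
  | "near t (flip P X)" "feas V inc D (flip P' X)"
  | "feas V inc D (flip P X)" "near t (flip P' X)"
proof -
  interpret exchange V E inc D P P' v by (rule ex)
  have tV: "t \<in> V" and XM: "X \<subseteq> flip P P'" using tr_basic[OF tr] by auto
  have bt: "t \<in> BD" if one: "(dg (flip P X) t \<in> D t) \<noteq> (dg (flip P' X) t \<in> D t)"
  proof (rule ccontr)
    assume "t \<notin> BD"
    then have D: "D t = {k. even k}" using evens tV by (auto simp: bad_def)
    have "t \<noteq> v" using \<open>t \<notin> BD\<close> v by blast
    then have "even (dg P t)" "even (dg P' t)" using others[of t] tV D by auto
    moreover have "dg (flip P X) t + dg (flip P' X) t = dg P t + dg P' t"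
      unfolding deg_def by (rule sum_flip) (use finP XM in auto)
    ultimately show False using one D by (metis even_add mem_Collect_eq)
  qed
  note F = tr_fine[OF tr] and S = tr_flips[OF tr]
  show thesis
  proof (cases "dg (flip P X) t \<in> D t")
    case True
    then have "feas V inc D (flip P X)" using F unfolding feas_def by metis
    moreover have "feas V inc D (flip P' X) \<or> near t (flip P' X)"
      using F bt True S(2) unfolding feas_def near_def by blast
    ultimately show thesis using that by blast
  next
    case False
    then have "dg (flip P' X) t \<in> D t" using nb by blast
    then have "feas V inc D (flip P' X)" using F unfolding feas_def by metis
    moreover have "near t (flip P X)"
      using F bt False \<open>dg (flip P' X) t \<in> D t\<close> S(1) unfolding near_def by blast
    ultimately show thesis using that by blast
  qed
qed

text \<open>Fills the hole \<open>k\<close>. The weight of \<open>e\<close> is lowered until the total weight is \<open>1\<close>, so that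
  a set through \<open>e\<close> comes out with the full weight; this is needed when the union of \<open>P\<close> and
  \<open>Q\<close> below exhausts all edges.\<close>

lemma partner:
  assumes v: "v \<in> BD" and k: "k \<le> d v" "k \<notin> D v" and still: "\<not> good (d v) (insert k (D v))"
    and e: "e \<in> E"
  obtains P where "near v P" "dg P v = k" "e \<notin> P \<and> 0 < sum w P \<or> e \<in> P \<and> sum w E \<le> sum w P"
proof -
  define D' where "D' = D(v := insert k (D v))"
  define w' where "w' = w(e := w e + (1 - sum w E))"
  have b: "bad V d D' = BD"
  proof -
    have "u \<in> bad V d D' \<longleftrightarrow> u \<in> BD" for u
      using v still by (cases "u = v") (auto simp: bad_def D'_def)
    then show ?thesis by blast
  qed
  have vf: "finite BD" using finV by (simp add: bad_def)
  have "holes V d D' < holes V d D"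
    unfolding holes_def b
  proof (rule sum_strict_mono_ex1[OF vf])
    show "\<forall>x\<in>BD. card {k. k \<le> d x \<and> k \<notin> D' x} \<le> card {k. k \<le> d x \<and> k \<notin> D x}"
      by (auto intro!: card_mono simp: D'_def)
    have "card {k. k \<le> d v \<and> k \<notin> D' v} < card {k. k \<le> d v \<and> k \<notin> D v}"
      by (rule psubset_card_mono) (use k in \<open>auto simp: D'_def\<close>)
    then show "\<exists>a\<in>BD. card {k. k \<le> d a \<and> k \<notin> D' a} < card {k. k \<le> d a \<and> k \<notin> D a}"
      using v by blast
  qed
  moreover have "jumpy (d u) (D' u)" if "u \<in> V" for u
    using jmp[OF that] unfolding jumpy_def by (auto simp: D'_def)
  moreover have "0 < sum w' E"
    unfolding w'_def using e finE by (subst sum_upd) auto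
  ultimately obtain I where I: "I \<subset> E" "feas V inc D' I" "0 < sum w' I"
    using IH[of E D' w'] b bad3 by auto
  have wI: "sum w' I = sum w I + (if e \<in> I then 1 - sum w E else 0)"
    unfolding w'_def by (rule sum_upd) (use I finite_sub in blast)
  have "0 < sum w I" using wI I(3) pos by (auto split: if_splits)
  then have "\<not> feas V inc D I" using NP[OF I(1)] by auto
  moreover have "dg I u \<in> D u" if "u \<in> V" "u \<noteq> v" for u
    using I(2) that by (auto simp: feas_def D'_def)
  moreover have "dg I v \<in> insert k (D v)"
    using I(2) BD_V[OF v] by (auto simp: feas_def D'_def)
  ultimately have "near v I" "dg I v = k"
    using v I(1) unfolding near_def feas_def by blast+
  moreover have "e \<notin> I \<and> 0 < sum w I \<or> e \<in> I \<and> sum w E \<le> sum w I"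
    using wI I(3) by (auto split: if_splits)
  ultimately show thesis using that by blast
qed

end

section \<open>Exchanges with an extremal violation at a single vertex\<close>

locale extremal = minimal_cex V E inc D w for V :: "'v set" and E :: "'e set" and inc D w +
  fixes v :: 'v and Q :: "'e set"
  assumes nearQ: "near v Q" and fpos: "0 < sum w Q"
    and maxw: "\<And>u R. near u R \<Longrightarrow> sum w R \<le> sum w Q"
    and minc: "\<And>u R. near u R \<Longrightarrow> sum w R = sum w Q \<Longrightarrow> card Q \<le> card R"
begin

lemma v: "v \<in> BD" "v \<in> V" and QE: "Q \<subset> E" and hole: "dg Q v \<notin> D v"
  and Qo: "u \<in> V \<Longrightarrow> u \<noteq> v \<Longrightarrow> dg Q u \<in> D u"
  using nearQ near_psub[OF nearQ] by (auto simp: near_def bad_def)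

lemma hn: "dg Q v - 1 \<in> D v" "dg Q v + 1 \<in> D v" "0 < dg Q v" "dg Q v < d v"
  using hole_nbr[OF v(2) _ hole] QE by blast+

lemma fin: "finite E" "finite Q" "finite (E - Q)"
  using finE QE finite_sub by auto

text \<open>The two sets produced by the trail partition \<open>Q\<close> and share its positive
  weight. Since proper feasible sets have weight at most 0, extremality leaves only
  \<open>X = Q\<close>, a closed trail at \<open>v\<close> through all edges of \<open>Q\<close>;
  parity and \<open>tr_run\<close> then make every other vertex good within
  \<open>Q\<close>.\<close>

lemma ex_empty:
  assumes one: "1 \<in> D v"
  shows "even (dg Q v)" "u \<in> V \<Longrightarrow> u \<noteq> v \<Longrightarrow> good (dg Q u) (D u)"
proof -
  interpret exchange V E inc D "{}" Q v
  proof
    fix e t' assume e: "e \<in> flip {} Q" "joins inc e v t'" "t' \<noteq> v"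
    then have i: "inc e v = 1" by (simp add: joins_def)
    have "dg Q v = inc e v + dg (Q - {e}) v"
      using e fin deg_insert[of "Q - {e}" e inc v] by (simp add: insert_absorb)
    then have "dg (Q - {e}) v = dg Q v - 1" using i by simp
    then show "dg (flip {} {e}) v \<in> D v \<and> dg (flip Q {e}) v \<in> D v"
      using hn(1) one i e by (simp add: insert_absorb deg_def)
  qed (use QE Qo D0 v in auto)
  obtain e0 where "e0 \<in> Q" "0 < inc e0 v" using deg_pos_ex[OF fin(2) hn(3)] by blast
  then obtain X t where X: "tr X t" "X \<noteq> {}"
    "dg (flip {} X) t \<in> D t \<or> dg (flip Q X) t \<in> D t"
    using tr_final[of e0] D0 v by (metis Diff_empty UnCI deg_empty empty_Diff)
  have XQ: "X \<subseteq> Q" using tr_basic[OF X(1)] by auto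
  have fl: "flip {} X = X" "flip Q X = Q - X" using XQ by auto
  have sub: "X \<subset> E" "Q - X \<subset> E" using XQ QE by auto
  have s: "sum w X + sum w (Q - X) = sum w Q"
    using XQ fin sum.subset_diff[of X Q w] by simp
  have main: "X = Q \<and> near t Q"
    using exchange_axioms v(1) X(1,3,2)
  proof (rule exchange_outcome; unfold fl)
    assume "feas V inc D X" "feas V inc D (Q - X)"
    then show ?thesis using NP[OF sub(1)] NP[OF sub(2)] s fpos by simp
  next
    assume n: "near t X" and "feas V inc D (Q - X)"
    then have "sum w Q \<le> sum w X" using NP[OF sub(2)] s by simp
    then have "card Q \<le> card X" using minc[OF n] maxw[OF n] by simp
    then have "X = Q" using XQ fin card_seteq by blast
    then show ?thesis using n by simp
  next
    assume "feas V inc D X" and n: "near t (Q - X)"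
    then have "sum w Q \<le> sum w (Q - X)" using NP[OF sub(1)] s by simp
    then have "card Q \<le> card (Q - X)" using minc[OF n] maxw[OF n] by simp
    then have "Q - X = Q" using fin card_seteq by (metis Diff_subset)
    then show ?thesis using XQ X(2) by blast
  qed
  then have t: "t = v" using Qo hole BD_V by (auto simp: near_def)
  then have tr: "tr Q v" using X(1) main by simp
  show "even (dg Q v)" using tr_parity[OF tr, of v] by simp
  show "good (dg Q u) (D u)" if "u \<in> V" "u \<noteq> v"
    using tr_parity[OF tr, of u] tr_run[OF _ tr that] that by (auto simp: good_def)
qed

text \<open>The flipped sets share the weight \<open>sum w Q + sum w E\<close>. Now
  \<open>Q \<union> X\<close> may be all of \<open>E\<close>, to which \<open>NP\<close> does not
  apply; this is exactly the case of a closed trail at \<open>v\<close> through the complement of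
  \<open>Q\<close>. Every other alternative contradicts \<open>NP\<close> or exceeds the maximal
  weight.\<close>

lemma ex_full:
  assumes one: "d v - 1 \<in> D v"
  shows "even (d v - dg Q v)"
    "u \<in> V \<Longrightarrow> u \<noteq> v \<Longrightarrow> even (d u - dg Q u)"
    "u \<in> V \<Longrightarrow> u \<noteq> v \<Longrightarrow> even j \<Longrightarrow> j \<le> d u - dg Q u \<Longrightarrow> dg Q u + j \<in> D u"
proof -
  interpret exchange V E inc D Q E v
  proof
    fix e t' assume "e \<in> flip Q E" and j: "joins inc e v t'" "t' \<noteq> v"
    then have e: "e \<in> E" "e \<notin> Q" using QE by auto
    have i: "inc e v = 1" using j by (simp add: joins_def)
    have "d v = inc e v + dg (E - {e}) v"
      using e fin deg_insert[of "E - {e}" e inc v] by (simp add: insert_absorb)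
    then have "dg (E - {e}) v = d v - 1" using i by simp
    moreover have "flip Q {e} = insert e Q" "flip E {e} = E - {e}" using e by auto
    ultimately show "dg (flip Q {e}) v \<in> D v \<and> dg (flip E {e}) v \<in> D v"
      using hn(2) one i e fin by (simp add: deg_insert)
  qed (use QE Qo D0 v in auto)
  have fd: "dg (E - Q) u = d u - dg Q u" for u using deg_Diff[of E Q inc u] fin QE by blast
  have "0 < dg (E - Q) v" using fd[of v] hn by simp
  from deg_pos_ex[OF fin(3) this] obtain e0 where e0: "e0 \<in> E - Q" "0 < inc e0 v" by (rule bexE)
  have "e0 \<in> flip Q E" using e0 by simp
  from tr_final[OF this e0(2)] obtain X t where X: "tr X t" "X \<noteq> {}"
    "dg (flip Q X) t \<in> D t \<or> dg (flip E X) t \<in> D t"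
    using D0(2)[OF v(2)] by (metis (no_types, lifting))
  have XQ: "X \<subseteq> E - Q" using tr_basic[OF X(1)] QE by blast
  have fl: "flip Q X = Q \<union> X" "flip E X = E - X" using XQ by auto
  have R: "Q \<union> X \<subseteq> E" "E - X \<subset> E" using XQ QE X(2) by auto
  have s: "sum w (Q \<union> X) + sum w (E - X) = sum w Q + sum w E"
    using sum_flip[of Q E X w] XQ fin fl by auto
  have RE: "X = E - Q \<and> E - X = Q" if "Q \<union> X = E" using that XQ QE by blast
  have main: "X = E - Q \<and> near t Q"
    using exchange_axioms v(1) X(1,3,2)
  proof (rule exchange_outcome; unfold fl)
    assume a: "feas V inc D (Q \<union> X)" "feas V inc D (E - X)"
    have "Q \<union> X \<noteq> E"
    proof
      assume "Q \<union> X = E"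
      from RE[OF this] have "E - X = Q" by (rule conjunct2)
      then show False using a(2) near_not_feas[OF nearQ] by simp
    qed
    then have "sum w (Q \<union> X) \<le> 0" using NP[OF psubsetI[OF R(1)] a(1)] by blast
    then show ?thesis using NP[OF R(2) a(2)] s fpos pos by linarith
  next
    assume n: "near t (Q \<union> X)" and a: "feas V inc D (E - X)"
    show ?thesis using NP[OF R(2) a] maxw[OF n] s pos by linarith
  next
    assume a: "feas V inc D (Q \<union> X)" and n: "near t (E - X)"
    have "Q \<union> X = E"
    proof (rule ccontr)
      assume "Q \<union> X \<noteq> E"
      then have "sum w (Q \<union> X) \<le> 0" using NP[OF psubsetI[OF R(1)] a] by blast
      then show False using maxw[OF n] s pos by linarith
    qed
    from RE[OF this] show ?thesis using n by (elim conjE) simp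
  qed
  then have t: "t = v" using Qo hole BD_V by (auto simp: near_def)
  then have tr: "tr (E - Q) v" using X(1) main by simp
  show "even (d v - dg Q v)" using tr_parity[OF tr, of v] fd by simp
  show "even (d u - dg Q u)" if "u \<in> V" "u \<noteq> v"
    using tr_parity[OF tr, of u] fd that by simp
  show "dg Q u + j \<in> D u" if "u \<in> V" "u \<noteq> v" "even j" "j \<le> d u - dg Q u"
    using tr_run[OF _ tr that(1,2,3)] that QE fd by auto
qed

text \<open>The two exchanged sets together weigh \<open>sum w P + sum w Q\<close>, which exceeds
  \<open>sum w Q\<close>, and a proper feasible set contributes at most 0. So two feasible sets
  would weigh too little, and a violating one would be heavier than \<open>Q\<close>. A trail stuck
  at \<open>v\<close> is excluded by \<open>noswap\<close>; a result equal to \<open>E\<close> is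
  not proper and needs \<open>fullcase\<close>.\<close>

lemma no_partner:
  assumes P: "near v P" "dg P v \<noteq> dg Q v"
    and e: "e \<in> E - Q" "e \<notin> P \<and> 0 < sum w P \<or> e \<in> P \<and> sum w E \<le> sum w P"
    and noswap: "\<And>X. exchange V E inc D P Q v \<Longrightarrow> trail inc D P Q v X v \<Longrightarrow> dg (flip P X) v = dg Q v \<Longrightarrow>
      dg (flip Q X) v = dg P v \<Longrightarrow> False"
  shows False
proof -
  have PsE: "P \<subset> E" and Po: "\<And>u. u \<in> V \<Longrightarrow> u \<noteq> v \<Longrightarrow> dg P u \<in> D u" and hP: "dg P v \<notin> D v"
    using P near_psub by (auto simp: near_def)
  interpret exchange V E inc D P Q v
  proof
    fix e t' assume "e \<in> flip P Q" and j: "joins inc e v t'" "t' \<noteq> v"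
    then have i: "inc e v = 1" by (simp add: joins_def)
    have "dg (flip Y (insert e {})) v \<in> D v" if "Y \<subseteq> E" "dg Y v \<notin> D v" for Y
      using unit_step[OF v(2) that(1) _ _ finite_sub[OF that(1)], of "{}" e] that(2) i by simp
    then show "dg (flip P {e}) v \<in> D v \<and> dg (flip Q {e}) v \<in> D v"
      using hP hole PsE QE by auto
  qed (use PsE QE Qo Po v in auto)
  have "\<exists>e0\<in>flip P Q. 0 < inc e0 v"
    using deg_exhausted[of "{}" v] P(2) by (metis Diff_empty Un_empty_right empty_Diff empty_subsetI gr0I)
  then obtain X t where X: "tr X t" "X \<noteq> {}"
    and or: "\<not> (dg (flip P X) t \<notin> D t \<and> dg (flip Q X) t \<notin> D t) \<or>
     t = v \<and> dg P v \<notin> D v \<and> dg Q v \<notin> D v \<and>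
       dg (flip P X) v = dg Q v \<and> dg (flip Q X) v = dg P v \<and>
       dg (flip P X) v \<notin> D v \<and> dg (flip Q X) v \<notin> D v"
    using tr_final by metis
  have nb: "dg (flip P X) t \<in> D t \<or> dg (flip Q X) t \<in> D t"
    using or X(1) noswap[OF exchange_axioms] by blast
  have XM: "X \<subseteq> flip P Q" using tr_basic[OF X(1)] by blast
  have s: "sum w (flip P X) + sum w (flip Q X) = sum w P + sum w Q"
    by (rule sum_flip) (use finP XM in auto)
  have sE: "flip P X \<subseteq> E" "flip Q X \<subseteq> E" using tr_flips[OF X(1)] by auto
  have wP: "0 < sum w P" using e(2) pos by auto
  \<comment> \<open>If one result is \<open>E\<close>, the other is \<open>P \<inter> Q\<close>, and
    \<open>e\<close> lies in \<open>P\<close>. The second alternative for \<open>P\<close> then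
    gives this intersection at least the weight of \<open>Q\<close>, although it is a proper subset
    of \<open>Q\<close>.\<close>
  have fullcase: False
    if full: "A = E" and inter: "A \<inter> A' = P \<inter> Q" and un: "A \<union> A' = P \<union> Q" and AE: "A' \<subseteq> E"
      and sA: "sum w A + sum w A' = sum w P + sum w Q"
      and fe: "feas V inc D A' \<or> near t A'" for A A'
  proof -
    have A': "A' = P \<inter> Q" using inter full AE by blast
    have "e \<in> P" using un full e(1) by auto
    then have ge: "sum w Q \<le> sum w A'" using e(2) sA full by auto
    have "P \<union> Q = E" using un full AE by auto
    have "\<not> Q \<subseteq> P"
    proof
      assume "Q \<subseteq> P"
      then have "P \<union> Q = P" by blast
      then show False using PsE \<open>P \<union> Q = E\<close> by simp
    qed
    then have lt: "A' \<subset> Q" using A' by auto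
    from fe show False
    proof
      assume "feas V inc D A'"
      then show False using NP[of A'] lt QE ge fpos by auto
    next
      assume n: "near t A'"
      then show False using minc[OF n] maxw[OF n] ge psubset_card_mono[OF fin(2) lt] by simp
    qed
  qed
  have iu: "flip P X \<inter> flip Q X = P \<inter> Q" "flip P X \<union> flip Q X = P \<union> Q"
    "flip Q X \<inter> flip P X = P \<inter> Q" "flip Q X \<union> flip P X = P \<union> Q"
    using XM by blast+
  have s': "sum w (flip Q X) + sum w (flip P X) = sum w P + sum w Q" using s by simp
  show False
    using exchange_axioms v(1) X(1) nb X(2)
  proof (rule exchange_outcome)
    assume a: "feas V inc D (flip P X)" "feas V inc D (flip Q X)"
    show False
    proof (cases "flip P X = E \<or> flip Q X = E")
      case True
      then show False
      proof
        assume "flip P X = E"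
        from fullcase[OF this iu(1,2) sE(2) s disjI1[OF a(2)]] show False .
      next
        assume "flip Q X = E"
        from fullcase[OF this iu(3,4) sE(1) s' disjI1[OF a(1)]] show False .
      qed
    next
      case False
      then have "sum w (flip P X) \<le> 0" "sum w (flip Q X) \<le> 0"
        using NP[OF psubsetI[OF sE(1)] a(1)] NP[OF psubsetI[OF sE(2)] a(2)] by blast+
      then show False using s fpos wP by linarith
    qed
  next
    assume a: "near t (flip P X)" "feas V inc D (flip Q X)"
    show False
    proof (cases "flip Q X = E")
      case True
      from fullcase[OF this iu(3,4) sE(1) s' disjI2[OF a(1)]] show False .
    next
      case False
      then have "sum w (flip Q X) \<le> 0" using NP[OF psubsetI[OF sE(2)] a(2)] by blast
      then show False using maxw[OF a(1)] s wP by linarith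
    qed
  next
    assume a: "feas V inc D (flip P X)" "near t (flip Q X)"
    show False
    proof (cases "flip P X = E")
      case True
      from fullcase[OF this iu(1,2) sE(2) s disjI2[OF a(2)]] show False .
    next
      case False
      then have "sum w (flip P X) \<le> 0" using NP[OF psubsetI[OF sE(1)] a(1)] by blast
      then show False using maxw[OF a(2)] s wP by linarith
    qed
  qed
qed

lemma e_out: obtains e where "e \<in> E - Q"
  using QE by blast

text \<open>A trail that returns to \<open>v\<close> has even degree at \<open>v\<close>, so
  flipping it cannot turn the degree \<open>k\<close> of the partner into a degree of the other
  parity.\<close>

lemma no_odd_partner:
  assumes k: "k \<le> d v" "k \<notin> D v" "odd (k + dg Q v)" and still: "\<not> good (d v) (insert k (D v))"
  shows False
proof -
  obtain e where e: "e \<in> E - Q" by (rule e_out)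
  then have "e \<in> E" by blast
  from partner[OF v(1) k(1,2) still this] obtain P where P: "near v P" "dg P v = k"
    "e \<notin> P \<and> 0 < sum w P \<or> e \<in> P \<and> sum w E \<le> sum w P" by blast
  have ne: "dg P v \<noteq> dg Q v" using P(2) k(3) by auto
  have fP: "finite P" "P \<subseteq> E" using P(1) finite_sub by (auto simp: near_def)
  show False
  proof (rule no_partner[OF P(1) ne e P(3)])
    fix X assume ex: "exchange V E inc D P Q v" and t: "trail inc D P Q v X v"
      and sw: "dg (flip P X) v = dg Q v"
    interpret exchange V E inc D P Q v by (rule ex)
    have "even (dg X v)" using tr_parity[OF t, of v] by simp
    then show False using even_deg_flip[OF fP(1) tr_flips(3)[OF t], of inc v] sw k(3) P(2) by simp
  qed
qed

text \<open>The even hole \<open>g\<close> has two roles: \<open>v\<close> remains bad after the odd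
  hole \<open>k\<close> is filled, and \<open>g - 1\<close> is an odd admissible value that
  separates \<open>k\<close> from \<open>dg Q v\<close>, so that the two degrees cannot be
  exchanged.\<close>

lemma no_sep_partner:
  assumes k: "k \<le> d v" "k \<notin> D v" "odd k" and odd: "odd (dg Q v)" and dv: "even (d v)"
    and g: "even g" "g \<le> d v" "g \<notin> D v" "k < g \<and> g < dg Q v \<or> dg Q v < g \<and> g < k"
  shows False
proof -
  have still: "\<not> good (d v) (insert k (D v))"
    using g k(3) by (auto simp: good_def)
  have g1: "g - 1 \<in> D v" using jmp[OF v(2)] g by (auto simp: jumpy_def)
  obtain e where e: "e \<in> E - Q" by (rule e_out)
  then have "e \<in> E" by blast
  from partner[OF v(1) k(1,2) still this] obtain P where P: "near v P" "dg P v = k"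
    "e \<notin> P \<and> 0 < sum w P \<or> e \<in> P \<and> sum w E \<le> sum w P" by blast
  have ne: "dg P v \<noteq> dg Q v" using P(2) g(4) by auto
  show False
  proof (rule no_partner[OF P(1) ne e P(3)])
    fix X assume ex: "exchange V E inc D P Q v" and t: "trail inc D P Q v X v"
      and sw: "dg (flip P X) v = dg Q v" "dg (flip Q X) v = dg P v"
    interpret exchange V E inc D P Q v by (rule ex)
    show False
    proof (cases "k < g")
      case True
      then show False using tr_barrier[of P g X v] P k odd t sw g g1 by auto
    next
      case False
      then show False using tr_barrier[of Q g X v] P k odd t sw g g1 hole by auto
    qed
  qed
qed

text \<open>This deletes all edges outside \<open>Q\<close>; admitting \<open>dg Q v\<close>
  restores \<open>jumpy\<close>. With three bad vertices the induction hypothesis gives a proper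
  subset \<open>I\<close> of \<open>Q\<close>. It must violate \<open>v\<close> with the full degree
  \<open>dg Q v\<close>, hence contain every edge of \<open>Q\<close> at \<open>v\<close>, and then
  it weighs at least as much as \<open>Q\<close> with fewer edges.\<close>

lemma few_bad_within: "card (bad V (dg Q) (D(v := insert (dg Q v) (D v)))) \<le> 2"
proof (rule ccontr)
  let ?D = "D(v := insert (dg Q v) (D v))"
  assume n: "\<not> ?thesis"
  obtain e where e: "e \<in> Q" "0 < inc e v" using deg_pos_ex[OF fin(2) hn(3)] by blast
  \<comment> \<open>The total of \<open>w'\<close> on \<open>Q\<close> is 1, so positivity on a set
    containing \<open>e\<close> means weight at least \<open>sum w Q\<close>. The edge is taken at
    \<open>v\<close> in order to force it into \<open>I\<close>.\<close>
  define w' where "w' = w(e := w e + (1 - sum w Q))"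
  have le: "dg Q u \<le> d u" for u using deg_le[of Q u] QE by simp
  have "bad V (dg Q) ?D \<subseteq> BD"
  proof
    fix u assume u: "u \<in> bad V (dg Q) ?D"
    show "u \<in> BD"
    proof (rule ccontr)
      assume "u \<notin> BD"
      then have "u \<noteq> v" "D u = {k. even k}" "u \<in> V" using u v evens by (auto simp: bad_def)
      then show False using u Qo by (auto simp: bad_def good_def)
    qed
  qed
  then have "holes V (dg Q) ?D \<le> holes V d D"
  proof (rule holes_mono[OF finV])
    fix u
    show "card {k. k \<le> dg Q u \<and> k \<notin> ?D u} \<le> card {k. k \<le> d u \<and> k \<notin> D u}"
      by (rule card_mono) (use le in \<open>auto intro: order_trans\<close>)
  qed
  moreover have "card Q < card E" using QE fin psubset_card_mono by blast
  moreover have "jumpy (dg Q u) (?D u)" if "u \<in> V" for u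
    using jmp[OF that] Qo[OF that] le[of u] unfolding jumpy_def by (auto intro: order_trans)
  moreover have "0 < sum w' Q"
    unfolding w'_def using e fin by (subst sum_upd) auto
  moreover have "3 \<le> card (bad V (dg Q) ?D)" using n by simp
  moreover have "card Q + holes V (dg Q) ?D < card E + holes V d D" using calculation(1,2) by linarith
  ultimately obtain I where I: "I \<subset> Q" "feas V inc ?D I" "0 < sum w' I"
    using IH[of Q ?D w'] QE by (meson psubset_imp_subset)
  have fI: "finite I" "I \<subset> E" using I(1) QE finite_sub by blast+
  have wI: "sum w' I = sum w I + (if e \<in> I then 1 - sum w Q else 0)"
    unfolding w'_def by (rule sum_upd[OF fI(1)])
  then have wp: "0 < sum w I" using I(3) fpos by (auto split: if_splits)
  then have nf: "\<not> feas V inc D I" using NP[OF fI(2)] by auto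
  have o: "dg I u \<in> D u" if "u \<in> V" "u \<noteq> v" for u
    using I(2) that by (auto simp: feas_def)
  have "dg I v \<notin> D v" using nf o by (auto simp: feas_def)
  moreover have "dg I v \<in> insert (dg Q v) (D v)" using I(2) v by (auto simp: feas_def)
  ultimately have nI: "near v I" and eq: "dg I v = dg Q v" using v o fI by (auto simp: near_def)
  have "e \<in> I"
  proof (rule ccontr)
    assume "e \<notin> I"
    then have "dg (insert e I) v = inc e v + dg I v" using fI by (simp add: deg_insert)
    moreover have "dg (insert e I) v \<le> dg Q v" using e I(1) fin by (intro deg_mono) auto
    ultimately show False using eq e by simp
  qed
  then have "sum w Q \<le> sum w I" using wI I(3) by (simp only: if_True)
  then have "card Q \<le> card I" using minc[OF nI] maxw[OF nI] by simp
  then show False using psubset_card_mono[OF fin(2) I(1)] by simp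
qed

text \<open>Degrees counted from those of \<open>Q\<close>, as after its contraction; the extra
  value 0 at \<open>v\<close> fills the hole that \<open>Q\<close> has there.\<close>

abbreviation "shifted_D \<equiv> \<lambda>u. {k. k + dg Q u \<in> D u \<or> u = v \<and> k = 0}"

text \<open>For a solution \<open>I\<close> of the contracted instance, \<open>Q \<union> I\<close>
  has positive weight, so it violates \<open>v\<close>, which is possible only through the extra
  value 0. Then \<open>I\<close> avoids all edges at \<open>v\<close>, in particular
  \<open>e\<close>, and \<open>Q \<union> I\<close> is a violating set heavier than
  \<open>Q\<close>.\<close>

lemma few_bad_outside: "card (bad V (\<lambda>u. d u - dg Q u) shifted_D) \<le> 2"
proof (rule ccontr)
  assume n: "\<not> ?thesis"
  have fd: "dg (E - Q) u = d u - dg Q u" for u using deg_Diff[of E Q inc u] fin QE by blast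
  then have fd': "dg (E - Q) = (\<lambda>u. d u - dg Q u)" by (rule ext)
  have "0 < dg (E - Q) v" using fd[of v] hn by simp
  from deg_pos_ex[OF fin(3) this] obtain e where e: "e \<in> E - Q" "0 < inc e v" by (rule bexE)
  \<comment> \<open>The weight of \<open>Q\<close> is loaded onto one edge at \<open>v\<close>, so
    the contracted instance keeps the total \<open>sum w E\<close>, while a set without
    \<open>e\<close> must have positive weight on its own.\<close>
  define w' where "w' = w(e := w e + sum w Q)"
  have le: "dg Q u \<le> d u" for u using deg_le[of Q u] QE by simp
  have "bad V (\<lambda>u. d u - dg Q u) shifted_D \<subseteq> BD"
  proof
    fix u assume u: "u \<in> bad V (\<lambda>u. d u - dg Q u) shifted_D"
    show "u \<in> BD"
    proof (rule ccontr)
      assume "u \<notin> BD"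
      then have "u \<noteq> v" "D u = {k. even k}" "u \<in> V" using u v evens by (auto simp: bad_def)
      moreover have "even (d u)" using \<open>u \<notin> BD\<close> \<open>u \<in> V\<close> by (auto simp: bad_def good_def)
      ultimately show False using u Qo[of u] by (auto simp: bad_def good_def)
    qed
  qed
  then have "holes V (\<lambda>u. d u - dg Q u) shifted_D \<le> holes V d D"
  proof (rule holes_mono[OF finV])
    fix u
    show "card {k. k \<le> d u - dg Q u \<and> k \<notin> shifted_D u} \<le> card {k. k \<le> d u \<and> k \<notin> D u}"
      by (rule card_inj_on_le[where f = "\<lambda>k. k + dg Q u"]) (use le[of u] in auto)
  qed
  then have hl: "holes V (dg (E - Q)) shifted_D \<le> holes V d D" using fd' by simp
  have "card (E - Q) < card E"
  proof (rule psubset_card_mono[OF fin(1)])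
    have "Q \<noteq> {}" using hn(3) by auto
    then show "E - Q \<subset> E" using QE by blast
  qed
  with hl have "card (E - Q) + holes V (dg (E - Q)) shifted_D < card E + holes V d D" by linarith
  moreover have "jumpy (dg (E - Q) u) (shifted_D u)" if "u \<in> V" for u
  proof -
    have "0 \<in> shifted_D u" using Qo[OF that] by auto
    moreover have "d u - dg Q u \<in> shifted_D u" using D0(2)[OF that] le[of u] by simp
    moreover have "k - 1 \<in> shifted_D u \<and> k + 1 \<in> shifted_D u" if k: "k \<le> d u - dg Q u" "k \<notin> shifted_D u" for k
    proof -
      have "k + dg Q u \<le> d u" "k + dg Q u \<notin> D u" using k le[of u] by auto
      then have *: "k + dg Q u - 1 \<in> D u" "k + dg Q u + 1 \<in> D u"
        using jmp[OF \<open>u \<in> V\<close>] unfolding jumpy_def by auto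
      have "k \<noteq> 0"
      proof
        assume "k = 0"
        then have "u \<noteq> v" "dg Q u \<notin> D u" using k(2) by auto
        then show False using Qo[OF \<open>u \<in> V\<close>] by blast
      qed
      then show ?thesis using * by simp
    qed
    ultimately show ?thesis unfolding jumpy_def fd by blast
  qed
  moreover have "0 < sum w' (E - Q)"
  proof -
    have "sum w' (E - Q) = sum w (E - Q) + sum w Q"
      unfolding w'_def using e fin by (subst sum_upd) auto
    then show ?thesis using sum.subset_diff[of Q E w] QE fin pos by auto
  qed
  moreover have "3 \<le> card (bad V (dg (E - Q)) shifted_D)" unfolding fd' using n by linarith
  ultimately obtain I where I: "I \<subset> E - Q" "feas V inc shifted_D I" "0 < sum w' I"
    using IH[of "E - Q" shifted_D w'] by blast
  have fI: "finite I" "I \<inter> Q = {}" "Q \<union> I \<subset> E" using I(1) QE finite_sub by blast+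
  have dI: "dg (Q \<union> I) u = dg I u + dg Q u" for u
    using deg_Un[of I Q inc u] fI fin by (simp add: Un_commute)
  have wQI: "sum w (Q \<union> I) = sum w I + sum w Q"
    using fI fin by (subst sum.union_disjoint) auto
  have wI: "sum w' I = sum w I + (if e \<in> I then sum w Q else 0)"
    unfolding w'_def by (rule sum_upd[OF fI(1)])
  have o: "dg (Q \<union> I) u \<in> D u" if "u \<in> V" "u \<noteq> v" for u
    using I(2) that dI by (auto simp: feas_def)
  have wp: "0 < sum w (Q \<union> I)" using wI wQI I(3) fpos by (auto split: if_splits)
  then have "\<not> feas V inc D (Q \<union> I)" using NP[OF fI(3)] by auto
  then have nv: "dg (Q \<union> I) v \<notin> D v" using o by (auto simp: feas_def)
  then have z: "dg I v = 0" using I(2) v dI by (auto simp: feas_def)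
  have "e \<notin> I"
  proof
    assume "e \<in> I"
    then have "inc e v \<le> dg I v" unfolding deg_def using fI by (intro member_le_sum) auto
    then show False using z e by simp
  qed
  then have "sum w Q < sum w (Q \<union> I)" using wI wQI I(3) by simp
  moreover have "near v (Q \<union> I)" using nv o v fI by (auto simp: near_def)
  ultimately show False using maxw by fastforce
qed

text \<open>A vertex \<open>u\<close> that is good within \<open>Q\<close> and good outside
  \<open>Q\<close> is good in \<open>E\<close>. So when one side is certified to be good at all
  vertices but \<open>v\<close>, the bad vertices persist on the other side, against
  \<open>few_bad_within\<close> or \<open>few_bad_outside\<close>. Which side is certified depends
  on the parities of \<open>d v\<close> and \<open>dg Q v\<close>.\<close>

theorem no_extremal_set: False
proof (cases "even (d v)")
  case odd: False
  \<comment> \<open>For odd \<open>d v\<close> no filling can make \<open>v\<close> good, so every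
    hole at \<open>v\<close> has the parity of \<open>dg Q v\<close>. Hence 1 or
    \<open>d v - 1\<close>, whichever has the other parity, is admissible.\<close>
  have par: "even (k + dg Q v)" if "k \<le> d v" "k \<notin> D v" for k
    using no_odd_partner[OF that] odd by (auto simp: good_def)
  have "\<not> card BD \<le> 2" using bad3 by simp
  show False
  proof (cases "even (dg Q v)")
    case True
    have "1 \<in> D v" using par[of 1] hn True by fastforce
    note c = ex_empty(2)[OF this]
    have "BD \<subseteq> bad V (\<lambda>u. d u - dg Q u) shifted_D"
    proof
      fix u assume u: "u \<in> BD"
      show "u \<in> bad V (\<lambda>u. d u - dg Q u) shifted_D"
      proof (cases "u = v")
        case True
        then show ?thesis using odd \<open>even (dg Q v)\<close> hn v by (auto simp: bad_def good_def)
      next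
        case False
        have uV: "u \<in> V" using u BD_V by blast
        have le: "dg Q u \<le> d u" using deg_le QE by blast
        have g: "good (dg Q u) (D u)" using c uV False by blast
        show ?thesis
        proof (rule ccontr)
          assume "\<not> ?thesis"
          then have g2: "good (d u - dg Q u) (shifted_D u)" using uV by (simp add: bad_def)
          have "k \<in> D u" if "even k" "k \<le> d u" for k
          proof (cases "k \<le> dg Q u")
            case True
            then show ?thesis using g that by (auto simp: good_def)
          next
            case k: False
            then have "even (k - dg Q u)" "k - dg Q u \<le> d u - dg Q u"
              using g that by (auto simp: good_def)
            then have "k - dg Q u \<in> shifted_D u" using g2 unfolding good_def by blast
            then show ?thesis using k False by simp
          qed
          moreover have "even (d u)" using g g2 le by (auto simp: good_def)
          ultimately show False using u by (auto simp: bad_def good_def)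
        qed
      qed
    qed
    then have "card BD \<le> card (bad V (\<lambda>u. d u - dg Q u) shifted_D)"
      using finV by (intro card_mono) (auto simp: bad_def)
    then show False using few_bad_outside \<open>\<not> card BD \<le> 2\<close> by simp
  next
    case oddh: False
    have "d v - 1 \<in> D v" using par[of "d v - 1"] hn oddh odd by fastforce
    note c = ex_full(2,3)[OF this]
    let ?D = "D(v := insert (dg Q v) (D v))"
    have "BD \<subseteq> bad V (dg Q) ?D"
    proof
      fix u assume u: "u \<in> BD"
      show "u \<in> bad V (dg Q) ?D"
      proof (cases "u = v")
        case True
        then show ?thesis using oddh v by (auto simp: bad_def good_def)
      next
        case False
        have uV: "u \<in> V" using u BD_V by blast
        have le: "dg Q u \<le> d u" using deg_le QE by blast
        show ?thesis
        proof (rule ccontr)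
          assume "\<not> ?thesis"
          then have g: "good (dg Q u) (D u)" using uV False by (simp add: bad_def)
          have "k \<in> D u" if "even k" "k \<le> d u" for k
          proof (cases "k \<le> dg Q u")
            case True
            then show ?thesis using g that by (auto simp: good_def)
          next
            case k: False
            then have "even (k - dg Q u)" "k - dg Q u \<le> d u - dg Q u"
              using g that by (auto simp: good_def)
            from c(2)[OF uV False this] show ?thesis using k by simp
          qed
          moreover have "even (d u)" using g c(1)[OF uV False] le by (auto simp: good_def)
          ultimately show False using u by (auto simp: bad_def good_def)
        qed
      qed
    qed
    then have "card BD \<le> card (bad V (dg Q) ?D)"
      using finV by (intro card_mono) (auto simp: bad_def)
    then show False using few_bad_within \<open>\<not> card BD \<le> 2\<close> by simp
  qed
next
  case dv: True
  show False
  proof (cases "even (dg Q v)")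
    case True
    have hle: "dg Q v \<le> d v" using hn by simp
    \<comment> \<open>Filling an odd hole leaves the even hole \<open>dg Q v\<close>, so
      \<open>v\<close> stays bad and \<open>no_odd_partner\<close> applies. As 1 and
      \<open>d v - 1\<close> are then admissible, both sides are certified and no vertex but
      \<open>v\<close> can be bad.\<close>
    have par: "k \<in> D v" if "k \<le> d v" "odd k" for k
    proof (rule ccontr)
      assume "k \<notin> D v"
      moreover have "\<not> good (d v) (insert k (D v))"
        using True hole hle that by (auto simp: good_def)
      ultimately show False using no_odd_partner[of k] that True by simp
    qed
    have "1 \<in> D v" "d v - 1 \<in> D v" using par hn dv by auto
    note c = ex_empty(2)[OF this(1)] ex_full(2,3)[OF this(2)]
    have "u = v" if u: "u \<in> BD" for u
    proof (rule ccontr)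
      assume ne: "u \<noteq> v"
      have uV: "u \<in> V" using u BD_V by blast
      have le: "dg Q u \<le> d u" using deg_le QE by blast
      note g = c(1)[OF uV ne]
      have "k \<in> D u" if "even k" "k \<le> d u" for k
      proof (cases "k \<le> dg Q u")
        case True
        then show ?thesis using g that by (auto simp: good_def)
      next
        case k: False
        then have "even (k - dg Q u)" "k - dg Q u \<le> d u - dg Q u"
          using g that by (auto simp: good_def)
        from c(3)[OF uV ne this] show ?thesis using k by simp
      qed
      moreover have "even (d u)" using g c(2)[OF uV ne] le by (auto simp: good_def)
      ultimately show False using u by (auto simp: bad_def good_def)
    qed
    then have "card BD \<le> card {v}" by (intro card_mono) auto
    then show False using bad3 by simp
  next
    case oddh: False
    \<comment> \<open>If 1 or \<open>d v - 1\<close> were admissible, a closed trail would make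
      \<open>dg Q v\<close> even; so both are odd holes. An even hole \<open>g\<close> exists
      because \<open>v\<close> is bad, and it separates \<open>dg Q v\<close> from one of
      them.\<close>
    have 1: "1 \<notin> D v" using ex_empty(1) oddh by blast
    have 2: "d v - 1 \<notin> D v" using ex_full(1) oddh dv hn by fastforce
    obtain g where g: "even g" "g \<le> d v" "g \<notin> D v"
      using v dv by (auto simp: bad_def good_def)
    have g0: "g \<noteq> 0" "g \<noteq> d v" "g \<noteq> dg Q v" using g D0[OF v(2)] oddh by metis+
    have "1 \<le> d v" using hn by simp
    show False
    proof (cases "dg Q v < g")
      case True
      have "a < b - 1" if "even a" "even b" "a \<le> b" "a \<noteq> b" for a b :: nat
        using that by presburger
      then have "g < d v - 1" using g g0 dv by blast
      then show False
        using no_sep_partner[OF _ 2 _ oddh dv g] True dv hn by fastforce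
    next
      case False
      have "1 < g" using g(1) g0(1) by (cases g) (auto elim: oddE)
      then show False
        using no_sep_partner[OF _ 1 _ oddh dv g] False g0 \<open>1 \<le> d v\<close> by fastforce
    qed
  qed
qed

end

section \<open>Existence of an extremal violation and descent\<close>

context minimal_cex
begin

text \<open>If 1 or \<open>d v - 1\<close> is a hole, filling it gives a partner. Otherwise the
  empty set is exchanged with \<open>E\<close>. If both results are feasible, the trail runs through
  all of \<open>E\<close>, and every vertex but its two ends is good: this is where three bad
  vertices are needed.\<close>

lemma near_exists: "\<exists>v Q. near v Q \<and> 0 < sum w Q"
proof -
  have "BD \<noteq> {}" using bad3 by auto
  then obtain v where v: "v \<in> BD" by blast
  then have vV: "v \<in> V" by (rule BD_V)
  have dv: "0 < d v"
  proof (rule ccontr)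
    assume "\<not> ?thesis"
    then have "good (d v) (D v)" using D0(1)[OF vV] by (auto simp: good_def)
    then show False using v by (simp add: bad_def)
  qed
  have "E \<noteq> {}" using pos by auto
  then obtain e where e: "e \<in> E" by blast
  show ?thesis
  proof (cases "1 \<in> D v \<and> d v - 1 \<in> D v")
    case False
    then obtain k where k: "k = 1 \<or> k = d v - 1" "k \<notin> D v" by blast
    \<comment> \<open>For even \<open>d v\<close> both candidates are odd, and an odd value does not
      help \<open>good\<close>.\<close>
    have "\<not> good (d v) (insert k (D v))"
    proof
      assume g: "good (d v) (insert k (D v))"
      then have "even (d v)" by (simp add: good_def)
      then have "odd k" using k(1) dv by auto
      then have "good (d v) (D v)" using g by (auto simp: good_def)
      then show False using v by (simp add: bad_def)
    qed
    moreover have "k \<le> d v" using k(1) dv by auto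
    ultimately obtain P where "near v P" "e \<notin> P \<and> 0 < sum w P \<or> e \<in> P \<and> sum w E \<le> sum w P"
      using partner[OF v _ k(2) _ e] by metis
    then show ?thesis using pos by (meson less_le_trans)
  next
    case one: True
    interpret exchange V E inc D "{}" E v
    proof
      fix e t' assume e: "e \<in> flip {} E" "joins inc e v t'" "t' \<noteq> v"
      then have i: "inc e v = 1" by (simp add: joins_def)
      have "d v = inc e v + dg (E - {e}) v"
        using e finE deg_insert[of "E - {e}" e inc v] by (simp add: insert_absorb)
      then have "dg (E - {e}) v = d v - 1" using i by simp
      then show "dg (flip {} {e}) v \<in> D v \<and> dg (flip E {e}) v \<in> D v"
        using one i e by (simp add: insert_absorb deg_def)
    qed (use D0 vV in auto)
    from deg_pos_ex[OF finE dv] obtain e0 where e0: "e0 \<in> E" "0 < inc e0 v" by (rule bexE)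
    have "e0 \<in> flip {} E" using e0 by simp
    from tr_final[OF this e0(2)] obtain X t where X: "tr X t" "X \<noteq> {}"
      "dg (flip {} X) t \<in> D t \<or> dg (flip E X) t \<in> D t"
      using D0(2)[OF vV] by (metis (no_types, lifting))
    have XE: "X \<subseteq> E" using tr_basic[OF X(1)] by simp
    have fl: "flip {} X = X" "flip E X = E - X" using XE by auto
    have s: "sum w X + sum w (E - X) = sum w E"
      using XE finE sum.subset_diff[of X E w] by simp
    have c: "E - X \<subset> E" using XE X(2) by blast
    show ?thesis
      using exchange_axioms v X(1,3,2)
    proof (rule exchange_outcome; unfold fl)
      assume f: "feas V inc D X" "feas V inc D (E - X)"
      have "X = E"
      proof (rule ccontr)
        assume "X \<noteq> E"
        then have "sum w X \<le> 0" using NP[OF psubsetI[OF XE] f(1)] by blast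
        then show False using NP[OF c f(2)] s pos by linarith
      qed
      then have tr: "tr E t" using X(1) by simp
      have "u \<in> {v, t}" if "u \<in> BD" for u
      proof (rule ccontr)
        assume "u \<notin> {v, t}"
        then have u: "u \<noteq> v" "u \<noteq> t" "u \<in> V" using that BD_V by auto
        have "even (d u)" using tr_parity[OF tr, of u] u by simp
        then have "good (d u) (D u)"
          using tr_run[OF _ tr u(3,1)] u by (auto simp: good_def)
        then show False using that by (simp add: bad_def)
      qed
      then have "BD \<subseteq> {v, t}" by blast
      then have "card BD \<le> card {v, t}" by (intro card_mono) auto
      also have "\<dots> \<le> 2" by (simp add: card_insert_if)
      finally show ?thesis using bad3 by simp
    next
      assume n: "near t X" and f: "feas V inc D (E - X)"
      show ?thesis using n NP[OF c f] s pos by (intro exI[of _ t] exI[of _ X]) auto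
    next
      assume f: "feas V inc D X" and n: "near t (E - X)"
      have "X \<noteq> E" using near_def n D0 by (metis BD_V Diff_cancel deg_empty)
      then have "sum w X \<le> 0" using NP[OF psubsetI[OF XE] f] by blast
      then show ?thesis using n s pos by (intro exI[of _ t] exI[of _ "E - X"]) auto
    qed
  qed
qed

lemma no_minimal_cex: False
proof -
  define S where "S = {(v, Q). near v Q \<and> 0 < sum w Q}"
  \<comment> \<open>A single integer encodes the lexicographic order, by larger weight and then by
    fewer edges; the factor \<open>N\<close> exceeds every cardinality.\<close>
  define N where "N = int (card E) + 1"
  define key where "key = (\<lambda>(v :: 'v, Q). sum w Q * N - int (card Q))"
  have "S \<subseteq> V \<times> Pow E" by (auto simp: S_def near_def bad_def)
  then have "finite S" using finV finE finite_subset by blast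
  moreover have "S \<noteq> {}" using near_exists by (auto simp: S_def)
  ultimately have "Max (key ` S) \<in> key ` S" "\<And>p. p \<in> S \<Longrightarrow> key p \<le> Max (key ` S)"
    by (auto intro: Max_in)
  then obtain p where p: "p \<in> S" "\<And>q. q \<in> S \<Longrightarrow> key q \<le> key p" by (metis imageE)
  obtain v Q where pvQ: "p = (v, Q)" by fastforce
  have vQ: "near v Q" "0 < sum w Q" using p(1) pvQ by (auto simp: S_def)
  have mx: "sum w R * N - int (card R) \<le> sum w Q * N - int (card Q)"
    if "near u R" "0 < sum w R" for u R
    using p(2)[of "(u, R)"] that pvQ by (auto simp: S_def key_def)
  have le: "sum w R \<le> sum w Q" if nr: "near u R" for u R
  proof (rule ccontr)
    assume gt: "\<not> ?thesis"
    then have "0 < sum w R" using vQ(2) by simp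
    from mx[OF nr this] have 1: "sum w R * N - int (card R) \<le> sum w Q * N - int (card Q)" .
    have "R \<subseteq> E" using nr by (simp add: near_def)
    then have "int (card R) < N" using card_mono[OF finE] by (simp add: N_def)
    moreover have "(sum w Q + 1) * N \<le> sum w R * N"
      using gt by (intro mult_right_mono) (auto simp: N_def)
    ultimately show False using 1 by (simp add: distrib_right)
  qed
  interpret extremal V E inc D w v Q
  proof
    show "near v Q" "0 < sum w Q" by (fact vQ)+
    show "sum w R \<le> sum w Q" if "near u R" for u R using le[OF that] .
    show "card Q \<le> card R" if "near u R" "sum w R = sum w Q" for u R
      using mx[OF that(1)] that(2) vQ(2) by simp
  qed
  show False by (rule no_extremal_set)
qed

end

lemma improving_proper_subset:
  fixes w :: "'e \<Rightarrow> int"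
  assumes "finite V" "finite E" "\<And>e. e \<in> E \<Longrightarrow> \<exists>a\<in>V. \<exists>b\<in>V. joins inc e a b"
    and "\<And>u. u \<in> V \<Longrightarrow> jumpy (deg inc E u) (D u)"
    and "3 \<le> card (bad V (deg inc E) D)" "0 < sum w E"
  shows "\<exists>I\<subset>E. feas V inc D I \<and> 0 < sum w I"
  using assms(2-)
proof (induction "card E + holes V (deg inc E) D" arbitrary: E D w rule: less_induct)
  case less
  show ?case
  proof (rule ccontr)
    assume no: "\<not> ?case"
    \<comment> \<open>Only degrees up to \<open>deg inc E u\<close> occur, and at a good vertex
      \<open>D u\<close> contains all even numbers in this range. So the normalization creates no
      new solutions and establishes \<open>evens\<close>.\<close>
    define D' where "D' = (\<lambda>u. if good (deg inc E u) (D u) then {k. even k} else D u)"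
    have gd: "good (deg inc E u) (D' u) \<longleftrightarrow> good (deg inc E u) (D u)" for u
      by (auto simp: D'_def good_def)
    have b: "bad V (deg inc E) D' = bad V (deg inc E) D"
      by (simp add: bad_def gd)
    have h: "holes V (deg inc E) D' = holes V (deg inc E) D"
      unfolding holes_def b by (rule sum.cong) (auto simp: bad_def D'_def)
    have fe: "feas V inc D I" if "I \<subseteq> E" "feas V inc D' I" for I
      unfolding feas_def
    proof
      fix u assume "u \<in> V"
      then have "deg inc I u \<in> D' u" using that by (simp add: feas_def)
      moreover have "deg inc I u \<le> deg inc E u" using less.prems(1) that(1) by (rule deg_mono)
      ultimately show "deg inc I u \<in> D u"
        by (auto simp: D'_def good_def split: if_splits)
    qed
    interpret minimal_cex V E inc D' w
    proof
      show "finite V" "finite E" by fact+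
      show "\<exists>a\<in>V. \<exists>b\<in>V. joins inc e a b" if "e \<in> E" for e using less.prems(2) that .
      show "jumpy (deg inc E u) (D' u)" if "u \<in> V" for u
        using less.prems(3)[OF that] by (auto simp: D'_def jumpy_def good_def)
      show "3 \<le> card (bad V (deg inc E) D')" using less.prems(4) b by simp
      show "0 < sum w E" by fact
      show "sum w I \<le> 0" if "I \<subset> E" "feas V inc D' I" for I
        using no fe[of I] that by force
      show "D' u = {k. even k}" if "u \<in> V" "good (deg inc E u) (D' u)" for u
        using that gd by (simp add: D'_def)
      show "\<exists>I\<subset>E'. feas V inc D'' I \<and> 0 < sum (w' :: 'e \<Rightarrow> int) I"
        if "E' \<subseteq> E" "card E' + holes V (deg inc E') D'' < card E + holes V (deg inc E) D'"
          "\<And>u. u \<in> V \<Longrightarrow> jumpy (deg inc E' u) (D'' u)" "3 \<le> card (bad V (deg inc E') D'')" "0 < sum w' E'"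
        for E' D'' w'
      proof (rule less.hyps)
        show "card E' + holes V (deg inc E') D'' < card E + holes V (deg inc E) D" using that(2) h by simp
        show "finite E'" using that(1) less.prems(1) by (rule finite_subset)
        show "\<exists>a\<in>V. \<exists>b\<in>V. joins inc e a b" if "e \<in> E'" for e
          using less.prems(2) that \<open>E' \<subseteq> E\<close> by blast
      qed (use that in auto)
    qed
    show False by (rule no_minimal_cex)
  qed
qed

text \<open>Feasibility of an improving subset makes its degrees admissible full degrees, so the
  hypotheses are inherited and \<open>improving_proper_subset\<close> can be iterated until at most
  two bad vertices remain.\<close>

lemma improving_subset_few_bad:
  fixes w :: "'e \<Rightarrow> int"
  assumes "finite V" "finite E" "\<And>e. e \<in> E \<Longrightarrow> \<exists>a\<in>V. \<exists>b\<in>V. joins inc e a b"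
    and "\<And>u. u \<in> V \<Longrightarrow> jumpy (deg inc E u) (D u)" "0 < sum w E"
  shows "\<exists>I\<subseteq>E. feas V inc D I \<and> card (bad V (deg inc I) D) \<le> 2 \<and> 0 < sum w I"
  using assms(2-)
proof (induction "card E" arbitrary: E rule: less_induct)
  case less
  show ?case
  proof (cases "card (bad V (deg inc E) D) \<le> 2")
    case True
    have "feas V inc D E" using less.prems(3) by (auto simp: feas_def jumpy_def)
    then show ?thesis using True less.prems(4) by blast
  next
    case False
    then have "3 \<le> card (bad V (deg inc E) D)" by simp
    from improving_proper_subset[OF assms(1) less.prems(1,2,3) this less.prems(4)]
    obtain I where I: "I \<subset> E" "feas V inc D I" "0 < sum w I" by auto
    have fI: "finite I" using I(1) less.prems(1) finite_subset by blast
    have "\<exists>I'\<subseteq>I. feas V inc D I' \<and> card (bad V (deg inc I') D) \<le> 2 \<and> 0 < sum w I'"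
    proof (rule less.hyps)
      show "card I < card E" using psubset_card_mono[OF less.prems(1) I(1)] .
      show "\<exists>a\<in>V. \<exists>b\<in>V. joins inc e a b" if "e \<in> I" for e
        using less.prems(2) I(1) that by blast
      fix u assume u: "u \<in> V"
      have "deg inc I u \<le> deg inc E u" using less.prems(1) I(1) by (intro deg_mono) auto
      then show "jumpy (deg inc I u) (D u)"
        using less.prems(3)[OF u] I(2) u by (auto simp: jumpy_def feas_def)
    qed (use fI I in auto)
    then show ?thesis using I(1) by blast
  qed
qed

text \<open>Subtract \<open>g\<close> from every weight. If the total stayed positive, some set with
  at most two bad vertices would weigh more than \<open>g\<close> times its size, hence more than
  \<open>g\<close>, since it is non-empty.\<close>

lemma gain_bound:
  fixes w :: "'e \<Rightarrow> int"
  assumes "finite V" "finite E" "\<And>e. e \<in> E \<Longrightarrow> \<exists>a\<in>V. \<exists>b\<in>V. joins inc e a b"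
    and "\<And>u. u \<in> V \<Longrightarrow> jumpy (deg inc E u) (D u)" and g: "0 \<le> g"
    and le: "\<And>I. I \<subseteq> E \<Longrightarrow> feas V inc D I \<Longrightarrow> card (bad V (deg inc I) D) \<le> 2 \<Longrightarrow> sum w I \<le> g"
  shows "sum w E \<le> g * int (card E)"
proof (rule ccontr)
  assume n: "\<not> ?thesis"
  define w' where "w' = (\<lambda>e. w e - g)"
  have s: "sum w' X = sum w X - g * int (card X)" for X
    by (simp add: w'_def sum_subtractf)
  have "0 < sum w' E" using n s by simp
  then obtain I where I: "I \<subseteq> E" "feas V inc D I" "card (bad V (deg inc I) D) \<le> 2" "0 < sum w' I"
    using improving_subset_few_bad[OF assms(1-4), where w = w'] by auto
  have "finite I" using I(1) assms(2) finite_subset by blast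
  then have "1 \<le> int (card I)" using I(4) by (cases "I = {}") (auto simp: Suc_le_eq card_gt_0_iff)
  then have "g * 1 \<le> g * int (card I)" using g by (intro mult_left_mono)
  then show False using s[of I] I(4) le[OF I(1-3)] by simp
qed

section \<open>Local optima of the jump system intersection\<close>

lemma no_gap:
  assumes "jump_system_1d B" "a \<in> B" "b \<in> B" "a \<le> z" "z \<le> b" "z \<notin> B"
  shows "z - 1 \<in> B" "z + 1 \<in> B"
proof -
  have ng: "\<not> has_gap B p" if "1 < p" for p
    using assms(1) that by (simp add: jump_system_1d_iff_gaps)
  define \<alpha> where "\<alpha> = Max (B \<inter> {a..z})"
  define \<beta> where "\<beta> = Min (B \<inter> {z..b})"
  have fA: "finite (B \<inter> {a..z})" "B \<inter> {a..z} \<noteq> {}" using assms by auto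
  have fB: "finite (B \<inter> {z..b})" "B \<inter> {z..b} \<noteq> {}" using assms by auto
  have A: "\<alpha> \<in> B" "\<alpha> \<le> z" using Max_in[OF fA] by (auto simp: \<alpha>_def)
  have Bt: "\<beta> \<in> B" "z \<le> \<beta>" "\<beta> \<le> b" using Min_in[OF fB] by (auto simp: \<beta>_def)
  have "\<alpha> \<noteq> z" "\<beta> \<noteq> z" using A Bt assms(6) by auto
  then have lt: "\<alpha> < z" "z < \<beta>" using A Bt by auto
  have gap: "k \<notin> B" if "\<alpha> < k" "k < \<beta>" for k
  proof
    assume k: "k \<in> B"
    have "a \<le> \<alpha>" using Max_in[OF fA] by (auto simp: \<alpha>_def)
    show False
    proof (cases "k \<le> z")
      case True
      then have "k \<le> \<alpha>" unfolding \<alpha>_def using k that \<open>a \<le> \<alpha>\<close> by (intro Max_ge[OF fA(1)]) auto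
      then show False using that by simp
    next
      case False
      then have "\<beta> \<le> k" unfolding \<beta>_def using k that Bt by (intro Min_le[OF fB(1)]) auto
      then show False using that by simp
    qed
  qed
  have "has_gap B (nat (\<beta> - \<alpha> - 1))"
    unfolding has_gap_def by (rule bexI[OF _ A(1)]) (use gap Bt lt in auto)
  then have "\<not> 1 < nat (\<beta> - \<alpha> - 1)" using ng by blast
  then have "\<beta> - \<alpha> \<le> 2" by linarith
  then have "\<alpha> = z - 1" "\<beta> = z + 1" using lt by linarith+
  then show "z - 1 \<in> B" "z + 1 \<in> B" using A Bt by auto
qed

text \<open>The successor map embeds the holes between two elements into \<open>B\<close>, so they
  are not more numerous than the elements.\<close>

lemma spread_le_card:
  assumes "finite B" "jump_system_1d B" "a \<in> B" "b \<in> B"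
  shows "\<bar>b - a\<bar> \<le> 2 * int (card B)"
proof -
  have *: "d - c \<le> 2 * int (card B)" if cd: "c \<in> B" "d \<in> B" "c \<le> d" for c d
  proof -
    let ?H = "{c..d} - B"
    have "card ?H \<le> card B"
    proof (rule card_inj_on_le[where f = "\<lambda>k. k + 1"])
      show "(\<lambda>k. k + 1) ` ?H \<subseteq> B"
        using no_gap(2)[OF assms(2) cd(1,2)] by auto
    qed (use assms in auto)
    moreover have "card ({c..d} \<inter> B) \<le> card B" using assms by (intro card_mono) auto
    moreover have "card {c..d} = card ({c..d} \<inter> B) + card ?H"
      by (rule card_Int_Diff) simp
    ultimately show ?thesis using cd by simp
  qed
  show ?thesis using *[of a b] *[of b a] assms by (cases "a \<le> b") auto
qed

lemma joins_of_sum_two: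
  assumes "finite V" "(\<Sum>u\<in>V. f u) = (2 :: nat)" "\<And>u. u \<notin> V \<Longrightarrow> f u = 0"
  shows "\<exists>a\<in>V. \<exists>b\<in>V. \<forall>u. f u = of_bool (u = a) + of_bool (u = b)"
proof -
  have "sum f V \<noteq> 0" using assms(2) by simp
  then obtain a where a: "a \<in> V" "f a \<noteq> 0" by (meson sum.neutral)
  have r: "f a + (\<Sum>u\<in>V - {a}. f u) = 2" using sum.remove[OF assms(1) a(1), of f] assms(2) by simp
  show ?thesis
  proof (cases "f a = 1")
    case True
    then have "(\<Sum>u\<in>V - {a}. f u) = 1" using r by simp
    then have "sum f (V - {a}) \<noteq> 0" by simp
    then obtain b where b: "b \<in> V - {a}" "f b \<noteq> 0" by (meson sum.neutral)
    have "f b + (\<Sum>u\<in>V - {a} - {b}. f u) = 1"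
      using sum.remove[of "V - {a}" b f] assms(1) b \<open>sum f (V - {a}) = 1\<close> by simp
    then have fb: "f b = 1" "(\<Sum>u\<in>V - {a} - {b}. f u) = 0" using b by auto
    then have "\<forall>u\<in>V - {a} - {b}. f u = 0" using assms(1) by simp
    then have "f u = of_bool (u = a) + of_bool (u = b)" for u
      using True fb b assms(3)[of u] by (cases "u \<in> V") auto
    then show ?thesis using a b by blast
  next
    case False
    then have "f a = 2" "(\<Sum>u\<in>V - {a}. f u) = 0" using r a by auto
    then have "\<forall>u\<in>V - {a}. f u = 0" using assms(1) by simp
    then have "f u = of_bool (u = a) + of_bool (u = a)" for u
      using \<open>f a = 2\<close> assms(3)[of u] by (cases "u \<in> V") auto
    then show ?thesis using a by blast
  qed
qed

text \<open>Membership in the maximal parity interval of \<open>B\<close> around \<open>a\<close>,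
  stated without constructing that interval.\<close>

definition in_run :: "int set \<Rightarrow> int \<Rightarrow> int \<Rightarrow> bool" where
  "in_run B a z \<longleftrightarrow> even (z - a) \<and> (\<forall>t. even (t - a) \<and> min a z \<le> t \<and> t \<le> max a z \<longrightarrow> t \<in> B)"

text \<open>The norms add up, so the triangle inequality is tight in every coordinate: there is no
  cancellation, and all summands share the sign of the total.\<close>

lemma decomposition_signs:
  fixes f :: "'i \<Rightarrow> 'v \<Rightarrow> int"
  assumes "finite V" "finite S" "(\<Sum>i\<in>S. \<Sum>u\<in>V. \<bar>f i u\<bar>) = (\<Sum>u\<in>V. \<bar>\<Sum>i\<in>S. f i u\<bar>)"
    and u: "u \<in> V"
  defines "\<sigma> \<equiv> sgn (\<Sum>i\<in>S. f i u)"
  shows "(\<Sum>i\<in>S. \<bar>f i u\<bar>) = \<bar>\<Sum>i\<in>S. f i u\<bar>" "\<And>i. i \<in> S \<Longrightarrow> f i u = \<sigma> * \<bar>f i u\<bar>"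
proof -
  have "(\<Sum>u\<in>V. \<Sum>i\<in>S. \<bar>f i u\<bar>) = (\<Sum>u\<in>V. \<bar>\<Sum>i\<in>S. f i u\<bar>)"
    using assms(3) by (subst sum.swap) simp
  then have "(\<Sum>u\<in>V. (\<Sum>i\<in>S. \<bar>f i u\<bar>) - \<bar>\<Sum>i\<in>S. f i u\<bar>) = 0"
    by (simp add: sum_subtractf)
  then have "(\<Sum>i\<in>S. \<bar>f i u\<bar>) - \<bar>\<Sum>i\<in>S. f i u\<bar> = 0"
    using u assms(1) by (subst (asm) sum_nonneg_eq_0_iff) (auto intro: sum_abs)
  then show 1: "(\<Sum>i\<in>S. \<bar>f i u\<bar>) = \<bar>\<Sum>i\<in>S. f i u\<bar>" by simp
  also have "\<dots> = \<sigma> * (\<Sum>i\<in>S. f i u)" by (simp add: \<sigma>_def abs_sgn mult.commute)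
  also have "\<dots> = (\<Sum>i\<in>S. \<sigma> * f i u)" by (rule sum_distrib_left)
  finally have "(\<Sum>i\<in>S. \<bar>f i u\<bar> - \<sigma> * f i u) = 0" by (simp add: sum_subtractf)
  moreover have "0 \<le> \<bar>f i u\<bar> - \<sigma> * f i u" for i
    by (auto simp: \<sigma>_def sgn_if)
  ultimately have e: "\<bar>f i u\<bar> = \<sigma> * f i u" if "i \<in> S" for i
    using that assms(2) by (subst (asm) sum_nonneg_eq_0_iff) auto
  show "f i u = \<sigma> * \<bar>f i u\<bar>" if "i \<in> S" for i
    using e[OF that] by (auto simp: \<sigma>_def sgn_if split: if_splits)
qed

lemma sum_fun_apply: "(\<Sum>i\<in>I. f i) u = (\<Sum>i\<in>I. f i u)" for f :: "'i \<Rightarrow> 'v \<Rightarrow> int"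
  by (induction I rule: infinite_finite_induct) auto

text \<open>Because of the common signs, a partial sum over \<open>I\<close> is determined in each
  coordinate by the degree of \<open>I\<close>, and at a good vertex it stays in the parity run of
  \<open>x\<close>. Two bad vertices thus mean two coordinates off their runs, and
  \<open>gain_bound\<close> applies; \<open>spread_le_card\<close> bounds the number of
  edges.\<close>

lemma local_to_global:
  fixes x y c :: "'v \<Rightarrow> int"
  assumes V: "finite V" and J: "sbo_jump V J"
    and B: "\<And>u. u \<in> V \<Longrightarrow> finite (B u) \<and> jump_system_1d (B u)"
    and x: "x \<in> J \<inter> direct_product V B" and y: "y \<in> J \<inter> direct_product V B" and g: "0 \<le> g"
    and le: "\<And>z. z \<in> J \<inter> direct_product V B \<Longrightarrow> card {u\<in>V. \<not> in_run (B u) (x u) (z u)} \<le> 2 \<Longrightarrow>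
      (\<Sum>u\<in>V. c u * z u) \<le> (\<Sum>u\<in>V. c u * x u) + g"
  shows "(\<Sum>u\<in>V. c u * y u) - (\<Sum>u\<in>V. c u * x u) \<le> g * (\<Sum>u\<in>V. int (card (B u)))"
proof -
  obtain ps where ps: "two_step_decomposition V (y - x) ps"
    and sub: "\<And>I. I \<subseteq> {..<length ps} \<Longrightarrow> x + (\<Sum>i\<in>I. ps ! i) \<in> J"
    using J x y unfolding sbo_jump_def by blast
  define E where "E = {..<length ps}"
  define p where "p = (\<lambda>i. ps ! i)"
  define inc where "inc = (\<lambda>i u. nat \<bar>p i u\<bar>)"
  define w where "w = (\<lambda>i. \<Sum>u\<in>V. c u * p i u)"
  define \<sigma> where "\<sigma> = (\<lambda>u. sgn (\<Sum>i\<in>E. p i u))"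
  \<comment> \<open>Degree \<open>k\<close> at \<open>u\<close> stands for moving from
    \<open>x u\<close> by \<open>k\<close> towards \<open>y u\<close>.\<close>
  define D where "D = (\<lambda>u. {k. x u + \<sigma> u * int k \<in> B u})"
  have pV: "p i \<in> int_vecs V" "l1 V (p i) = 2" if "i \<in> E" for i
    using ps that by (auto simp: two_step_decomposition_def E_def p_def)
  have yx: "y - x = (\<Sum>i\<in>E. p i)" and l: "l1 V (y - x) = 2 * int (card E)"
    using ps by (auto simp: two_step_decomposition_def E_def p_def)
  have yxu: "y u - x u = (\<Sum>i\<in>E. p i u)" for u
    using fun_cong[OF yx, of u] by (simp add: sum_fun_apply)
  have xB: "x u \<in> B u" and yB: "y u \<in> B u" if "u \<in> V" for u
    using x y that by (auto simp: direct_product_def)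
  have fE: "finite E" by (simp add: E_def)
  have tot: "(\<Sum>i\<in>E. \<Sum>u\<in>V. \<bar>p i u\<bar>) = (\<Sum>u\<in>V. \<bar>\<Sum>i\<in>E. p i u\<bar>)"
    using l pV by (simp add: l1_def yxu)
  have degE: "int (deg inc E u) = \<bar>y u - x u\<bar>" if "u \<in> V" for u
    using decomposition_signs(1)[OF V fE tot that] by (simp add: deg_def inc_def yxu)
  have pos: "x u + (\<Sum>i\<in>I. p i u) = x u + \<sigma> u * int (deg inc I u)" if "u \<in> V" "I \<subseteq> E" for u I
  proof -
    have "(\<Sum>i\<in>I. p i u) = (\<Sum>i\<in>I. \<sigma> u * \<bar>p i u\<bar>)"
      using decomposition_signs(2)[OF V fE tot that(1)] that(2)
      by (intro sum.cong) (auto simp: \<sigma>_def)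
    also have "\<dots> = \<sigma> u * int (deg inc I u)"
      by (simp add: deg_def inc_def sum_distrib_left)
    finally show ?thesis by simp
  qed
  have zz: "x + (\<Sum>i\<in>I. p i) \<in> J \<inter> direct_product V B" if "I \<subseteq> E" "feas V inc D I" for I
  proof
    show "x + (\<Sum>i\<in>I. p i) \<in> J" using sub[of I] that by (simp add: E_def p_def)
    have "x u + (\<Sum>i\<in>I. p i u) = 0" if "u \<notin> V" for u
    proof -
      have "p i u = 0" if "i \<in> I" for i
        using pV(1)[of i] \<open>I \<subseteq> E\<close> \<open>u \<notin> V\<close> that by (auto simp: int_vecs_def)
      moreover have "x u = 0" using x that by (auto simp: direct_product_def int_vecs_def)
      ultimately show ?thesis by simp
    qed
    moreover have "x u + (\<Sum>i\<in>I. p i u) \<in> B u" if "u \<in> V" for u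
      using pos[OF that \<open>I \<subseteq> E\<close>] \<open>feas V inc D I\<close> that by (simp add: feas_def D_def)
    ultimately show "x + (\<Sum>i\<in>I. p i) \<in> direct_product V B"
      by (simp add: direct_product_def int_vecs_def sum_fun_apply)
  qed
  have wI: "sum w I = (\<Sum>u\<in>V. c u * (x + (\<Sum>i\<in>I. p i)) u) - (\<Sum>u\<in>V. c u * x u)" for I
  proof -
    have "sum w I = (\<Sum>u\<in>V. \<Sum>i\<in>I. c u * p i u)" unfolding w_def by (rule sum.swap)
    also have "\<dots> = (\<Sum>u\<in>V. c u * (\<Sum>i\<in>I. p i u))" by (simp add: sum_distrib_left)
    finally show ?thesis by (simp add: sum_fun_apply distrib_left sum.distrib)
  qed
  have "sum w E \<le> g * int (card E)"
  proof (rule gain_bound[OF V fE _ _ g])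
    fix i assume i: "i \<in> E"
    have "(\<Sum>u\<in>V. inc i u) = 2"
    proof -
      have "int (\<Sum>u\<in>V. inc i u) = l1 V (p i)" by (simp add: inc_def l1_def)
      then have "int (\<Sum>u\<in>V. inc i u) = int 2" using pV(2)[OF i] by (simp only: of_nat_numeral)
      then show ?thesis by (simp only: of_nat_eq_iff)
    qed
    moreover have "inc i u = 0" if "u \<notin> V" for u
      using pV(1)[OF i] that by (auto simp: int_vecs_def inc_def)
    ultimately show "\<exists>a\<in>V. \<exists>b\<in>V. joins inc i a b"
      unfolding joins_def using joins_of_sum_two[OF V] by blast
  next
    fix u assume u: "u \<in> V"
    have s: "\<sigma> u = sgn (y u - x u)" by (simp add: \<sigma>_def yxu)
    have end_val: "x u + \<sigma> u * int (deg inc E u) = y u"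
      using degE[OF u] s by (simp add: sgn_mult_abs)
    have "k - 1 \<in> D u \<and> k + 1 \<in> D u" if k: "k \<le> deg inc E u" "k \<notin> D u" for k
    proof -
      have z: "x u + \<sigma> u * int k \<notin> B u" using k by (simp add: D_def)
      then have k0: "1 \<le> k" using xB[OF u] by (cases k) auto
      consider "x u < y u" | "y u < x u" | "x u = y u" by linarith
      then show ?thesis
      proof cases
        case 1
        then have s1: "\<sigma> u = 1" using s by simp
        have "x u + int k \<le> y u" using k(1) degE[OF u] 1 by linarith
        from no_gap[of "B u" "x u" "y u" "x u + int k"] this B[OF u] xB[OF u] yB[OF u] z s1
        show ?thesis using k0 by (simp add: D_def add.assoc of_nat_diff algebra_simps)
      next
        case 2
        then have s1: "\<sigma> u = -1" using s by simp
        have "y u \<le> x u - int k" using k(1) degE[OF u] 2 by linarith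
        from no_gap[of "B u" "y u" "x u" "x u - int k"] this B[OF u] xB[OF u] yB[OF u] z s1
        show ?thesis using k0 by (simp add: D_def add.assoc of_nat_diff algebra_simps)
      next
        case 3
        then show ?thesis using degE[OF u] k k0 by simp
      qed
    qed
    then show "jumpy (deg inc E u) (D u)"
      unfolding jumpy_def using xB[OF u] yB[OF u] end_val by (simp add: D_def)
  next
    fix I assume I: "I \<subseteq> E" "feas V inc D I" "card (bad V (deg inc I) D) \<le> 2"
    let ?z = "x + (\<Sum>i\<in>I. p i)"
    have "{u\<in>V. \<not> in_run (B u) (x u) (?z u)} \<subseteq> bad V (deg inc I) D"
    proof
      fix u assume "u \<in> {u\<in>V. \<not> in_run (B u) (x u) (?z u)}"
      then have u: "u \<in> V" "\<not> in_run (B u) (x u) (?z u)" by auto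
      have z: "?z u = x u + \<sigma> u * int (deg inc I u)"
        using pos[OF u(1) I(1)] by (simp add: sum_fun_apply)
      have "in_run (B u) (x u) (?z u)" if gd: "good (deg inc I u) (D u)"
        unfolding in_run_def z
      proof (intro conjI allI impI)
        show "even (x u + \<sigma> u * int (deg inc I u) - x u)" using gd by (simp add: good_def)
        fix t assume t: "even (t - x u) \<and> min (x u) (x u + \<sigma> u * int (deg inc I u)) \<le> t \<and>
          t \<le> max (x u) (x u + \<sigma> u * int (deg inc I u))"
        define k where "k = nat \<bar>t - x u\<bar>"
        have k: "even k" using t by (simp add: k_def even_nat_iff)
        have "\<sigma> u = 1 \<or> \<sigma> u = -1 \<or> \<sigma> u = 0" by (auto simp: \<sigma>_def sgn_if)
        then have "k \<le> deg inc I u" "t = x u + \<sigma> u * int k" using t by (auto simp: k_def)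
        then show "t \<in> B u" using gd k by (auto simp: good_def D_def)
      qed
      then show "u \<in> bad V (deg inc I) D" using u by (auto simp: bad_def)
    qed
    moreover have "finite (bad V (deg inc I) D)" using V by (simp add: bad_def)
    ultimately have "card {u\<in>V. \<not> in_run (B u) (x u) (?z u)} \<le> card (bad V (deg inc I) D)"
      by (intro card_mono)
    then have "card {u\<in>V. \<not> in_run (B u) (x u) (?z u)} \<le> 2" using I(3) by (rule order_trans)
    then show "sum w I \<le> g" using le[OF zz[OF I(1,2)]] wI[of I] by simp
  qed
  moreover have "sum w E = (\<Sum>u\<in>V. c u * y u) - (\<Sum>u\<in>V. c u * x u)"
    using wI[of E] unfolding yx[symmetric] add_diff_eq diff_add_cancel add_diff_cancel_left' .
  moreover have "g * int (card E) \<le> g * (\<Sum>u\<in>V. int (card (B u)))"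
  proof (rule mult_left_mono[OF _ g])
    have "2 * int (card E) \<le> (\<Sum>u\<in>V. 2 * int (card (B u)))"
      unfolding l[symmetric] l1_def
      by (rule sum_mono) (use spread_le_card B xB yB in simp)
    also have "\<dots> = 2 * (\<Sum>u\<in>V. int (card (B u)))" by (simp add: sum_distrib_left)
    finally show "int (card E) \<le> (\<Sum>u\<in>V. int (card (B u)))" by simp
  qed
  ultimately show ?thesis by linarith
qed

section \<open>Running time calculus\<close>

lemma int_len_le_iff: "int_len k \<le> Suc m \<longleftrightarrow> \<bar>k\<bar> < 2 ^ m"
proof -
  have "int_len k \<le> Suc m \<longleftrightarrow> floorlog 2 (nat \<bar>k\<bar>) \<le> m" by (simp add: int_len_def)
  also have "\<dots> \<longleftrightarrow> nat \<bar>k\<bar> < 2 ^ m"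
    by (simp add: floorlog_le_iff)
  also have "\<dots> \<longleftrightarrow> \<bar>k\<bar> < 2 ^ m"
    by (simp add: nat_less_iff)
  finally show ?thesis .
qed

lemma int_len_pos: "1 \<le> int_len k"
  by (simp add: int_len_def)

lemma int_len_bound: "\<bar>k\<bar> < 2 ^ (int_len k - 1)"
  using int_len_le_iff[of k "int_len k - 1"] int_len_pos[of k] by simp

lemma int_len_mono: "\<bar>k\<bar> \<le> \<bar>m\<bar> \<Longrightarrow> int_len k \<le> int_len m"
  using int_len_le_iff[of k "int_len m - 1"] int_len_bound[of m] int_len_pos[of m] by simp

lemma int_len_small [simp]: "int_len 0 = 1" "int_len 1 = 2" "int_len 2 = 3"
proof -
  show "int_len 0 = 1" by (simp add: int_len_def floorlog_def)
  have "int_len 1 \<le> Suc 1" "\<not> int_len 1 \<le> Suc 0" by (simp_all add: int_len_le_iff)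
  then show "int_len 1 = 2" by simp
  show "int_len 2 = 3" using int_len_le_iff[of 2 2] int_len_le_iff[of 2 1] by simp
qed

lemma int_len_add: "int_len (a + b) \<le> int_len a + int_len b"
  and int_len_diff: "int_len (a - b) \<le> int_len a + int_len b"
  and int_len_mult: "int_len (a * b) \<le> int_len a + int_len b"
proof -
  obtain p q where pq: "int_len a = Suc p" "int_len b = Suc q"
    using int_len_pos by (metis One_nat_def Suc_le_D)
  have ab: "\<bar>a\<bar> < 2 ^ p" "\<bar>b\<bar> < 2 ^ q" using int_len_bound[of a] int_len_bound[of b] pq by simp_all
  have "(2::int) ^ p \<le> 2 ^ (p + q)" "(2::int) ^ q \<le> 2 ^ (p + q)" by simp_all
  then have "\<bar>a\<bar> + \<bar>b\<bar> < 2 ^ Suc (p + q)" using ab unfolding power_Suc by linarith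
  then have "\<bar>a + b\<bar> < 2 ^ Suc (p + q)" "\<bar>a - b\<bar> < 2 ^ Suc (p + q)" by linarith+
  then show "int_len (a + b) \<le> int_len a + int_len b" "int_len (a - b) \<le> int_len a + int_len b"
    using int_len_le_iff[of "a + b" "Suc (p + q)"] int_len_le_iff[of "a - b" "Suc (p + q)"] pq by simp_all
  have "\<bar>a\<bar> * \<bar>b\<bar> < 2 ^ p * 2 ^ q" using ab by (intro mult_strict_mono') auto
  then have "\<bar>a * b\<bar> < 2 ^ (p + q)" by (simp add: abs_mult power_add)
  then show "int_len (a * b) \<le> int_len a + int_len b"
    using int_len_le_iff[of "a * b" "p + q"] pq by simp
qed

text \<open>The result of an operation is at most as long as its arguments together, for products as
  for sums, so a value has at most \<open>Z\<close> bits per leaf. A cell is one leaf whatever its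
  index, because the bound on the memory applies to its content.\<close>

fun leaves :: "aexp \<Rightarrow> nat" where
  "leaves (Const k) = 1"
| "leaves (Cell a e) = 1"
| "leaves (Plus e f) = leaves e + leaves f"
| "leaves (Minus e f) = leaves e + leaves f"
| "leaves (Times e f) = leaves e + leaves f"

fun aweight :: "aexp \<Rightarrow> nat" where
  "aweight (Const k) = 1"
| "aweight (Cell a e) = aweight e + 1"
| "aweight (Plus e f) = aweight e + aweight f + (leaves e + leaves f)"
| "aweight (Minus e f) = aweight e + aweight f + (leaves e + leaves f)"
| "aweight (Times e f) = aweight e + aweight f + (leaves e + leaves f)"

fun bweight :: "bexp \<Rightarrow> nat" where
  "bweight (Less e f) = aweight e + aweight f + 1"
| "bweight (Neg b) = bweight b + 1"
| "bweight (Conj b d) = bweight b + bweight d + 1"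

text \<open>The constant 2 is the step within a parity run; its bit length 3 is the reason for
  \<open>3 \<le> Z\<close> in \<open>short_cells\<close>.\<close>

fun small_aexp :: "aexp \<Rightarrow> bool" where
  "small_aexp (Const k) \<longleftrightarrow> \<bar>k\<bar> \<le> 2"
| "small_aexp (Cell a e) \<longleftrightarrow> small_aexp e"
| "small_aexp (Plus e f) \<longleftrightarrow> small_aexp e \<and> small_aexp f"
| "small_aexp (Minus e f) \<longleftrightarrow> small_aexp e \<and> small_aexp f"
| "small_aexp (Times e f) \<longleftrightarrow> small_aexp e \<and> small_aexp f"

fun small_bexp :: "bexp \<Rightarrow> bool" where
  "small_bexp (Less e f) \<longleftrightarrow> small_aexp e \<and> small_aexp f"
| "small_bexp (Neg b) \<longleftrightarrow> small_bexp b"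
| "small_bexp (Conj b d) \<longleftrightarrow> small_bexp b \<and> small_bexp d"

definition short_cells :: "nat \<Rightarrow> state \<Rightarrow> bool" where
  "short_cells Z s \<longleftrightarrow> 3 \<le> Z \<and> (\<forall>a i. int_len (s a i) \<le> Z)"

lemma aval_len:
  assumes "short_cells Z s"
  shows "small_aexp e \<Longrightarrow> int_len (aval e s) \<le> leaves e * Z"
proof (induction e)
  case (Const k)
  have "int_len k \<le> int_len 2" using Const by (intro int_len_mono) simp
  then show ?case using assms by (simp add: short_cells_def)
next
  case (Plus e f)
  then show ?case
    using int_len_add[of "aval e s" "aval f s"] by (simp add: algebra_simps)
next
  case (Minus e f)
  then show ?case
    using int_len_diff[of "aval e s" "aval f s"] by (simp add: algebra_simps)
next
  case (Times e f)
  then show ?case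
    using int_len_mult[of "aval e s" "aval f s"] by (simp add: algebra_simps)
qed (use assms in \<open>auto simp: short_cells_def\<close>)

lemma acost_le:
  assumes "short_cells Z s"
  shows "small_aexp e \<Longrightarrow> acost e s \<le> aweight e * Z"
proof (induction e)
  case (Const k)
  then show ?case using aval_len[OF assms Const] by simp
next
  case (Cell a e)
  have "int_len (s a (aval e s)) \<le> Z" using assms by (simp add: short_cells_def)
  then show ?case using Cell by simp
next
  case (Plus e f)
  then show ?case using aval_len[OF assms Plus.prems] by (simp add: algebra_simps)
next
  case (Minus e f)
  then show ?case using aval_len[OF assms Minus.prems] by (simp add: algebra_simps)
next
  case (Times e f)
  then show ?case using aval_len[OF assms Times.prems] by (simp add: algebra_simps)
qed

lemma bcost_le:
  assumes "short_cells Z s"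
  shows "small_bexp b \<Longrightarrow> bcost b s \<le> bweight b * Z"
proof (induction b)
  case (Less e f)
  have "3 \<le> Z" using assms by (simp add: short_cells_def)
  then show ?case using acost_le[OF assms, of e] acost_le[OF assms, of f] Less by (simp add: algebra_simps)
next
  case (Neg b)
  have "3 \<le> Z" using assms by (simp add: short_cells_def)
  then show ?case using Neg by simp
next
  case (Conj b d)
  have "3 \<le> Z" using assms by (simp add: short_cells_def)
  then show ?case using Conj by (simp add: algebra_simps)
qed

text \<open>Every loop is charged \<open>Z\<close> iterations. The bound is polymorphic so that it can also be evaluated
  at a polynomial, which yields the polynomial of the theorem.\<close>

fun time_bound :: "'a::comm_semiring_1 \<Rightarrow> com \<Rightarrow> 'a" where
  "time_bound Z Skip = 1"
| "time_bound Z (Assign a e f) = 1 + of_nat (aweight e + aweight f) * Z"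
| "time_bound Z (Seq p q) = 1 + time_bound Z p + time_bound Z q"
| "time_bound Z (Cond b p q) = 1 + of_nat (bweight b) * Z + time_bound Z p + time_bound Z q"
| "time_bound Z (While b p) = (Z + 1) * (1 + of_nat (bweight b) * Z + time_bound Z p)"
| "time_bound Z (Query lo hi ans flag) = 1 + 3 * (Z * Z)"

lemma of_nat_time_bound: "of_nat (time_bound Z p) = time_bound (of_nat Z) p"
  by (induction p) (simp_all only: time_bound.simps of_nat_add of_nat_mult of_nat_1 of_nat_numeral of_nat_id)

lemma poly_time_bound: "poly (time_bound q p) x = time_bound (poly q x) p"
  for q :: "'a::comm_ring_1 poly"
  by (induction p) (simp_all only: time_bound.simps poly_add poly_mult poly_1 poly_of_nat poly_numeral)

lemma time_bound_mono:
  fixes x y :: real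
  assumes "0 \<le> x" "x \<le> y"
  shows "0 \<le> time_bound x p \<and> time_bound x p \<le> time_bound y p"
proof (induction p)
  case (While b p)
  have "real (bweight b) * x \<le> real (bweight b) * y" "0 \<le> real (bweight b) * x"
    using assms by (auto intro: mult_left_mono)
  then show ?case using While assms by (auto intro!: mult_mono)
next
  case (Cond b p q)
  have "real (bweight b) * x \<le> real (bweight b) * y" "0 \<le> real (bweight b) * x"
    using assms by (auto intro: mult_left_mono)
  then show ?case using Cond assms by auto
next
  case (Assign a e f)
  show ?case using assms by (auto intro!: mult_left_mono simp flip: of_nat_add)
next
  case (Query a b c d)
  then show ?case using assms by (auto intro!: mult_mono)
qed auto

text \<open>Total correctness with a time bound. The bound depends on the program text and on
  \<open>Z\<close> only, never on the state, so applying the rules to a program involves no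
  arithmetic on running times.\<close>

definition wp :: "nat \<Rightarrow> ((nat \<Rightarrow> int) set \<Rightarrow> (nat \<Rightarrow> int) option) \<Rightarrow> nat \<Rightarrow> com \<Rightarrow>
    (state \<Rightarrow> bool) \<Rightarrow> state \<Rightarrow> bool" where
  "wp n orc Z p Q s \<longleftrightarrow> (\<exists>t s'. exec n orc p s t s' \<and> t \<le> time_bound Z p \<and> Q s')"

lemma wp_mono: "wp n orc Z p Q s \<Longrightarrow> (\<And>s'. Q s' \<Longrightarrow> Q' s') \<Longrightarrow> wp n orc Z p Q' s"
  unfolding wp_def by blast

lemma wp_Skip: "Q s \<Longrightarrow> wp n orc Z Skip Q s"
  using exec_Skip[of n orc s] unfolding wp_def by fastforce

lemma wp_Assign:
  assumes "short_cells Z s" "small_aexp e" "small_aexp f" "Q (store a (aval e s) (aval f s) s)"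
  shows "wp n orc Z (Assign a e f) Q s"
proof -
  have "1 + acost e s + acost f s \<le> time_bound Z (Assign a e f)"
    using acost_le[OF assms(1,2)] acost_le[OF assms(1,3)] by (simp add: distrib_right)
  then show ?thesis using exec_Assign assms(4) unfolding wp_def by blast
qed

lemma wp_Seq:
  assumes "wp n orc Z p (wp n orc Z q Q) s"
  shows "wp n orc Z (Seq p q) Q s"
proof -
  obtain t s' where 1: "exec n orc p s t s'" "t \<le> time_bound Z p" "wp n orc Z q Q s'"
    using assms unfolding wp_def[of _ _ _ p] by blast
  then obtain u s'' where 2: "exec n orc q s' u s''" "u \<le> time_bound Z q" "Q s''"
    unfolding wp_def by blast
  have "1 + t + u \<le> time_bound Z (Seq p q)" using 1(2) 2(2) by simp
  then show ?thesis using exec_Seq[OF 1(1) 2(1)] 2(3) unfolding wp_def by blast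
qed

lemma wp_Cond:
  assumes "short_cells Z s" "small_bexp b"
    and "bval b s \<Longrightarrow> wp n orc Z p Q s" "\<not> bval b s \<Longrightarrow> wp n orc Z q Q s"
  shows "wp n orc Z (Cond b p q) Q s"
proof (cases "bval b s")
  case True
  then obtain t s' where 1: "exec n orc p s t s'" "t \<le> time_bound Z p" "Q s'"
    using assms(3) unfolding wp_def by blast
  have "1 + bcost b s + t \<le> time_bound Z (Cond b p q)"
    using 1(2) bcost_le[OF assms(1,2)] by simp
  then show ?thesis using exec_CondTrue[OF True 1(1)] 1(3) unfolding wp_def by blast
next
  case False
  then obtain t s' where 1: "exec n orc q s t s'" "t \<le> time_bound Z q" "Q s'"
    using assms(4) unfolding wp_def by blast
  have "1 + bcost b s + t \<le> time_bound Z (Cond b p q)"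
    using 1(2) bcost_le[OF assms(1,2)] by simp
  then show ?thesis using exec_CondFalse[OF False 1(1)] 1(3) unfolding wp_def by blast
qed

text \<open>The measure at the start bounds the number of iterations; the additional 1 in
  \<open>Z + 1\<close> pays for the last, failing test.\<close>

lemma wp_While:
  fixes \<mu> :: "state \<Rightarrow> nat"
  assumes sb: "small_bexp b" and I: "I s" and Z: "\<mu> s \<le> Z"
    and sc: "\<And>s. I s \<Longrightarrow> short_cells Z s"
    and step: "\<And>s. I s \<Longrightarrow> bval b s \<Longrightarrow> wp n orc Z p (\<lambda>s'. I s' \<and> \<mu> s' < \<mu> s) s"
    and fin: "\<And>s. I s \<Longrightarrow> \<not> bval b s \<Longrightarrow> Q s"
  shows "wp n orc Z (While b p) Q s"
proof -
  let ?c = "1 + bweight b * Z + time_bound Z p"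
  have "\<exists>t s'. exec n orc (While b p) s t s' \<and> t \<le> (\<mu> s + 1) * ?c \<and> Q s'"
    using I
  proof (induction "\<mu> s" arbitrary: s rule: less_induct)
    case less
    note bc = bcost_le[OF sc[OF less.prems] sb]
    show ?case
    proof (cases "bval b s")
      case False
      have "1 + bcost b s \<le> 1 * ?c" using bc by simp
      also have "\<dots> \<le> (\<mu> s + 1) * ?c" by (rule mult_le_mono1) simp
      finally show ?thesis using exec_WhileFalse[OF False] fin[OF less.prems False] by blast
    next
      case True
      obtain t s' where 1: "exec n orc p s t s'" "t \<le> time_bound Z p" "I s'" "\<mu> s' < \<mu> s"
        using step[OF less.prems True] unfolding wp_def by blast
      obtain u s'' where 2: "exec n orc (While b p) s' u s''" "u \<le> (\<mu> s' + 1) * ?c" "Q s''"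
        using less.hyps[OF 1(4,3)] by blast
      have "1 + bcost b s + t + u \<le> ?c + (\<mu> s' + 1) * ?c" using 1(2) 2(2) bc by linarith
      also have "\<dots> = (\<mu> s' + 1 + 1) * ?c" by simp
      also have "\<dots> \<le> (\<mu> s + 1) * ?c" by (rule mult_le_mono1) (use 1(4) in simp)
      finally show ?thesis using exec_WhileTrue[OF True 1(1) 2(1)] 2(3) by blast
    qed
  qed
  then obtain t s' where t: "exec n orc (While b p) s t s'" "t \<le> (\<mu> s + 1) * ?c" "Q s'" by blast
  note t(2)
  also have "(\<mu> s + 1) * ?c \<le> (Z + 1) * ?c" by (rule mult_le_mono1) (use Z in simp)
  finally show ?thesis using t unfolding wp_def by auto
qed

lemma wp_Query:
  assumes "short_cells Z s" "n \<le> Z"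
    and "\<And>x. orc (query_set n s lo hi) = Some x \<Longrightarrow>
      (\<forall>v<n. int_len (x v) \<le> Z) \<and> Q (store flag 0 1 (store_vec n ans x s))"
    and "orc (query_set n s lo hi) = None \<Longrightarrow> Q (store flag 0 0 s)"
  shows "wp n orc Z (Query lo hi ans flag) Q s"
proof -
  have vl: "vec_len n y \<le> Z * Z" if "\<forall>v<n. int_len (y v) \<le> Z" for y
  proof -
    have "vec_len n y \<le> of_nat (card {..<n}) * Z"
      unfolding vec_len_def by (rule sum_bounded_above) (use that in auto)
    also have "\<dots> \<le> Z * Z" using assms(2) by simp
    finally show ?thesis .
  qed
  have rv: "\<forall>v<n. int_len (read_vec n s a v) \<le> Z" for a
    using assms(1) by (simp add: read_vec_def short_cells_def)
  note l = vl[OF rv]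
  show ?thesis
  proof (cases "orc (query_set n s lo hi)")
    case None
    have "1 + vec_len n (read_vec n s lo) + vec_len n (read_vec n s hi) \<le>
        time_bound Z (Query lo hi ans flag)"
      using l[of lo] l[of hi] by simp
    then show ?thesis using exec_QueryNone[of orc n s lo hi, OF None] assms(4)[OF None] unfolding wp_def by blast
  next
    case (Some x)
    have "1 + vec_len n (read_vec n s lo) + vec_len n (read_vec n s hi) + vec_len n x \<le>
        time_bound Z (Query lo hi ans flag)"
      using l[of lo] l[of hi] vl[of x] assms(3)[OF Some] by simp
    then show ?thesis using exec_QuerySome[of orc n s lo hi, OF Some] assms(3)[OF Some] unfolding wp_def by blast
  qed
qed

abbreviation scalar :: "array_name \<Rightarrow> aexp" where
  "scalar a \<equiv> Cell a (Const 0)"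

abbreviation set_scalar :: "array_name \<Rightarrow> aexp \<Rightarrow> com" where
  "set_scalar a e \<equiv> Assign a (Const 0) e"

definition For :: "array_name \<Rightarrow> aexp \<Rightarrow> com \<Rightarrow> com" where
  "For i e p = Seq (set_scalar i (Const 0))
     (While (Less (scalar i) e) (Seq p (set_scalar i (Plus (scalar i) (Const 1)))))"

lemma short_cells_store: "short_cells Z s \<Longrightarrow> int_len k \<le> Z \<Longrightarrow> short_cells Z (store a i k s)"
  by (auto simp: short_cells_def store_def)

text \<open>The body has to leave the counter at \<open>k\<close>, and the invariant is required of
  the state after the increment, so that it may mention the counter. The limit \<open>e\<close> is
  evaluated afresh in every round; \<open>inv\<close> keeps its value at \<open>m\<close>.\<close>

lemma wp_For:
  assumes s: "short_cells Z s" and sm: "small_aexp e" and m: "int_len (int m) \<le> Z" "m \<le> Z"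
    and start: "I 0 (store i 0 0 s)"
    and inv: "\<And>k s. I k s \<Longrightarrow> short_cells Z s \<and> s i 0 = int k \<and> aval e s = int m"
    and step: "\<And>k s. k < m \<Longrightarrow> I k s \<Longrightarrow> wp n orc Z p (\<lambda>s'. short_cells Z s' \<and> s' i 0 = int k \<and>
        I (Suc k) (store i 0 (int (Suc k)) s')) s"
    and fin: "\<And>s. I m s \<Longrightarrow> Q s"
  shows "wp n orc Z (For i e p) Q s"
  unfolding For_def
proof (intro wp_Seq wp_Assign[OF s])
  let ?I = "\<lambda>s. \<exists>k\<le>m. I k s"
  let ?\<mu> = "\<lambda>s. m - nat (s i 0)"
  show "wp n orc Z (While (Less (scalar i) e) (Seq p (set_scalar i (Plus (scalar i) (Const 1))))) Q
      (store i (aval (Const 0) s) (aval (Const 0) s) s)"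
  proof (rule wp_While[where I = ?I and \<mu> = ?\<mu>])
    show "?I (store i (aval (Const 0) s) (aval (Const 0) s) s)" using start by auto
    show "wp n orc Z (Seq p (set_scalar i (Plus (scalar i) (Const 1)))) (\<lambda>s''. ?I s'' \<and> ?\<mu> s'' < ?\<mu> s') s'"
      if Is: "?I s'" and b: "bval (Less (scalar i) e) s'" for s'
    proof -
      obtain k where k: "k \<le> m" "I k s'" using Is by blast
      then have km: "k < m" using b inv[OF k(2)] by simp
      show ?thesis
      proof (rule wp_Seq, rule wp_mono[OF step[OF km k(2)]])
        fix s1 assume 1: "short_cells Z s1 \<and> s1 i 0 = int k \<and> I (Suc k) (store i 0 (int (Suc k)) s1)"
        show "wp n orc Z (set_scalar i (Plus (scalar i) (Const 1))) (\<lambda>s''. ?I s'' \<and> ?\<mu> s'' < ?\<mu> s') s1"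
        proof (rule wp_Assign)
          have st: "store i (aval (Const 0) s1) (aval (Plus (scalar i) (Const 1)) s1) s1 =
              store i 0 (int (Suc k)) s1"
            using 1 by (simp add: add.commute)
          have v: "store i 0 (int (Suc k)) s1 i 0 = int (Suc k)" by (simp add: store_def)
          have v': "s' i 0 = int k" using inv[OF k(2)] by blast
          have "?I (store i 0 (int (Suc k)) s1)" using 1 km by (intro exI[of _ "Suc k"]) simp
          moreover have "?\<mu> (store i 0 (int (Suc k)) s1) < ?\<mu> s'"
            unfolding v v' using km by (simp del: of_nat_Suc)
          ultimately show "?I (store i (aval (Const 0) s1) (aval (Plus (scalar i) (Const 1)) s1) s1) \<and>
              ?\<mu> (store i (aval (Const 0) s1) (aval (Plus (scalar i) (Const 1)) s1) s1) < ?\<mu> s'"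
            unfolding st by blast
        qed (use 1 in auto)
      qed
    qed
    show "Q s'" if Is: "?I s'" and b: "\<not> bval (Less (scalar i) e) s'" for s'
    proof -
      obtain k where k: "k \<le> m" "I k s'" using Is by blast
      then have "k = m" using b inv[OF k(2)] by simp
      then show ?thesis using fin k by blast
    qed
    show "short_cells Z s'" if "?I s'" for s' using that inv by blast
  qed (use m sm in simp_all)
qed simp_all

section \<open>The local search program\<close>

definition Equal :: "aexp \<Rightarrow> aexp \<Rightarrow> bexp" where
  "Equal e f = Conj (Neg (Less e f)) (Neg (Less f e))"

definition copy_vec :: "array_name \<Rightarrow> array_name \<Rightarrow> com" where
  "copy_vec a b = For ''v'' (scalar ''n'') (Assign b (scalar ''v'') (Cell a (scalar ''v'')))"

definition dot_product :: "array_name \<Rightarrow> array_name \<Rightarrow> com" where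
  "dot_product a r = Seq (set_scalar r (Const 0)) (For ''v'' (scalar ''n'')
     (set_scalar r (Plus (scalar r) (Times (Cell ''c'' (scalar ''v'')) (Cell a (scalar ''v''))))))"

text \<open>One pass suffices because the elements of each \<open>B v\<close> are visited in
  monotone order: the run end of the owner moves by \<open>\<delta>\<close> whenever the next point
  of the run appears. The expression \<open>e\<close> gives the scanning order, which is reversed
  for the lower ends.\<close>

definition extend_runs :: "array_name \<Rightarrow> int \<Rightarrow> aexp \<Rightarrow> com" where
  "extend_runs a \<delta> e = For ''i'' (scalar ''L'')
     (Cond (Equal (Plus (Cell a (Cell ''own'' e)) (Const \<delta>)) (Cell ''B'' e))
        (Assign a (Cell ''own'' e) (Cell ''B'' e)) Skip)"

definition fix_coordinate :: "array_name \<Rightarrow> com" where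
  "fix_coordinate i = Seq
     (Assign ''ql'' (Cell ''own'' (scalar i)) (Cell ''B'' (scalar i)))
     (Assign ''qh'' (Cell ''own'' (scalar i)) (Cell ''B'' (scalar i)))"

definition adopt_answer :: com where
  "adopt_answer = Seq (set_scalar ''bv'' (scalar ''av''))
     (Seq (set_scalar ''go'' (Const 1)) (copy_vec ''ans'' ''x''))"

definition evaluate_answer :: com where
  "evaluate_answer = Seq (dot_product ''ans'' ''av'')
     (Cond (Less (scalar ''bv'') (scalar ''av'')) adopt_answer Skip)"

definition query_box :: com where
  "query_box = Seq (Query ''ql'' ''qh'' ''ans'' ''fl'')
     (Cond (Less (Const 0) (scalar ''fl'')) evaluate_answer Skip)"

definition try_pair :: com where
  "try_pair = Seq (copy_vec ''lo'' ''ql'') (Seq (copy_vec ''hi'' ''qh'')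
     (Seq (fix_coordinate ''i'') (Seq (fix_coordinate ''j'') query_box)))"

text \<open>The bounds \<open>lo\<close> and \<open>hi\<close> belong to the point at the start of
  the round and stay fixed while the pairs are tried, whereas \<open>x\<close> holds the best answer
  so far.\<close>

definition improve :: com where
  "improve = Seq (copy_vec ''x'' ''hi'') (Seq (extend_runs ''hi'' 2 (scalar ''i''))
     (Seq (copy_vec ''x'' ''lo'')
     (Seq (extend_runs ''lo'' (- 2) (Minus (Minus (scalar ''L'') (Const 1)) (scalar ''i'')))
     (Seq (dot_product ''x'' ''bv'') (Seq (set_scalar ''go'' (Const 0))
     (For ''i'' (scalar ''L'') (For ''j'' (scalar ''L'') try_pair)))))))"

definition set_owners :: com where
  "set_owners = For ''v'' (scalar ''n'') (For ''k'' (Cell ''len'' (scalar ''v''))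
     (Seq (Assign ''own'' (scalar ''L'') (scalar ''v'')) (set_scalar ''L'' (Plus (scalar ''L'') (Const 1)))))"

definition local_search :: com where
  "local_search = Seq set_owners (Seq (copy_vec ''x0'' ''x'') (Seq (set_scalar ''go'' (Const 1))
     (While (Less (Const 0) (scalar ''go'')) improve)))"

section \<open>Frame conditions and the layout of the input\<close>

definition keeps :: "array_name set \<Rightarrow> state \<Rightarrow> state \<Rightarrow> bool" where
  "keeps A s s' \<longleftrightarrow> (\<forall>a. a \<notin> A \<longrightarrow> s' a = s a)"

lemma keeps_refl: "keeps A s s"
  by (simp add: keeps_def)

lemma keeps_store: "keeps A s s' \<Longrightarrow> a \<in> A \<Longrightarrow> keeps A s (store a i k s')"
  by (auto simp: keeps_def store_def)

lemma keeps_trans: "keeps A s s' \<Longrightarrow> keeps A' s' s'' \<Longrightarrow> A \<subseteq> C \<Longrightarrow> A' \<subseteq> C \<Longrightarrow> keeps C s s''"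
  unfolding keeps_def by (metis subsetD)

lemma keepsD: "keeps A s s' \<Longrightarrow> a \<notin> A \<Longrightarrow> s' a = s a"
  by (simp add: keeps_def)

lemma store_apply: "store a i k s b = (if b = a then (s a)(i := k) else s b)"
  by (simp add: store_def)

text \<open>The list behind the input array \<open>B\<close>, with every element labelled by its
  coordinate.\<close>

definition entries :: "(nat \<Rightarrow> int set) \<Rightarrow> nat \<Rightarrow> (nat \<times> int) list" where
  "entries B m = concat (map (\<lambda>v. map (Pair v) (sorted_list_of_set (B v))) [0..<m])"

lemma entries_Suc: "entries B (Suc m) = entries B m @ map (Pair m) (sorted_list_of_set (B m))"
  by (simp add: entries_def)

lemma length_entries: "length (entries B m) = (\<Sum>v<m. card (B v))"
  by (induction m) (simp_all add: entries_Suc, simp add: entries_def)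

lemma entries_prefix: "v \<le> m \<Longrightarrow> \<exists>zs. entries B m = entries B v @ zs"
proof (induction m)
  case (Suc m)
  then show ?case by (cases "v = Suc m") (auto simp: entries_Suc)
qed simp

lemma entries_nth:
  assumes "v < m" "k < card (B v)"
  shows "entries B m ! ((\<Sum>u<v. card (B u)) + k) = (v, sorted_list_of_set (B v) ! k)"
proof -
  obtain zs where "entries B m = entries B (Suc v) @ zs" using entries_prefix[of "Suc v" m B] assms by auto
  then show ?thesis
    using assms length_entries[of B v] by (simp add: entries_Suc nth_append)
qed

lemma set_entries: "(\<And>v. v < m \<Longrightarrow> finite (B v)) \<Longrightarrow> set (entries B m) = (SIGMA v:{..<m}. B v)"
  by (auto simp: entries_def)

lemma sorted_entries:
  "sorted_wrt (\<lambda>p q. fst p < fst q \<or> fst p = fst q \<and> snd p \<le> snd q) (entries B m)"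
proof (induction m)
  case 0
  then show ?case by (simp add: entries_def)
next
  case (Suc m)
  have "p \<in> set (entries B m) \<Longrightarrow> fst p < m" for p
    by (auto simp: entries_def)
  then show ?case using Suc sorted_sorted_list_of_set[of "B m"]
    by (auto simp: entries_Suc sorted_wrt_append sorted_wrt_map)
qed

lemma map_snd_entries: "map snd (entries B m) = concat (map (\<lambda>v. sorted_list_of_set (B v)) [0..<m])"
  by (simp add: entries_def map_concat comp_def)

locale jsi =
  fixes n :: nat and J :: "(nat \<Rightarrow> int) set" and B :: "nat \<Rightarrow> int set" and c :: "nat \<Rightarrow> int"
    and orc :: "(nat \<Rightarrow> int) set \<Rightarrow> (nat \<Rightarrow> int) option"
  assumes J: "sbo_jump {..<n} J"
    and B: "\<And>v. v < n \<Longrightarrow> finite (B v) \<and> jump_system_1d (B v)"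
    and orc: "optimization_oracle {..<n} J c orc"
begin

definition "L = (\<Sum>v<n. card (B v))"
definition "absB = (\<Sum>v<n. \<Sum>\<alpha>\<in>B v. \<bar>\<alpha>\<bar>)"
definition "absc = (\<Sum>v<n. \<bar>c v\<bar>)"
definition "own i = fst (entries B n ! i)"
definition "elt i = snd (entries B n ! i)"
definition "val x = (\<Sum>v<n. c v * x v)"
abbreviation "F \<equiv> J \<inter> direct_product {..<n} B"

lemma entry: "i < L \<Longrightarrow> own i < n \<and> elt i \<in> B (own i)"
proof -
  assume "i < L"
  then have "entries B n ! i \<in> set (entries B n)" by (simp add: L_def length_entries)
  then show ?thesis using set_entries[of n B] B by (auto simp: own_def elt_def)
qed

lemma entry_ex: "u < n \<Longrightarrow> b \<in> B u \<Longrightarrow> \<exists>i<L. own i = u \<and> elt i = b"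
proof -
  assume "u < n" "b \<in> B u"
  then have "(u, b) \<in> set (entries B n)" using set_entries[of n B] B by auto
  then obtain i where "i < length (entries B n)" "entries B n ! i = (u, b)"
    by (metis in_set_conv_nth)
  then show ?thesis by (auto simp: own_def elt_def L_def length_entries)
qed

lemma entry_sorted: "i < j \<Longrightarrow> j < L \<Longrightarrow> own i = own j \<Longrightarrow> elt i \<le> elt j"
  using sorted_entries[of B n] unfolding sorted_wrt_iff_nth_less
  by (fastforce simp: own_def elt_def L_def length_entries)

lemma abs_le_absB: "v < n \<Longrightarrow> b \<in> B v \<Longrightarrow> \<bar>b\<bar> \<le> absB"
proof -
  assume v: "v < n" "b \<in> B v"
  have "\<bar>b\<bar> \<le> (\<Sum>\<alpha>\<in>B v. \<bar>\<alpha>\<bar>)" using v B by (intro member_le_sum) auto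
  also have "\<dots> \<le> absB" unfolding absB_def using v by (intro member_le_sum) (auto simp: sum_nonneg)
  finally show ?thesis .
qed

lemma partial_le:
  assumes "k \<le> n" "\<forall>v<n. \<bar>y v\<bar> \<le> absB"
  shows "\<bar>\<Sum>v<k. c v * y v\<bar> \<le> absc * absB"
proof -
  have A: "0 \<le> absB" by (simp add: absB_def sum_nonneg)
  have "\<bar>\<Sum>v<k. c v * y v\<bar> \<le> (\<Sum>v<k. \<bar>c v * y v\<bar>)" by (rule sum_abs)
  also have "\<dots> \<le> (\<Sum>v<k. \<bar>c v\<bar> * absB)"
    by (rule sum_mono) (use assms in \<open>auto simp: abs_mult intro: mult_left_mono\<close>)
  also have "\<dots> \<le> (\<Sum>v<n. \<bar>c v\<bar> * absB)"
    by (rule sum_mono2) (use assms A in auto)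
  finally show ?thesis by (simp add: absc_def sum_distrib_right)
qed

lemma F_bound: "y \<in> F \<Longrightarrow> v < n \<Longrightarrow> \<bar>y v\<bar> \<le> absB"
  using abs_le_absB by (auto simp: direct_product_def)

lemma val_bound: "y \<in> F \<Longrightarrow> \<bar>val y\<bar> \<le> absc * absB"
  unfolding val_def by (rule partial_le) (auto simp: F_bound)

section \<open>Parity runs around the current point and the boxes built from them\<close>

definition run_end :: "(nat \<Rightarrow> int) \<Rightarrow> int \<Rightarrow> nat \<Rightarrow> int \<Rightarrow> bool" where
  "run_end x \<tau> u h \<longleftrightarrow> 0 \<le> \<tau> * (h - x u) \<and> even (h - x u) \<and>
     (\<forall>t. even (t - x u) \<and> 0 \<le> \<tau> * (t - x u) \<and> \<tau> * (t - x u) \<le> \<tau> * (h - x u) \<longrightarrow> t \<in> B u) \<and>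
     h + 2 * \<tau> \<notin> B u"

text \<open>Invariant of the scan: \<open>h\<close> is reached from \<open>x u\<close> inside
  \<open>B u\<close>, and no entry visited so far continues the run. After all \<open>L\<close>
  entries this becomes \<open>run_end\<close>.\<close>

definition run_part :: "(nat \<Rightarrow> int) \<Rightarrow> int \<Rightarrow> (nat \<Rightarrow> nat) \<Rightarrow> nat \<Rightarrow> nat \<Rightarrow> int \<Rightarrow> bool" where
  "run_part x \<tau> \<pi> k u h \<longleftrightarrow> 0 \<le> \<tau> * (h - x u) \<and> even (h - x u) \<and>
     (\<forall>t. even (t - x u) \<and> 0 \<le> \<tau> * (t - x u) \<and> \<tau> * (t - x u) \<le> \<tau> * (h - x u) \<longrightarrow> t \<in> B u) \<and>
     (\<forall>i<k. own (\<pi> i) = u \<longrightarrow> elt (\<pi> i) \<noteq> h + 2 * \<tau>)"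

definition scan :: "int \<Rightarrow> (nat \<Rightarrow> nat) \<Rightarrow> bool" where
  "scan \<tau> \<pi> \<longleftrightarrow> (\<tau> = 1 \<or> \<tau> = -1) \<and> bij_betw \<pi> {..<L} {..<L} \<and>
     (\<forall>i j. i < j \<and> j < L \<and> own (\<pi> i) = own (\<pi> j) \<longrightarrow> \<tau> * elt (\<pi> i) \<le> \<tau> * elt (\<pi> j))"

lemma scan_up: "scan 1 (\<lambda>i. i)"
  using entry_sorted bij_betw_id[of "{..<L}"] by (auto simp: scan_def id_def)

lemma scan_down: "scan (- 1) (\<lambda>i. L - 1 - i)"
proof -
  have "bij_betw (\<lambda>i. L - 1 - i) {..<L} {..<L}"
    by (rule bij_betw_byWitness[where f' = "\<lambda>i. L - 1 - i"]) auto
  moreover have "elt (L - 1 - j) \<le> elt (L - 1 - i)"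
    if "i < j" "j < L" "own (L - 1 - i) = own (L - 1 - j)" for i j
    using entry_sorted[of "L - 1 - j" "L - 1 - i"] that by auto
  ultimately show ?thesis by (auto simp: scan_def)
qed

lemma run_part_step:
  assumes s: "scan \<tau> \<pi>" and k: "k < L" and h: "run_part x \<tau> \<pi> k u h"
  shows "run_part x \<tau> \<pi> (Suc k) u
    (if u = own (\<pi> k) \<and> h + 2 * \<tau> = elt (\<pi> k) then elt (\<pi> k) else h)"
proof (cases "u = own (\<pi> k) \<and> h + 2 * \<tau> = elt (\<pi> k)")
  case True
  have \<tau>: "\<tau> = 1 \<or> \<tau> = -1" using s by (simp add: scan_def)
  have "\<pi> k < L" using s k by (auto simp: scan_def bij_betw_def)
  then have inB: "elt (\<pi> k) \<in> B u" using entry True by blast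
  have "run_part x \<tau> \<pi> (Suc k) u (h + 2 * \<tau>)"
    unfolding run_part_def
  proof (intro conjI allI impI)
    show "0 \<le> \<tau> * (h + 2 * \<tau> - x u)" "even (h + 2 * \<tau> - x u)"
      using h \<tau> by (auto simp: run_part_def)
    show "t \<in> B u" if t: "even (t - x u) \<and> 0 \<le> \<tau> * (t - x u) \<and> \<tau> * (t - x u) \<le> \<tau> * (h + 2 * \<tau> - x u)" for t
    proof (cases "t = h + 2 * \<tau>")
      case True
      then show ?thesis using inB \<open>u = own (\<pi> k) \<and> h + 2 * \<tau> = elt (\<pi> k)\<close> by simp
    next
      case False
      have "even (h - x u)" using h by (simp add: run_part_def)
      then have "\<tau> * (t - x u) \<le> \<tau> * (h - x u)" using t False \<tau> by auto presburger+
      then show ?thesis using h t by (simp add: run_part_def)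
    qed
    \<comment> \<open>Entries of \<open>u\<close> visited so far do not lie beyond the current one,
      so none of them can be the next point of the extended run.\<close>
    show "elt (\<pi> i) \<noteq> h + 2 * \<tau> + 2 * \<tau>" if "i < Suc k" "own (\<pi> i) = u" for i
    proof -
      have "\<tau> * elt (\<pi> i) \<le> \<tau> * elt (\<pi> k)"
        using s k that True by (cases "i = k") (auto simp: scan_def)
      then show ?thesis using True \<tau> by auto
    qed
  qed
  then show ?thesis using True by simp
next
  case False
  have "\<forall>i<Suc k. own (\<pi> i) = u \<longrightarrow> elt (\<pi> i) \<noteq> h + 2 * \<tau>"
    using h False by (auto simp: run_part_def less_Suc_eq)
  then show ?thesis using h False by (auto simp: run_part_def)
qed

lemma run_part_end:
  assumes s: "scan \<tau> \<pi>" and h: "run_part x \<tau> \<pi> L u h" and u: "u < n"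
  shows "run_end x \<tau> u h"
proof -
  have "h + 2 * \<tau> \<notin> B u"
  proof
    assume "h + 2 * \<tau> \<in> B u"
    then obtain i where i: "i < L" "own i = u" "elt i = h + 2 * \<tau>" using entry_ex[OF u] by blast
    moreover have "\<pi> ` {..<L} = {..<L}" using s by (simp add: scan_def bij_betw_def)
    ultimately obtain k where "k < L" "\<pi> k = i" by (metis imageE lessThan_iff)
    then show False using h i by (auto simp: run_part_def)
  qed
  then show ?thesis using h by (auto simp: run_part_def run_end_def)
qed

lemma run_endsD:
  assumes lo: "run_end x (- 1) u l" and hi: "run_end x 1 u h"
  shows "l \<le> h" "even (h - l)" "parity_interval l h \<subseteq> B u"
    "in_run (B u) (x u) z \<Longrightarrow> z \<in> parity_interval l h"
proof -
  have 1: "l \<le> x u" "x u \<le> h" "even (l - x u)" "even (h - x u)"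
    and l2: "l - 2 \<notin> B u" and h2: "h + 2 \<notin> B u"
    and lB: "\<And>t. even (t - x u) \<Longrightarrow> l \<le> t \<Longrightarrow> t \<le> x u \<Longrightarrow> t \<in> B u"
    and hB: "\<And>t. even (t - x u) \<Longrightarrow> x u \<le> t \<Longrightarrow> t \<le> h \<Longrightarrow> t \<in> B u"
    using lo hi by (auto simp: run_end_def)
  show "l \<le> h" using 1 by simp
  show 2: "even (h - l)" using 1 by presburger
  show "parity_interval l h \<subseteq> B u"
  proof
    fix t assume "t \<in> parity_interval l h"
    then have t: "l \<le> t" "t \<le> h" "even (t - l)" by (auto simp: parity_interval_def)
    then have "even (t - x u)" using 1 by presburger
    then show "t \<in> B u" using lB[of t] hB[of t] t by (cases "t \<le> x u") auto
  qed
  assume z: "in_run (B u) (x u) z"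
  then have ez: "even (z - x u)" by (simp add: in_run_def)
  have "z \<le> h"
  proof (rule ccontr)
    assume "\<not> z \<le> h"
    then have "h + 2 \<le> z" using ez 1 by presburger
    then have "h + 2 \<in> B u" using z 1 by (auto simp: in_run_def)
    then show False using h2 by simp
  qed
  moreover have "l \<le> z"
  proof (rule ccontr)
    assume "\<not> l \<le> z"
    then have "z \<le> l - 2" using ez 1 by presburger
    then have "l - 2 \<in> B u" using z 1 by (auto simp: in_run_def)
    then show False using l2 by simp
  qed
  moreover have "even (z - l)" using ez 1 by presburger
  ultimately show "z \<in> parity_interval l h" by (simp add: parity_interval_def)
qed

text \<open>The second update wins if both entries belong to one coordinate, as in the program.
  Taking \<open>i = j\<close> covers a single exceptional coordinate.\<close>

definition pinned :: "(nat \<Rightarrow> int) \<Rightarrow> nat \<Rightarrow> nat \<Rightarrow> nat \<Rightarrow> int" where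
  "pinned f i j = f(own i := elt i, own j := elt j)"

definition box :: "(nat \<Rightarrow> int) \<Rightarrow> (nat \<Rightarrow> int) \<Rightarrow> nat \<Rightarrow> nat \<Rightarrow> (nat \<Rightarrow> int) set" where
  "box l h i j = direct_product {..<n} (\<lambda>v. parity_interval (pinned l i j v) (pinned h i j v))"

definition tight :: "(nat \<Rightarrow> int) \<Rightarrow> (nat \<Rightarrow> int) \<Rightarrow> (nat \<Rightarrow> int) \<Rightarrow> bool" where
  "tight x l h \<longleftrightarrow> (\<forall>u<n. run_end x (- 1) u (l u) \<and> run_end x 1 u (h u))"

lemma parity_interval_single [simp]: "parity_interval a a = {a}"
  by (auto simp: parity_interval_def)

lemma box_sub:
  assumes "tight x l h" "i < L" "j < L"
  shows "box l h i j \<subseteq> direct_product {..<n} B"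
proof -
  have "parity_interval (pinned l i j v) (pinned h i j v) \<subseteq> B v" if "v < n" for v
    using run_endsD(3)[of x v "l v" "h v"] assms that entry[of i] entry[of j]
    by (auto simp: pinned_def tight_def)
  then show ?thesis by (auto simp: box_def direct_product_def)
qed

lemma box_oracle:
  assumes "tight x l h"
  shows "case orc (box l h i j) of None \<Rightarrow> J \<inter> box l h i j = {}
    | Some y \<Rightarrow> is_maximizer {..<n} c (J \<inter> box l h i j) y"
proof -
  have "\<forall>v\<in>{..<n}. pinned l i j v \<le> pinned h i j v \<and> even (pinned h i j v - pinned l i j v)"
    using run_endsD(1,2)[of x _ "l _" "h _"] assms by (auto simp: pinned_def tight_def)
  then show ?thesis
    using orc unfolding optimization_oracle_def box_def by (auto simp: Let_def)
qed

text \<open>Choosing the entries that carry the values of \<open>z\<close> at its at most two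
  exceptional coordinates puts \<open>z\<close> into a queried box, so \<open>g\<close> dominates
  every competitor considered in \<open>local_to_global\<close>.\<close>

lemma gap_bound:
  assumes x: "x \<in> F" and y: "y \<in> F" and t: "tight x l h" and ge: "val x \<le> g"
    and best: "\<And>i j z. i < L \<Longrightarrow> j < L \<Longrightarrow> z \<in> J \<inter> box l h i j \<Longrightarrow> val z \<le> g"
  shows "val y - val x \<le> (g - val x) * int L"
\<comment> \<open>Even a \<open>z\<close> without exceptional coordinates needs some entry to pin,
  so a coordinate must exist.\<close>
proof (cases "n = 0")
  case True
  then show ?thesis unfolding val_def L_def by simp
next
  case n0: False
  have "(\<Sum>u\<in>{..<n}. c u * y u) - (\<Sum>u\<in>{..<n}. c u * x u) \<le> (g - val x) * (\<Sum>u\<in>{..<n}. int (card (B u)))"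
  proof (rule local_to_global[OF _ J _ x y])
    fix z assume z: "z \<in> F" and cd: "card {u \<in> {..<n}. \<not> in_run (B u) (x u) (z u)} \<le> 2"
    let ?X = "{u \<in> {..<n}. \<not> in_run (B u) (x u) (z u)}"
    have zB: "u < n \<Longrightarrow> z u \<in> B u" for u using z by (auto simp: direct_product_def)
    obtain u1 u2 where u: "u1 < n" "u2 < n" "?X \<subseteq> {u1, u2}"
    proof -
      consider "card ?X = 0" | "card ?X = 1" | "card ?X = 2" using cd by linarith
      then show ?thesis
      proof cases
        case 1
        have "finite ?X" by simp
        with 1 have "?X = {}" by (simp only: card_0_eq)
        then show ?thesis using that[of 0 0] n0 by (metis empty_subsetI gr0I)
      next
        case 2
        then obtain a where a: "?X = {a}" by (auto simp: card_1_singleton_iff)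
        then have "a < n" by blast
        then show ?thesis using that[of a a] a by simp
      next
        case 3
        then obtain a b where a: "?X = {a, b}" by (auto simp: card_2_iff)
        then have "a < n" "b < n" by blast+
        then show ?thesis using that[of a b] a by simp
      qed
    qed
    obtain i where i: "i < L" "own i = u1" "elt i = z u1" using entry_ex[OF u(1) zB[OF u(1)]] by blast
    obtain j where j: "j < L" "own j = u2" "elt j = z u2" using entry_ex[OF u(2) zB[OF u(2)]] by blast
    have "z v \<in> parity_interval (pinned l i j v) (pinned h i j v)" if "v < n" for v
    proof (cases "v = u1 \<or> v = u2")
      case True
      then show ?thesis using i j by (auto simp: pinned_def)
    next
      case False
      then have "in_run (B v) (x v) (z v)" using u(3) that by auto
      then show ?thesis using run_endsD(4)[of x v "l v" "h v"] t that False i j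
        by (auto simp: pinned_def tight_def)
    qed
    then have "z \<in> J \<inter> box l h i j" using z by (auto simp: box_def direct_product_def)
    then have "val z \<le> g" by (rule best[OF i(1) j(1)])
    then show "(\<Sum>u\<in>{..<n}. c u * z u) \<le> (\<Sum>u\<in>{..<n}. c u * x u) + (g - val x)"
      by (simp add: val_def)
  qed (use B ge in auto)
  then show ?thesis by (simp add: val_def L_def)
qed

end

text \<open>One number \<open>Z\<close> bounds bit lengths, loop lengths and the number of rounds at
  once. The range in \<open>short\<close> covers counters, elements, weights and partial scalar
  products; in \<open>iters\<close>, \<open>2 * absc * absB\<close> bounds the initial gap to the
  optimum.\<close>

locale jsi_cost = jsi +
  fixes Z :: nat
  assumes Z3: "3 \<le> Z" and nZ: "n \<le> Z" and LZ: "L \<le> Z"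
    and short: "\<And>k. \<bar>k\<bar> \<le> int n + int L + 2 + absB + absc + absc * absB \<Longrightarrow> int_len k \<le> Z"
    and iters: "nat \<lceil>1 + real L * ln (real_of_int (2 * absc * absB) + 1)\<rceil> + 1 \<le> Z"
begin

lemma nonneg: "0 \<le> absB" "0 \<le> absc" "0 \<le> absc * absB"
  by (simp_all add: absB_def absc_def sum_nonneg)

lemma short_B: "v < n \<Longrightarrow> b \<in> B v \<Longrightarrow> int_len b \<le> Z"
  using abs_le_absB[of v b] nonneg by (intro short) linarith

lemma short_elt: "i < L \<Longrightarrow> int_len (elt i) \<le> Z"
  using entry short_B by blast

lemma short_nat: "k \<le> n \<or> k \<le> L \<Longrightarrow> int_len (int k) \<le> Z"
  using nonneg by (intro short, elim disjE) linarith+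

lemma short_partial: "k \<le> n \<Longrightarrow> \<forall>v<n. \<bar>y v\<bar> \<le> absB \<Longrightarrow> int_len (\<Sum>v<k. c v * y v) \<le> Z"
proof (rule short)
  assume "k \<le> n" "\<forall>v<n. \<bar>y v\<bar> \<le> absB"
  from partial_le[OF this] show "\<bar>\<Sum>v<k. c v * y v\<bar> \<le> int n + int L + 2 + absB + absc + absc * absB"
    using nonneg by linarith
qed

lemma short_01: "int_len 0 \<le> Z" "int_len 1 \<le> Z"
  using Z3 by auto

section \<open>Correctness and cost of the program pieces\<close>

abbreviation "WP \<equiv> wp n orc Z"

abbreviation "fixed_arrays \<equiv> {''n'', ''L'', ''c'', ''B'', ''own''}"

text \<open>The bound on all cells together with the part of the memory that stays fixed once the
  owners are computed, so that a loop invariant has to describe only its own arrays.\<close>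

definition static :: "state \<Rightarrow> bool" where
  "static s \<longleftrightarrow> short_cells Z s \<and> s ''n'' 0 = int n \<and> s ''L'' 0 = int L \<and>
     (\<forall>v<n. s ''c'' (int v) = c v) \<and>
     (\<forall>i<L. s ''B'' (int i) = elt i \<and> s ''own'' (int i) = int (own i))"

lemma static_short: "static s \<Longrightarrow> short_cells Z s"
  by (simp add: static_def)

lemma static_store: "static s \<Longrightarrow> a \<notin> fixed_arrays \<Longrightarrow> int_len k \<le> Z \<Longrightarrow> static (store a i k s)"
  unfolding static_def by (auto simp: short_cells_store store_apply)

lemma wp_copy_vec:
  assumes s: "static s" and ab: "a \<noteq> b" "a \<noteq> ''v''" "b \<noteq> ''v''" "b \<notin> fixed_arrays"
    and Q: "\<And>s'. static s' \<Longrightarrow> keeps {''v'', b} s s' \<Longrightarrow> (\<And>v. v < n \<Longrightarrow> s' b (int v) = s a (int v)) \<Longrightarrow> Q s'"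
  shows "WP (copy_vec a b) Q s"
  unfolding copy_vec_def
proof (rule wp_For[where m = n and I = "\<lambda>k s'. static s' \<and> keeps {''v'', b} s s' \<and> s' ''v'' 0 = int k \<and>
    (\<forall>v<k. s' b (int v) = s a (int v))"], goal_cases)
  case 5
  then show ?case using s by (auto intro!: static_store keeps_store keeps_refl short_01 simp: store_apply)
next
  case (6 k s')
  then show ?case by (auto simp: static_def)
next
  case (7 k s')
  then have I: "static s'" "keeps {''v'', b} s s'" "s' ''v'' 0 = int k" "\<And>v. v < k \<Longrightarrow> s' b (int v) = s a (int v)"
    by auto
  have sa: "s' a = s a" using I(2) ab by (auto simp: keeps_def)
  have il: "int_len (s a (int k)) \<le> Z" using s by (simp add: static_def short_cells_def)
  have kn: "int_len (int (Suc k)) \<le> Z" using 7 by (intro short_nat) simp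
  show ?case
    by (rule wp_Assign)
      (use I ab sa il kn in \<open>auto intro!: static_store keeps_store static_short simp: store_apply less_Suc_eq simp del: of_nat_Suc\<close>)
next
  case (8 s')
  then show ?case by (intro Q) auto
qed (use s static_short short_nat nZ in auto)

lemma wp_dot_product:
  assumes s: "static s" and ab: "a \<noteq> r" "a \<noteq> ''v''" "r \<noteq> ''v''" "r \<notin> fixed_arrays"
    and y: "\<And>v. v < n \<Longrightarrow> s a (int v) = y v" "\<forall>v<n. \<bar>y v\<bar> \<le> absB"
    and Q: "\<And>s'. static s' \<Longrightarrow> keeps {''v'', r} s s' \<Longrightarrow> s' r 0 = val y \<Longrightarrow> Q s'"
  shows "WP (dot_product a r) Q s"
  unfolding dot_product_def
proof (intro wp_Seq wp_Assign)
  let ?s = "store r (aval (Const 0) s) (aval (Const 0) s) s"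
  have st: "static ?s" using s ab by (auto intro!: static_store short_01)
  show "WP (For ''v'' (scalar ''n'')
     (set_scalar r (Plus (scalar r) (Times (Cell ''c'' (scalar ''v'')) (Cell a (scalar ''v'')))))) Q ?s"
  proof (rule wp_For[where m = n and I = "\<lambda>k s'. static s' \<and> keeps {''v'', r} s s' \<and> s' ''v'' 0 = int k \<and>
      s' r 0 = (\<Sum>v<k. c v * y v)"], goal_cases)
    case 5
    then show ?case using st ab
      by (auto intro!: static_store keeps_store keeps_refl short_01 simp: store_apply[of "''v''"], simp add: store_apply)
  next
    case (6 k s')
    then show ?case by (auto simp: static_def)
  next
    case (7 k s')
    then have I: "static s'" "keeps {''v'', r} s s'" "s' ''v'' 0 = int k" "s' r 0 = (\<Sum>v<k. c v * y v)"
      by auto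
    have sa: "s' a = s a" using I(2) ab by (auto simp: keeps_def)
    have ck: "s' ''c'' (int k) = c k" using I(1) 7 by (simp add: static_def)
    have il: "int_len (\<Sum>v<Suc k. c v * y v) \<le> Z" using 7 y by (intro short_partial) auto
    have kn: "int_len (int (Suc k)) \<le> Z" using 7 by (intro short_nat) simp
    show ?case
    proof (rule wp_Assign)
      let ?s2 = "store r (aval (Const 0) s')
        (aval (Plus (scalar r) (Times (Cell ''c'' (scalar ''v'')) (Cell a (scalar ''v'')))) s') s'"
      let ?s3 = "store ''v'' 0 (int (Suc k)) ?s2"
      have "aval (Plus (scalar r) (Times (Cell ''c'' (scalar ''v'')) (Cell a (scalar ''v'')))) s' =
          (\<Sum>v<Suc k. c v * y v)"
        using I sa ck y(1) 7 by simp
      then show "short_cells Z ?s2 \<and> ?s2 ''v'' 0 = int k \<and> static ?s3 \<and> keeps {''v'', r} s ?s3 \<and>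
          ?s3 ''v'' 0 = int (Suc k) \<and> ?s3 r 0 = (\<Sum>v<Suc k. c v * y v)"
        using I ab il kn
        by (auto intro!: static_store keeps_store static_short simp: store_apply simp del: of_nat_Suc sum.lessThan_Suc aval.simps(3))
    qed (use I in \<open>auto intro: static_short\<close>)
  next
    case (8 s')
    then show ?case by (intro Q) (auto simp: val_def)
  qed (use st static_short short_nat nZ in auto)
qed (use s static_short in auto)

lemma wp_extend_runs:
  assumes s: "static s" and a: "a \<noteq> ''i''" "a \<notin> fixed_arrays"
    and \<delta>: "\<delta> = 2 * \<tau>" and sc: "scan \<tau> \<pi>" and e: "small_aexp e"
    and ev: "\<And>k s'. k < L \<Longrightarrow> static s' \<Longrightarrow> s' ''i'' 0 = int k \<Longrightarrow> aval e s' = int (\<pi> k)"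
    and x: "\<And>v. v < n \<Longrightarrow> s a (int v) = x v" "\<And>v. v < n \<Longrightarrow> x v \<in> B v"
    and Q: "\<And>s'. static s' \<Longrightarrow> keeps {''i'', a} s s' \<Longrightarrow> (\<And>v. v < n \<Longrightarrow> run_end x \<tau> v (s' a (int v))) \<Longrightarrow> Q s'"
  shows "WP (extend_runs a \<delta> e) Q s"
  unfolding extend_runs_def
proof (rule wp_For[where m = L and I = "\<lambda>k s'. static s' \<and> keeps {''i'', a} s s' \<and> s' ''i'' 0 = int k \<and>
    (\<forall>u<n. run_part x \<tau> \<pi> k u (s' a (int u)))"], goal_cases)
  case 5
  have "run_part x \<tau> \<pi> 0 u (x u)" if "u < n" for u
  proof -
    have "\<tau> = 1 \<or> \<tau> = -1" using sc by (simp add: scan_def)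
    then show ?thesis using x(2)[OF that] by (auto simp: run_part_def)
  qed
  then show ?case using s a x by (auto intro!: static_store keeps_store keeps_refl short_01 simp: store_apply)
next
  case (6 k s')
  then show ?case by (auto simp: static_def)
next
  case (7 k s')
  then have I: "static s'" "keeps {''i'', a} s s'" "s' ''i'' 0 = int k"
    "\<And>u. u < n \<Longrightarrow> run_part x \<tau> \<pi> k u (s' a (int u))"
    by auto
  have pk: "\<pi> k < L" using sc 7 by (auto simp: scan_def bij_betw_def)
  have e': "aval e s' = int (\<pi> k)" using ev I 7 by blast
  have vals: "s' ''own'' (int (\<pi> k)) = int (own (\<pi> k))" "s' ''B'' (int (\<pi> k)) = elt (\<pi> k)"
    using I(1) pk by (auto simp: static_def)
  have kn: "int_len (int (Suc k)) \<le> Z" using 7 by (intro short_nat) simp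
  have on: "own (\<pi> k) < n" using entry pk by blast
  note st = run_part_step[OF sc 7(1) I(4)]
  show ?case
  proof (rule wp_Cond)
    assume b: "bval (Equal (Plus (Cell a (Cell ''own'' e)) (Const \<delta>)) (Cell ''B'' e)) s'"
    then have eq: "s' a (int (own (\<pi> k))) + 2 * \<tau> = elt (\<pi> k)"
      using e' vals \<delta> by (simp add: Equal_def)
    have "run_part x \<tau> \<pi> (Suc k) u (if u = own (\<pi> k) then elt (\<pi> k) else s' a (int u))" if "u < n" for u
      using st[OF that] eq by (cases "u = own (\<pi> k)") auto
    then show "WP (Assign a (Cell ''own'' e) (Cell ''B'' e)) (\<lambda>s'. short_cells Z s' \<and> s' ''i'' 0 = int k \<and>
        static (store ''i'' 0 (int (Suc k)) s') \<and> keeps {''i'', a} s (store ''i'' 0 (int (Suc k)) s') \<and>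
        store ''i'' 0 (int (Suc k)) s' ''i'' 0 = int (Suc k) \<and>
        (\<forall>u<n. run_part x \<tau> \<pi> (Suc k) u (store ''i'' 0 (int (Suc k)) s' a (int u)))) s'"
      using I a kn short_elt[OF pk] vals e' e
      by (intro wp_Assign)
        (auto intro!: static_store keeps_store static_short simp: store_apply split: if_splits simp del: of_nat_Suc)
  next
    assume b: "\<not> bval (Equal (Plus (Cell a (Cell ''own'' e)) (Const \<delta>)) (Cell ''B'' e)) s'"
    then have eq: "s' a (int (own (\<pi> k))) + 2 * \<tau> \<noteq> elt (\<pi> k)"
      using e' vals \<delta> by (auto simp: Equal_def)
    have "run_part x \<tau> \<pi> (Suc k) u (s' a (int u))" if "u < n" for u
      using st[OF that] eq by (auto split: if_splits)
    then show "WP Skip (\<lambda>s'. short_cells Z s' \<and> s' ''i'' 0 = int k \<and>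
        static (store ''i'' 0 (int (Suc k)) s') \<and> keeps {''i'', a} s (store ''i'' 0 (int (Suc k)) s') \<and>
        store ''i'' 0 (int (Suc k)) s' ''i'' 0 = int (Suc k) \<and>
        (\<forall>u<n. run_part x \<tau> \<pi> (Suc k) u (store ''i'' 0 (int (Suc k)) s' a (int u)))) s'"
      using I a kn
      by (intro wp_Skip)
        (auto intro!: static_store keeps_store static_short simp: store_apply simp del: of_nat_Suc)
  next
    show "small_bexp (Equal (Plus (Cell a (Cell ''own'' e)) (Const \<delta>)) (Cell ''B'' e))"
      using e \<delta> sc by (auto simp: Equal_def scan_def)
  qed (use I in \<open>auto intro: static_short\<close>)
next
  case (8 s')
  then show ?case using run_part_end[OF sc] by (intro Q) auto
qed (use s static_short short_nat LZ in auto)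

end

lemma read_vec_store: "a \<noteq> b \<Longrightarrow> read_vec n (store a i k s) b = read_vec n s b"
  by (auto simp: read_vec_def store_def)

lemma read_vec_keeps: "keeps A s s' \<Longrightarrow> b \<notin> A \<Longrightarrow> read_vec n s' b = read_vec n s b"
  by (auto simp: read_vec_def keeps_def)

context jsi_cost
begin

lemma wp_fix_coordinate:
  assumes s: "static s" and a: "a \<noteq> ''ql''" "a \<noteq> ''qh''" "s a 0 = int m" "m < L"
    and Q: "\<And>s'. static s' \<Longrightarrow> keeps {''ql'', ''qh''} s s' \<Longrightarrow>
      (\<And>v. v < n \<Longrightarrow> s' ''ql'' (int v) = (if v = own m then elt m else s ''ql'' (int v))) \<Longrightarrow>
      (\<And>v. v < n \<Longrightarrow> s' ''qh'' (int v) = (if v = own m then elt m else s ''qh'' (int v))) \<Longrightarrow> Q s'"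
  shows "WP (fix_coordinate a) Q s"
proof -
  have o: "s ''own'' (int m) = int (own m)" "s ''B'' (int m) = elt m"
    using s a(4) by (auto simp: static_def)
  define s1 where "s1 = store ''ql'' (int (own m)) (elt m) s"
  define s2 where "s2 = store ''qh'' (int (own m)) (elt m) s1"
  have st: "static s1" "static s2"
    using s short_elt[OF a(4)] by (auto simp: s1_def s2_def intro!: static_store)
  have av: "aval (Cell ''own'' (scalar a)) s = int (own m)" "aval (Cell ''B'' (scalar a)) s = elt m"
    "aval (Cell ''own'' (scalar a)) s1 = int (own m)" "aval (Cell ''B'' (scalar a)) s1 = elt m"
    using o a by (auto simp: s1_def store_apply)
  have "Q s2"
    by (rule Q) (use st in \<open>auto simp: s1_def s2_def store_apply intro!: keeps_store keeps_refl\<close>)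
  then have q2: "Q (store ''qh'' (aval (Cell ''own'' (scalar a)) s1) (aval (Cell ''B'' (scalar a)) s1) s1)"
    unfolding av s2_def .
  have "WP (Assign ''qh'' (Cell ''own'' (scalar a)) (Cell ''B'' (scalar a))) Q s1"
    by (rule wp_Assign[where Q = Q, OF static_short[OF st(1)] _ _ q2]) simp_all
  then have q1: "WP (Assign ''qh'' (Cell ''own'' (scalar a)) (Cell ''B'' (scalar a))) Q
      (store ''ql'' (aval (Cell ''own'' (scalar a)) s) (aval (Cell ''B'' (scalar a)) s) s)"
    unfolding av s1_def .
  show ?thesis
    unfolding fix_coordinate_def
  proof (rule wp_Seq, rule wp_Assign)
    show "WP (Assign ''qh'' (Cell ''own'' (scalar a)) (Cell ''B'' (scalar a))) Q
      (store ''ql'' (aval (Cell ''own'' (scalar a)) s) (aval (Cell ''B'' (scalar a)) s) s)" by (fact q1)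
  qed (use static_short[OF s] in simp_all)
qed

lemma static_store_vec:
  assumes "static s" "a \<notin> fixed_arrays" "\<And>v. v < n \<Longrightarrow> int_len (y v) \<le> Z"
  shows "static (store_vec n a y s)"
proof -
  have "short_cells Z (store_vec n a y s)"
    using assms static_short[OF assms(1)] by (auto simp: short_cells_def store_vec_def)
  then show ?thesis using assms unfolding static_def by (auto simp: store_vec_def)
qed

abbreviation "scratch \<equiv> {''v'', ''ql'', ''qh'', ''ans'', ''fl'', ''av'', ''bv'', ''go'', ''x''}"

text \<open>The answer is compared with the best value so far, not with the value at the start of
  the round. It is feasible by \<open>box_sub\<close>, which also bounds its bit length and thus the
  cost of the query.\<close>

lemma wp_try_pair:
  assumes s: "static s" and ij: "s ''i'' 0 = int i" "i < L" "s ''j'' 0 = int j" "j < L"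
    and lo: "\<And>v. v < n \<Longrightarrow> s ''lo'' (int v) = l v" and hi: "\<And>v. v < n \<Longrightarrow> s ''hi'' (int v) = h v"
    and ti: "tight x l h"
    and cur: "read_vec n s ''x'' \<in> F" "s ''bv'' 0 = val (read_vec n s ''x'')"
    and Q: "\<And>s'. static s' \<Longrightarrow> keeps scratch s s' \<Longrightarrow> read_vec n s' ''x'' \<in> F \<Longrightarrow>
      s' ''bv'' 0 = val (read_vec n s' ''x'') \<Longrightarrow> val (read_vec n s ''x'') \<le> val (read_vec n s' ''x'') \<Longrightarrow>
      s' ''go'' 0 = (if val (read_vec n s ''x'') < val (read_vec n s' ''x'') then 1 else s ''go'' 0) \<Longrightarrow>
      (\<And>z. z \<in> J \<inter> box l h i j \<Longrightarrow> val z \<le> val (read_vec n s' ''x'')) \<Longrightarrow> Q s'"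
  shows "WP try_pair Q s"
  unfolding try_pair_def
proof (rule wp_Seq, rule wp_copy_vec[OF s])
  fix s1 assume s1: "static s1" "keeps {''v'', ''ql''} s s1"
    and q1: "\<And>v. v < n \<Longrightarrow> s1 ''ql'' (int v) = s ''lo'' (int v)"
  show "WP (Seq (copy_vec ''hi'' ''qh'')
     (Seq (fix_coordinate ''i'') (Seq (fix_coordinate ''j'')
     query_box))) Q s1"
  proof (rule wp_Seq, rule wp_copy_vec[OF s1(1)])
    fix s2 assume s2: "static s2" "keeps {''v'', ''qh''} s1 s2"
      and q2: "\<And>v. v < n \<Longrightarrow> s2 ''qh'' (int v) = s1 ''hi'' (int v)"
    have k2: "keeps {''v'', ''ql'', ''qh''} s s2" by (rule keeps_trans[OF s1(2) s2(2)]) auto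
    have e2: "s2 ''i'' 0 = int i" "s2 ''ql'' = s1 ''ql''" "s1 ''hi'' = s ''hi''"
      using k2 s2(2) s1(2) ij by (auto simp: keeps_def)
    show "WP (Seq (fix_coordinate ''i'') (Seq (fix_coordinate ''j'')
     query_box)) Q s2"
    proof (rule wp_Seq, rule wp_fix_coordinate[OF s2(1) _ _ e2(1) ij(2)])
      fix s3 assume s3: "static s3" "keeps {''ql'', ''qh''} s2 s3"
        and q3: "\<And>v. v < n \<Longrightarrow> s3 ''ql'' (int v) = (if v = own i then elt i else s2 ''ql'' (int v))"
          "\<And>v. v < n \<Longrightarrow> s3 ''qh'' (int v) = (if v = own i then elt i else s2 ''qh'' (int v))"
      have k3: "keeps {''v'', ''ql'', ''qh''} s s3" by (rule keeps_trans[OF k2 s3(2)]) auto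
      have e3: "s3 ''j'' 0 = int j" using k3 ij by (auto simp: keeps_def)
      show "WP (Seq (fix_coordinate ''j'')
         query_box) Q s3"
      proof (rule wp_Seq, rule wp_fix_coordinate[OF s3(1) _ _ e3 ij(4)])
        fix s4 assume s4: "static s4" "keeps {''ql'', ''qh''} s3 s4"
          and q4: "\<And>v. v < n \<Longrightarrow> s4 ''ql'' (int v) = (if v = own j then elt j else s3 ''ql'' (int v))"
            "\<And>v. v < n \<Longrightarrow> s4 ''qh'' (int v) = (if v = own j then elt j else s3 ''qh'' (int v))"
        have k4: "keeps {''v'', ''ql'', ''qh''} s s4" by (rule keeps_trans[OF k3 s4(2)]) auto
        have "s4 ''ql'' (int v) = pinned l i j v" "s4 ''qh'' (int v) = pinned h i j v" if "v < n" for v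
          using that q4 q3 q2 q1 e2 lo hi by (auto simp: pinned_def)
        then have qs: "query_set n s4 ''ql'' ''qh'' = box l h i j"
          by (auto simp: query_set_def box_def direct_product_def read_vec_def)
        note bo = box_oracle[OF ti, of i j]
        have rx4: "read_vec n s4 ''x'' = read_vec n s ''x''" using k4 by (simp add: read_vec_keeps)
        have sc4: "s4 ''bv'' = s ''bv''" "s4 ''go'' = s ''go''" using k4 by (auto simp: keeps_def)
        show "WP query_box Q s4"
          unfolding query_box_def
        proof (rule wp_Seq, rule wp_Query[OF static_short[OF s4(1)] nZ]; unfold qs)
          assume None: "orc (box l h i j) = None"
          let ?s5 = "store ''fl'' 0 0 s4"
          have s5: "static ?s5" using s4(1) by (auto intro!: static_store short_01)
          have k5: "keeps scratch s ?s5"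
            by (rule keeps_store[OF keeps_trans[OF k4 keeps_refl[of "{}"]]]) auto
          have r5: "read_vec n ?s5 ''x'' = read_vec n s ''x''" using rx4 by (simp add: read_vec_store)
          have "Q ?s5"
            by (rule Q[OF s5 k5]; unfold r5)
              (use cur bo None sc4 in \<open>auto simp: store_apply\<close>)
          then show "WP (Cond (Less (Const 0) (scalar ''fl'')) evaluate_answer Skip) Q ?s5"
            using s5 static_short by (intro wp_Cond wp_Skip) (auto simp: store_apply)
        next
          fix y assume Some: "orc (box l h i j) = Some y"
          have y: "y \<in> J \<inter> box l h i j" and mx: "\<And>z. z \<in> J \<inter> box l h i j \<Longrightarrow> val z \<le> val y"
            using bo Some by (auto simp: is_maximizer_def val_def)
          have yF: "y \<in> F" using y box_sub[OF ti ij(2,4)] by blast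
          then have yV: "y \<in> int_vecs {..<n}" "\<And>v. v < n \<Longrightarrow> y v \<in> B v"
            by (auto simp: direct_product_def)
          let ?s5 = "store ''fl'' 0 1 (store_vec n ''ans'' y s4)"
          have s5: "static ?s5"
            using s4(1) yV(2) short_B by (auto intro!: static_store static_store_vec short_01)
          have k5: "keeps scratch s ?s5"
            using k4 by (auto simp: keeps_def store_apply store_vec_def)
          have a5: "?s5 ''ans'' (int v) = y v" if "v < n" for v
            using that by (simp add: store_apply store_vec_def)
          have e5: "?s5 ''bv'' 0 = val (read_vec n s ''x'')" "?s5 ''go'' 0 = s ''go'' 0"
            using cur(2) sc4 by (auto simp: store_apply store_vec_def)
          have "keeps {''fl'', ''ans''} s4 ?s5" by (auto simp: keeps_def store_apply store_vec_def)
          then have r5: "read_vec n ?s5 ''x'' = read_vec n s ''x''" using rx4 by (simp add: read_vec_keeps)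
          show "(\<forall>v<n. int_len (y v) \<le> Z) \<and> WP (Cond (Less (Const 0) (scalar ''fl'')) evaluate_answer Skip) Q ?s5"
            unfolding evaluate_answer_def
          proof (intro conjI wp_Cond wp_Seq)
            show "\<forall>v<n. int_len (y v) \<le> Z" using yV(2) short_B by blast
            show "WP (dot_product ''ans'' ''av'') (WP (Cond (Less (scalar ''bv'') (scalar ''av'')) adopt_answer Skip) Q) ?s5"
            proof (rule wp_dot_product[OF s5, where y = y])
              fix s6 assume s6: "static s6" "keeps {''v'', ''av''} ?s5 s6" "s6 ''av'' 0 = val y"
              have k6: "keeps scratch s s6" by (rule keeps_trans[OF k5 s6(2)]) auto
              have e6: "s6 ''bv'' 0 = val (read_vec n s ''x'')" "s6 ''go'' 0 = s ''go'' 0"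
                "read_vec n s6 ''x'' = read_vec n s ''x''"
                using e5 r5 keepsD[OF s6(2)] read_vec_keeps[OF s6(2)] by auto
              have a6: "s6 ''ans'' (int v) = y v" if "v < n" for v
                using a5[OF that] keepsD[OF s6(2), of "''ans''"] by simp
              show "WP (Cond (Less (scalar ''bv'') (scalar ''av'')) adopt_answer Skip) Q s6"
              proof (rule wp_Cond[OF static_short[OF s6(1)]])
                assume "\<not> bval (Less (scalar ''bv'') (scalar ''av'')) s6"
                then have le: "val y \<le> val (read_vec n s ''x'')" using e6 s6(3) by simp
                have "Q s6"
                  by (rule Q[OF s6(1) k6]; unfold e6) (use cur le mx in \<open>auto intro: order_trans\<close>)
                then show "WP Skip Q s6" by (rule wp_Skip)
              next
                assume "bval (Less (scalar ''bv'') (scalar ''av'')) s6"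
                then have lt: "val (read_vec n s ''x'') < val y" using e6 s6(3) by simp
                define s7 where "s7 = store ''bv'' 0 (val y) s6"
                define s8 where "s8 = store ''go'' 0 1 s7"
                have vl: "int_len (val y) \<le> Z"
                  unfolding val_def by (rule short_partial) (use F_bound[OF yF] in auto)
                have st: "static s7" "static s8"
                  using s6(1) vl by (auto simp: s7_def s8_def intro!: static_store short_01)
                have k8: "keeps scratch s s8"
                  using k6 by (auto simp: s7_def s8_def intro!: keeps_store)
                have a8: "s8 ''ans'' (int v) = y v" if "v < n" for v
                  using a6[OF that] by (simp add: s7_def s8_def store_apply)
                have w8: "WP (copy_vec ''ans'' ''x'') Q s8"
                proof (rule wp_copy_vec[OF st(2)])
                  fix s9 assume s9: "static s9" "keeps {''v'', ''x''} s8 s9"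
                    "\<And>v. v < n \<Longrightarrow> s9 ''x'' (int v) = s8 ''ans'' (int v)"
                  have r9: "read_vec n s9 ''x'' = y"
                    using s9(3) a8 yV(1) by (auto simp: read_vec_def int_vecs_def fun_eq_iff)
                  have k9: "keeps scratch s s9" by (rule keeps_trans[OF k8 s9(2)]) auto
                  have e9: "s9 ''bv'' 0 = val y" "s9 ''go'' 0 = 1"
                    using keepsD[OF s9(2)] by (auto simp: s7_def s8_def store_apply)
                  show "Q s9"
                    by (rule Q[OF s9(1) k9]; unfold r9) (use yF e9 lt mx in auto)
                qed auto
                have av6: "aval (scalar ''av'') s6 = val y" using s6(3) by simp
                show "WP adopt_answer Q s6"
                  unfolding adopt_answer_def
                proof (intro wp_Seq wp_Assign)
                  show "WP (copy_vec ''ans'' ''x'') Q (store ''go''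
                      (aval (Const 0) (store ''bv'' (aval (Const 0) s6) (aval (scalar ''av'') s6) s6))
                      (aval (Const 1) (store ''bv'' (aval (Const 0) s6) (aval (scalar ''av'') s6) s6))
                      (store ''bv'' (aval (Const 0) s6) (aval (scalar ''av'') s6) s6))"
                    using w8 s6(3) by (simp add: s8_def s7_def)
                  show "short_cells Z (store ''bv'' (aval (Const 0) s6) (aval (scalar ''av'') s6) s6)"
                    using static_short[OF st(1)] s6(3) by (simp add: s7_def)
                qed (use static_short[OF s6(1)] in auto)
              qed auto
            qed (use a5 F_bound[OF yF] in auto)
          qed (use static_short[OF s5] in \<open>auto simp: store_apply\<close>)
        qed
      qed auto
    qed auto
  qed auto
qed auto

end

context jsi_cost
begin

abbreviation "changed \<equiv> {''i'', ''j''} \<union> scratch"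

definition progress :: "(nat \<Rightarrow> int) \<Rightarrow> state \<Rightarrow> bool" where
  "progress x s \<longleftrightarrow> read_vec n s ''x'' \<in> F \<and> s ''bv'' 0 = val (read_vec n s ''x'') \<and>
     val x \<le> val (read_vec n s ''x'') \<and>
     s ''go'' 0 = (if val x < val (read_vec n s ''x'') then 1 else 0)"

lemma progress_store: "a \<notin> {''x'', ''bv'', ''go''} \<Longrightarrow> progress x (store a i k s) \<longleftrightarrow> progress x s"
  by (auto simp: progress_def read_vec_store store_apply)

text \<open>Values only increase during a round, so boxes handled earlier remain dominated by the
  current point.\<close>

lemma wp_all_pairs:
  assumes s: "static s" and ti: "tight x l h" and p: "progress x s"
    and lh: "\<And>v. v < n \<Longrightarrow> s ''lo'' (int v) = l v" "\<And>v. v < n \<Longrightarrow> s ''hi'' (int v) = h v"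
    and Q: "\<And>s'. static s' \<Longrightarrow> progress x s' \<Longrightarrow>
      (\<And>i j z. i < L \<Longrightarrow> j < L \<Longrightarrow> z \<in> J \<inter> box l h i j \<Longrightarrow> val z \<le> val (read_vec n s' ''x'')) \<Longrightarrow> Q s'"
  shows "WP (For ''i'' (scalar ''L'') (For ''j'' (scalar ''L'') try_pair)) Q s"
proof (rule wp_For[where m = L and I = "\<lambda>i s'. static s' \<and> keeps changed s s' \<and> s' ''i'' 0 = int i \<and>
    progress x s' \<and> (\<forall>i'<i. \<forall>j<L. \<forall>z\<in>J \<inter> box l h i' j. val z \<le> val (read_vec n s' ''x''))"], goal_cases)
  case 5
  then show ?case
    using s p by (auto intro!: static_store keeps_store keeps_refl short_01 simp: store_apply progress_store)
next
  case (6 i s')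
  then show ?case by (auto simp: static_def)
next
  case (7 i s1)
  then have iL: "i < L" and s1: "static s1" "keeps changed s s1" "s1 ''i'' 0 = int i" "progress x s1"
    and done1: "\<forall>i'<i. \<forall>j<L. \<forall>z\<in>J \<inter> box l h i' j. val z \<le> val (read_vec n s1 ''x'')" by auto
  have si: "int_len (int (Suc i)) \<le> Z" using iL by (intro short_nat) simp
  show ?case
  proof (rule wp_For[where m = L and I = "\<lambda>j s'. static s' \<and> keeps changed s s' \<and> s' ''i'' 0 = int i \<and>
      s' ''j'' 0 = int j \<and> progress x s' \<and>
      (\<forall>i'<i. \<forall>j<L. \<forall>z\<in>J \<inter> box l h i' j. val z \<le> val (read_vec n s' ''x'')) \<and>
      (\<forall>j'<j. \<forall>z\<in>J \<inter> box l h i j'. val z \<le> val (read_vec n s' ''x''))"], goal_cases)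
    case 5
    then show ?case
      using s1 done1
      by (auto intro!: static_store keeps_store short_01 simp: store_apply progress_store read_vec_store)
  next
    case (6 j s')
    then show ?case by (auto simp: static_def)
  next
    case (7 j s2)
    then have jL: "j < L" and s2: "static s2" "keeps changed s s2" "s2 ''i'' 0 = int i" "s2 ''j'' 0 = int j"
      "progress x s2"
      and done2: "\<forall>i'<i. \<forall>j<L. \<forall>z\<in>J \<inter> box l h i' j. val z \<le> val (read_vec n s2 ''x'')"
        "\<forall>j'<j. \<forall>z\<in>J \<inter> box l h i j'. val z \<le> val (read_vec n s2 ''x'')" by auto
    have sj: "int_len (int (Suc j)) \<le> Z" using jL by (intro short_nat) simp
    have lo2: "s2 ''lo'' (int v) = l v" and hi2: "s2 ''hi'' (int v) = h v" if "v < n" for v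
      using lh[OF that] keepsD[OF s2(2)] by auto
    have cur: "read_vec n s2 ''x'' \<in> F" "s2 ''bv'' 0 = val (read_vec n s2 ''x'')"
      using s2(5) by (auto simp: progress_def)
    show ?case
    proof (rule wp_try_pair[OF s2(1,3) iL s2(4) jL lo2 hi2 ti cur])
      fix s3 assume s3: "static s3" "keeps scratch s2 s3" "read_vec n s3 ''x'' \<in> F"
        "s3 ''bv'' 0 = val (read_vec n s3 ''x'')" "val (read_vec n s2 ''x'') \<le> val (read_vec n s3 ''x'')"
        "s3 ''go'' 0 = (if val (read_vec n s2 ''x'') < val (read_vec n s3 ''x'') then 1 else s2 ''go'' 0)"
        "\<And>z. z \<in> J \<inter> box l h i j \<Longrightarrow> val z \<le> val (read_vec n s3 ''x'')"
      have p3: "progress x s3" using s2(5) s3(3-6) by (auto simp: progress_def)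
      have k3: "keeps changed s s3" by (rule keeps_trans[OF s2(2) s3(2)]) auto
      have ij3: "s3 ''i'' 0 = int i" "s3 ''j'' 0 = int j" using s2(3,4) keepsD[OF s3(2)] by auto
      let ?s4 = "store ''j'' 0 (int (Suc j)) s3"
      have r4: "read_vec n ?s4 ''x'' = read_vec n s3 ''x''" by (simp add: read_vec_store)
      have d4: "\<forall>i'<i. \<forall>j<L. \<forall>z\<in>J \<inter> box l h i' j. val z \<le> val (read_vec n s3 ''x'')"
        using done2(1) s3(5) order_trans by blast
      have d4': "\<forall>j'<Suc j. \<forall>z\<in>J \<inter> box l h i j'. val z \<le> val (read_vec n s3 ''x'')"
        using done2(2) s3(5) s3(7) order_trans unfolding less_Suc_eq by blast
      have "static ?s4" using s3(1) sj by (intro static_store) auto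
      moreover have "keeps changed s ?s4" using k3 by (intro keeps_store) auto
      moreover have "progress x ?s4" using p3 by (simp add: progress_store)
      ultimately show "short_cells Z s3 \<and> s3 ''j'' 0 = int j \<and> static ?s4 \<and> keeps changed s ?s4 \<and>
          ?s4 ''i'' 0 = int i \<and> ?s4 ''j'' 0 = int (Suc j) \<and> progress x ?s4 \<and>
          (\<forall>i'<i. \<forall>j<L. \<forall>z\<in>J \<inter> box l h i' j. val z \<le> val (read_vec n ?s4 ''x'')) \<and>
          (\<forall>j'<Suc j. \<forall>z\<in>J \<inter> box l h i j'. val z \<le> val (read_vec n ?s4 ''x''))"
        unfolding r4 using d4 d4' ij3 static_short[OF s3(1)] by (simp add: store_apply del: of_nat_Suc)
    qed
  next
    case (8 s2)
    let ?s3 = "store ''i'' 0 (int (Suc i)) s2"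
    have r3: "read_vec n ?s3 ''x'' = read_vec n s2 ''x''" by (simp add: read_vec_store)
    have "static ?s3" using 8 si by (intro static_store) auto
    moreover have "keeps changed s ?s3" using 8 by (intro keeps_store) auto
    moreover have "progress x ?s3" using 8 by (simp add: progress_store)
    moreover have "\<forall>i'<Suc i. \<forall>j<L. \<forall>z\<in>J \<inter> box l h i' j. val z \<le> val (read_vec n s2 ''x'')"
      using 8 unfolding less_Suc_eq by blast
    ultimately show ?case
      unfolding r3 using 8 static_short by (simp add: store_apply del: of_nat_Suc)
  qed (use s1 static_short short_nat LZ in auto)
next
  case (8 s')
  then show ?case by (intro Q) auto
qed (use s static_short short_nat LZ in auto)

text \<open>The last condition handed to \<open>Q\<close> is the progress guarantee. If the round
  brings no gain, its right-hand side vanishes and it states that \<open>x\<close> is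
  optimal.\<close>

lemma wp_improve:
  assumes s: "static s" and x: "read_vec n s ''x'' = x" "x \<in> F"
    and Q: "\<And>s' x'. static s' \<Longrightarrow> read_vec n s' ''x'' = x' \<Longrightarrow> x' \<in> F \<Longrightarrow> val x \<le> val x' \<Longrightarrow>
      s' ''go'' 0 = (if val x < val x' then 1 else 0) \<Longrightarrow>
      (\<And>y. y \<in> F \<Longrightarrow> val y - val x \<le> (val x' - val x) * int L) \<Longrightarrow> Q s'"
  shows "WP improve Q s"
proof -
  have xv: "s ''x'' (int v) = x v" if "v < n" for v
    using x(1) that by (auto simp: read_vec_def)
  have xB: "x v \<in> B v" if "v < n" for v using x(2) that by (auto simp: direct_product_def)
  have xb: "\<forall>v<n. \<bar>x v\<bar> \<le> absB" using F_bound[OF x(2)] by blast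
  show ?thesis
    unfolding improve_def
  proof (rule wp_Seq, rule wp_copy_vec[OF s])
    fix s1 assume s1: "static s1" "keeps {''v'', ''hi''} s s1"
      and h1: "\<And>v. v < n \<Longrightarrow> s1 ''hi'' (int v) = s ''x'' (int v)"
    show "WP (Seq (extend_runs ''hi'' 2 (scalar ''i''))
     (Seq (copy_vec ''x'' ''lo'')
     (Seq (extend_runs ''lo'' (- 2) (Minus (Minus (scalar ''L'') (Const 1)) (scalar ''i'')))
     (Seq (dot_product ''x'' ''bv'') (Seq (set_scalar ''go'' (Const 0))
     (For ''i'' (scalar ''L'') (For ''j'' (scalar ''L'') try_pair))))))) Q s1"
    proof (rule wp_Seq, rule wp_extend_runs[OF s1(1) _ _ _ scan_up, where x = x])
      fix s2 assume s2: "static s2" "keeps {''i'', ''hi''} s1 s2"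
        and h2: "\<And>v. v < n \<Longrightarrow> run_end x 1 v (s2 ''hi'' (int v))"
      have x2: "s2 ''x'' = s ''x''" using keepsD[OF s2(2)] keepsD[OF s1(2)] by simp
      show "WP (Seq (copy_vec ''x'' ''lo'')
         (Seq (extend_runs ''lo'' (- 2) (Minus (Minus (scalar ''L'') (Const 1)) (scalar ''i'')))
         (Seq (dot_product ''x'' ''bv'') (Seq (set_scalar ''go'' (Const 0))
         (For ''i'' (scalar ''L'') (For ''j'' (scalar ''L'') try_pair)))))) Q s2"
      proof (rule wp_Seq, rule wp_copy_vec[OF s2(1)])
        fix s3 assume s3: "static s3" "keeps {''v'', ''lo''} s2 s3"
          and l3: "\<And>v. v < n \<Longrightarrow> s3 ''lo'' (int v) = s2 ''x'' (int v)"
        show "WP (Seq (extend_runs ''lo'' (- 2) (Minus (Minus (scalar ''L'') (Const 1)) (scalar ''i'')))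
         (Seq (dot_product ''x'' ''bv'') (Seq (set_scalar ''go'' (Const 0))
         (For ''i'' (scalar ''L'') (For ''j'' (scalar ''L'') try_pair))))) Q s3"
        proof (rule wp_Seq, rule wp_extend_runs[OF s3(1) _ _ _ scan_down, where x = x])
          fix s4 assume s4: "static s4" "keeps {''i'', ''lo''} s3 s4"
            and l4: "\<And>v. v < n \<Longrightarrow> run_end x (- 1) v (s4 ''lo'' (int v))"
          have x4: "s4 ''x'' = s ''x''" "s4 ''hi'' = s2 ''hi''"
            using keepsD[OF s4(2)] keepsD[OF s3(2)] x2 by simp_all
          show "WP (Seq (dot_product ''x'' ''bv'') (Seq (set_scalar ''go'' (Const 0))
            (For ''i'' (scalar ''L'') (For ''j'' (scalar ''L'') try_pair)))) Q s4"
          proof (rule wp_Seq, rule wp_dot_product[OF s4(1), where y = x])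
            fix s5 assume s5: "static s5" "keeps {''v'', ''bv''} s4 s5" "s5 ''bv'' 0 = val x"
            define s6 where "s6 = store ''go'' 0 0 s5"
            define l where "l = (\<lambda>v. s6 ''lo'' (int v))"
            define h where "h = (\<lambda>v. s6 ''hi'' (int v))"
            have st: "static s6" unfolding s6_def using s5(1) by (auto intro!: static_store short_01)
            have e6: "s6 ''x'' = s ''x''" "s6 ''hi'' = s2 ''hi''" "s6 ''lo'' = s4 ''lo''"
              using keepsD[OF s5(2)] x4 by (simp_all add: s6_def store_apply)
            have r6: "read_vec n s6 ''x'' = x" using x(1) unfolding read_vec_def e6(1) .
            have p6: "progress x s6"
              using s5(3) x(2) unfolding progress_def r6 by (simp add: s6_def store_apply)
            have t6: "tight x l h"
              using h2 l4 e6 by (simp add: tight_def l_def h_def)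
            have "WP (For ''i'' (scalar ''L'') (For ''j'' (scalar ''L'') try_pair)) Q s6"
            proof (rule wp_all_pairs[OF st t6 p6])
              fix s7 assume s7: "static s7" "progress x s7"
                "\<And>i j z. i < L \<Longrightarrow> j < L \<Longrightarrow> z \<in> J \<inter> box l h i j \<Longrightarrow> val z \<le> val (read_vec n s7 ''x'')"
              have pr: "read_vec n s7 ''x'' \<in> F" "val x \<le> val (read_vec n s7 ''x'')"
                "s7 ''go'' 0 = (if val x < val (read_vec n s7 ''x'') then 1 else 0)"
                using s7(2) by (auto simp: progress_def)
              show "Q s7"
                by (rule Q[OF s7(1) refl pr]) (rule gap_bound[OF x(2) _ t6 pr(2) s7(3)])
            qed (simp_all add: l_def h_def)
            then show "WP (Seq (set_scalar ''go'' (Const 0))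
                (For ''i'' (scalar ''L'') (For ''j'' (scalar ''L'') try_pair))) Q s5"
              using static_short[OF s5(1)] by (intro wp_Seq wp_Assign) (simp_all add: s6_def)
          qed (use x4 xv xb in auto)
        next
          show "aval (Minus (Minus (scalar ''L'') (Const 1)) (scalar ''i'')) s' = int (L - 1 - k)"
            if "k < L" "static s'" "s' ''i'' 0 = int k" for k s'
            using that by (auto simp: static_def of_nat_diff)
        qed (use l3 x2 xv xB in auto)
      qed auto
    qed (use h1 xv xB in auto)
  qed auto
qed

lemma wp_set_owners:
  assumes s: "short_cells Z s" and init: "s ''n'' 0 = int n" "\<And>v. v < n \<Longrightarrow> s ''c'' (int v) = c v"
    "\<And>v. v < n \<Longrightarrow> s ''len'' (int v) = int (card (B v))" "\<And>i. i < L \<Longrightarrow> s ''B'' (int i) = elt i" "s ''L'' 0 = 0"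
    and Q: "\<And>s'. static s' \<Longrightarrow> keeps {''v'', ''k'', ''own'', ''L''} s s' \<Longrightarrow> Q s'"
  shows "WP set_owners Q s"
proof -
  \<comment> \<open>The position of the first entry of coordinate \<open>v\<close> in the
    concatenated list, which is the value of the counter \<open>L\<close> when the outer loop
    reaches \<open>v\<close>.\<close>
  define off where "off v = (\<Sum>u<v. card (B u))" for v
  have offS: "off (Suc v) = off v + card (B v)" for v by (simp add: off_def)
  have offL: "off v \<le> L" if "v \<le> n" for v
    unfolding off_def L_def using that by (intro sum_mono2) auto
  have cdL: "card (B v) \<le> L" if "v < n" for v using offL[of "Suc v"] offS[of v] that by simp
  let ?A = "{''v'', ''k'', ''own'', ''L''}"
  let ?I = "\<lambda>v m s'. short_cells Z s' \<and> keeps ?A s s' \<and> s' ''v'' 0 = int v \<and> s' ''L'' 0 = int m \<and>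
    (\<forall>i<m. s' ''own'' (int i) = int (own i))"
  show ?thesis
    unfolding set_owners_def
  proof (rule wp_For[where m = n and I = "\<lambda>v. ?I v (off v)"], goal_cases)
    case 5
    then show ?case
      using s init by (auto intro!: short_cells_store short_01 keeps_store keeps_refl simp: store_apply off_def)
  next
    case (6 v s')
    then show ?case using init(1) by (auto simp: keeps_def)
  next
    case (7 v s1)
    then have vn: "v < n" and s1: "?I v (off v) s1" by auto
    have lv: "s1 ''len'' (int v) = int (card (B v))" using s1 init(3)[OF vn] by (auto simp: keeps_def)
    have sv: "int_len (int (Suc v)) \<le> Z" "int_len (int v) \<le> Z"
      using vn short_nat[of "Suc v"] short_nat[of v] by simp_all
    show ?case
    proof (rule wp_For[where m = "card (B v)" and I = "\<lambda>k s'. ?I v (off v + k) s' \<and> s' ''k'' 0 = int k"], goal_cases)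
      case 5
      then show ?case
        using s1 by (auto intro!: short_cells_store short_01 keeps_store simp: store_apply)
    next
      case (6 k s')
      then show ?case using init(3)[OF vn] by (auto simp: keeps_def)
    next
      case (7 k s2)
      then have k: "k < card (B v)" and s2: "?I v (off v + k) s2" "s2 ''k'' 0 = int k" by auto
      have ok: "own (off v + k) = v"
        using entries_nth[where B = B, OF vn k] by (simp add: own_def off_def)
      have le: "off v + Suc k \<le> L" using offL[of "Suc v"] offS[of v] vn k by simp
      have sk: "int_len (int (off v + Suc k)) \<le> Z" "int_len (int (Suc k)) \<le> Z"
        using le by (auto intro!: short_nat simp del: of_nat_add of_nat_Suc)
      let ?s3 = "store ''own'' (int (off v + k)) (int v) s2"
      let ?s4 = "store ''L'' 0 (int (off v + Suc k)) ?s3"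
      have sc: "short_cells Z ?s3" "short_cells Z ?s4"
        using s2 sv sk by (auto intro!: short_cells_store simp del: of_nat_add of_nat_Suc)
      have fin: "short_cells Z ?s4 \<and> ?s4 ''k'' 0 = int k \<and>
          ?I v (off v + Suc k) (store ''k'' 0 (int (Suc k)) ?s4) \<and>
          store ''k'' 0 (int (Suc k)) ?s4 ''k'' 0 = int (Suc k)"
        using sc s2 sk ok
        by (auto intro!: short_cells_store keeps_store simp: store_apply less_Suc_eq simp del: of_nat_add of_nat_Suc)
      let ?s5 = "store ''L'' (aval (Const 0) ?s3) (aval (Plus (scalar ''L'') (Const 1)) ?s3) ?s3"
      have post: "short_cells Z ?s5 \<and>
          ?s5 ''k'' 0 = int k \<and>
          ?I v (off v + Suc k) (store ''k'' 0 (int (Suc k)) ?s5) \<and>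
          store ''k'' 0 (int (Suc k)) ?s5 ''k'' 0 = int (Suc k)"
      proof -
        have a: "aval (Const 0) ?s3 = 0" "aval (Plus (scalar ''L'') (Const 1)) ?s3 = int (off v + Suc k)"
          using s2 by (simp_all add: store_apply)
        show ?thesis unfolding a by (rule fin)
      qed
      have eq: "store ''own'' (aval (scalar ''L'') s2) (aval (scalar ''v'') s2) s2 = ?s3"
        using s2 by simp
      show ?case
      proof (rule wp_Seq, rule wp_Assign, goal_cases)
        case 4
        show ?case unfolding eq
        proof (rule wp_Assign, goal_cases)
          case 4
          show ?case by (rule post)
        qed (use sc in auto)
      qed (use s2 in auto)
    next
      case (8 s')
      then have "short_cells Z s'" and e: "?I v (off (Suc v)) s'" by (auto simp: offS)
      then show ?case
        using sv by (auto intro!: short_cells_store keeps_store simp: store_apply simp del: of_nat_Suc)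
    qed (use s1 lv cdL[OF vn] short_nat LZ in \<open>auto intro: order_trans\<close>)
  next
    case (8 s')
    have "off n = L" by (simp add: off_def L_def)
    then have "static s'"
      using 8 init by (auto simp: static_def keeps_def)
    then show ?case using 8 by (intro Q) auto
  qed (use s short_nat nZ in auto)
qed

end

section \<open>Polynomial running time\<close>

context jsi_cost
begin

text \<open>A round replaces the gap \<open>\<Delta>\<close> by at most \<open>(1 - 1 / L) * \<Delta>\<close>, which lowers this quantity by one.\<close>

definition potential :: "int \<Rightarrow> real" where
  "potential \<Delta> = (if \<Delta> \<le> 0 then 0 else 1 + real L * ln (real_of_int \<Delta>))"

text \<open>The logarithm of a ratio is at most the ratio minus 1, which turns the factor
  \<open>1 - 1 / L\<close> into a decrease by \<open>1 / L\<close>. The summand 1 in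
  \<open>potential\<close> handles a gap that drops to 0, since a positive integral gap has a
  non-negative logarithm.\<close>

lemma potential_decrease:
  assumes "0 < \<Delta>" "\<Delta> \<le> (\<Delta> - \<Delta>') * int L"
  shows "potential \<Delta>' \<le> potential \<Delta> - 1"
proof (cases "\<Delta>' \<le> 0")
  case True
  have "0 \<le> ln (real_of_int \<Delta>)" using assms(1) by (intro ln_ge_zero) simp
  then show ?thesis using True assms(1) by (simp add: potential_def)
next
  case False
  have L: "0 < L" using assms by (cases L) auto
  have "real_of_int \<Delta> \<le> (real_of_int \<Delta> - real_of_int \<Delta>') * real L"
    using assms(2) by (metis of_int_diff of_int_le_iff of_int_mult of_int_of_nat_eq)
  then have "real_of_int \<Delta>' * real L \<le> real_of_int \<Delta> * real L - real_of_int \<Delta>"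
    by (simp add: algebra_simps)
  then have "real_of_int \<Delta>' / real_of_int \<Delta> \<le> 1 - 1 / real L"
    using L assms(1) by (simp add: field_simps)
  moreover have "ln (real_of_int \<Delta>' / real_of_int \<Delta>) \<le> real_of_int \<Delta>' / real_of_int \<Delta> - 1"
    using False assms(1) by (intro ln_le_minus_one) simp
  ultimately have "ln (real_of_int \<Delta>') - ln (real_of_int \<Delta>) \<le> - (1 / real L)"
    using False assms(1) by (simp add: ln_div)
  then have "real L * (ln (real_of_int \<Delta>') - ln (real_of_int \<Delta>)) \<le> real L * (- (1 / real L))"
    by (intro mult_left_mono) auto
  then show ?thesis using L False assms(1) by (simp add: potential_def algebra_simps)
qed

text \<open>The values on \<open>F\<close> are integers of absolute value at most
  \<open>absc * absB\<close>, so they form a finite set.\<close>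

lemma maximum_exists:
  assumes "F \<noteq> {}"
  obtains y where "y \<in> F" "\<And>z. z \<in> F \<Longrightarrow> val z \<le> val y"
proof -
  have "val ` F \<subseteq> {- (absc * absB)..absc * absB}" using val_bound by fastforce
  then have fin: "finite (val ` F)" by (rule finite_subset) simp
  then have "Max (val ` F) \<in> val ` F" using assms by (intro Max_in) auto
  then obtain y where "y \<in> F" "val y = Max (val ` F)" by auto
  then show thesis using that[of y] fin by simp
qed

lemma wp_search:
  assumes s: "static s" and x: "read_vec n s ''x'' \<in> F" and go: "s ''go'' 0 = 1"
  shows "WP (While (Less (Const 0) (scalar ''go'')) improve)
    (\<lambda>s'. is_maximizer {..<n} c F (read_vec n s' ''x'')) s"
proof -
  obtain y where y: "y \<in> F" "\<And>z. z \<in> F \<Longrightarrow> val z \<le> val y" using maximum_exists x by blast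
  let ?gap = "\<lambda>s. val y - val (read_vec n s ''x'')"
  \<comment> \<open>\<open>Suc\<close> pays for the round that finds no improvement and leaves
    \<open>go\<close> at 0.\<close>
  let ?\<mu> = "\<lambda>s. if s ''go'' 0 = 0 then 0 else Suc (nat \<lceil>potential (?gap s)\<rceil>)"
  show ?thesis
  proof (rule wp_While[where \<mu> = ?\<mu> and I = "\<lambda>s. static s \<and> read_vec n s ''x'' \<in> F \<and>
      s ''go'' 0 \<in> {0, 1} \<and> (s ''go'' 0 = 0 \<longrightarrow> val y \<le> val (read_vec n s ''x''))"])
    have "potential (?gap s) \<le> 1 + real L * ln (real_of_int (2 * absc * absB) + 1)"
    proof (cases "?gap s \<le> 0")
      case True
      have "0 \<le> ln (real_of_int (2 * absc * absB) + 1)"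
      proof (rule ln_ge_zero)
        have "0 \<le> 2 * absc * absB" using nonneg by simp
        then have "0 \<le> real_of_int (2 * absc * absB)" by (simp only: of_int_0_le_iff)
        then show "1 \<le> real_of_int (2 * absc * absB) + 1" by linarith
      qed
      then show ?thesis using True by (simp add: potential_def)
    next
      case False
      have "?gap s \<le> 2 * absc * absB" using val_bound[OF x] val_bound[OF y(1)] by linarith
      then have "real_of_int (?gap s) \<le> real_of_int (2 * absc * absB) + 1" by linarith
      then have "ln (real_of_int (?gap s)) \<le> ln (real_of_int (2 * absc * absB) + 1)"
        using False by (intro ln_mono) auto
      then show ?thesis using False by (simp add: potential_def mult_left_mono)
    qed
    then have "nat \<lceil>potential (?gap s)\<rceil> \<le> nat \<lceil>1 + real L * ln (real_of_int (2 * absc * absB) + 1)\<rceil>"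
      by (intro nat_mono ceiling_mono)
    then have "Suc (nat \<lceil>potential (?gap s)\<rceil>) \<le> Z" using iters by linarith
    then show "?\<mu> s \<le> Z" by simp
  next
    fix s assume I: "static s \<and> read_vec n s ''x'' \<in> F \<and>
      s ''go'' 0 \<in> {0, 1} \<and> (s ''go'' 0 = 0 \<longrightarrow> val y \<le> val (read_vec n s ''x''))"
      and b: "bval (Less (Const 0) (scalar ''go'')) s"
    let ?x = "read_vec n s ''x''"
    have go1: "s ''go'' 0 = 1" using I b by auto
    have st: "static s" and xF: "?x \<in> F" using I by auto
    show "WP improve (\<lambda>s'. (static s' \<and> read_vec n s' ''x'' \<in> F \<and>
      s' ''go'' 0 \<in> {0, 1} \<and> (s' ''go'' 0 = 0 \<longrightarrow> val y \<le> val (read_vec n s' ''x''))) \<and> ?\<mu> s' < ?\<mu> s) s"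
    proof (rule wp_improve[OF st refl xF])
      fix s' x' assume s': "static s'" "read_vec n s' ''x'' = x'" "x' \<in> F" "val ?x \<le> val x'"
        "s' ''go'' 0 = (if val ?x < val x' then 1 else 0)"
        and g: "\<And>y. y \<in> F \<Longrightarrow> val y - val ?x \<le> (val x' - val ?x) * int L"
      have "val y \<le> val x'" if "s' ''go'' 0 = 0"
        using that s'(4,5) g[OF y(1)] by (auto split: if_splits)
      moreover have "?\<mu> s' < ?\<mu> s"
      proof (cases "s' ''go'' 0 = 0")
        case True
        then show ?thesis using go1 by simp
      next
        case False
        then have lt: "val ?x < val x'" using s'(5) by (auto split: if_splits)
        have pos: "0 < ?gap s" using lt y(2)[OF s'(3)] by simp
        have "potential (?gap s') \<le> potential (?gap s) - 1"
          by (rule potential_decrease[OF pos]) (use g[OF y(1)] s'(2) in simp)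
        moreover have "1 \<le> potential (?gap s)"
        proof -
          have "0 \<le> ln (real_of_int (?gap s))" using pos by (intro ln_ge_zero) linarith
          then show ?thesis using pos by (simp add: potential_def)
        qed
        ultimately have "nat \<lceil>potential (?gap s')\<rceil> < nat \<lceil>potential (?gap s)\<rceil>"
          by linarith
        then show ?thesis using False go1 by simp
      qed
      ultimately show "(static s' \<and> read_vec n s' ''x'' \<in> F \<and>
        s' ''go'' 0 \<in> {0, 1} \<and> (s' ''go'' 0 = 0 \<longrightarrow> val y \<le> val (read_vec n s' ''x''))) \<and> ?\<mu> s' < ?\<mu> s"
        using s' by simp
    qed
  next
    fix s assume I: "static s \<and> read_vec n s ''x'' \<in> F \<and>
      s ''go'' 0 \<in> {0, 1} \<and> (s ''go'' 0 = 0 \<longrightarrow> val y \<le> val (read_vec n s ''x''))"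
      and b: "\<not> bval (Less (Const 0) (scalar ''go'')) s"
    then have "val y \<le> val (read_vec n s ''x'')" by auto
    then show "is_maximizer {..<n} c F (read_vec n s ''x'')"
      using I y(2) unfolding is_maximizer_def val_def by (meson order_trans)
  qed (use assms static_short in auto)
qed

lemma array_of_nth: "i < length xs \<Longrightarrow> array_of xs (int i) = xs ! i"
  by (simp add: array_of_def)

lemma short_array_of: "(\<And>k. k \<in> set xs \<Longrightarrow> int_len k \<le> Z) \<Longrightarrow> int_len (array_of xs i) \<le> Z"
  using short_01 by (auto simp: array_of_def)

theorem wp_local_search:
  assumes x0: "x0 \<in> F"
  shows "WP local_search (\<lambda>s. is_maximizer {..<n} c F (read_vec n s ''x'')) (input_state n B c x0)"
proof -
  let ?s = "input_state n B c x0"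
  have x0': "x0 \<in> int_vecs {..<n}" "\<And>v. v < n \<Longrightarrow> x0 v \<in> B v"
    using x0 by (auto simp: direct_product_def)
  have elts: "map snd (entries B n) = concat (map (\<lambda>v. sorted_list_of_set (B v)) [0..<n])"
    by (rule map_snd_entries)
  have abc: "int_len (c v) \<le> Z" if "v < n" for v
  proof (rule short)
    have "\<bar>c v\<bar> \<le> absc" unfolding absc_def using that by (intro member_le_sum) auto
    then show "\<bar>c v\<bar> \<le> int n + int L + 2 + absB + absc + absc * absB" using nonneg by linarith
  qed
  have cdL: "card (B v) \<le> L" if "v < n" for v
    unfolding L_def using that by (intro member_le_sum) auto
  have "int_len (?s a i) \<le> Z" for a i
    unfolding input_state_def
    using short_01 abc short_nat cdL short_B x0'(2) B
    by (auto intro!: short_array_of)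
  then have sc: "short_cells Z ?s" using Z3 by (simp add: short_cells_def)
  show ?thesis
    unfolding local_search_def
  proof (rule wp_Seq, rule wp_set_owners[OF sc])
    show "?s ''n'' 0 = int n" using array_of_nth[of 0 "[int n]"] by (simp add: input_state_def)
    show "?s ''c'' (int v) = c v" if "v < n" for v
      using array_of_nth[of v "map c [0..<n]"] that by (simp add: input_state_def)
    show "?s ''len'' (int v) = int (card (B v))" if "v < n" for v
      using array_of_nth[of v "map (\<lambda>v. int (card (B v))) [0..<n]"] that by (simp add: input_state_def)
    show "?s ''B'' (int i) = elt i" if "i < L" for i
    proof -
      have "i < length (entries B n)" using that by (simp add: L_def length_entries)
      then show ?thesis
        using array_of_nth[of i "map snd (entries B n)"] by (simp add: input_state_def elts[symmetric] elt_def)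
    qed
    show "?s ''L'' 0 = 0" by (simp add: input_state_def)
    fix s1 assume s1: "static s1" "keeps {''v'', ''k'', ''own'', ''L''} ?s s1"
    have x1: "s1 ''x0'' (int v) = x0 v" if "v < n" for v
      using keepsD[OF s1(2), of "''x0''"] array_of_nth[of v "map x0 [0..<n]"] that
      by (simp add: input_state_def)
    show "WP (Seq (copy_vec ''x0'' ''x'') (Seq (set_scalar ''go'' (Const 1))
     (While (Less (Const 0) (scalar ''go'')) improve))) (\<lambda>s. is_maximizer {..<n} c F (read_vec n s ''x'')) s1"
    proof (rule wp_Seq, rule wp_copy_vec[OF s1(1)])
      fix s2 assume s2: "static s2" "\<And>v. v < n \<Longrightarrow> s2 ''x'' (int v) = s1 ''x0'' (int v)"
      have r2: "read_vec n s2 ''x'' = x0"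
        using s2(2) x1 x0'(1) by (auto simp: read_vec_def int_vecs_def fun_eq_iff)
      define s3 where "s3 = store ''go'' 0 1 s2"
      have "WP (While (Less (Const 0) (scalar ''go'')) improve) (\<lambda>s. is_maximizer {..<n} c F (read_vec n s ''x'')) s3"
      proof (rule wp_search)
        show "static s3" using s2(1) by (auto simp: s3_def intro!: static_store short_01)
        show "read_vec n s3 ''x'' \<in> F" using x0 r2 by (simp add: s3_def read_vec_store)
        show "s3 ''go'' 0 = 1" by (simp add: s3_def store_apply)
      qed
      then show "WP (Seq (set_scalar ''go'' (Const 1))
        (While (Less (Const 0) (scalar ''go'')) improve)) (\<lambda>s. is_maximizer {..<n} c F (read_vec n s ''x'')) s2"
        using static_short[OF s2(1)] by (intro wp_Seq wp_Assign) (simp_all add: s3_def)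
    qed auto
  qed
qed

end

section \<open>Bounds in terms of the input size\<close>

lemma log_sum_le:
  fixes f :: "'i \<Rightarrow> real"
  assumes "finite S" "\<And>i. i \<in> S \<Longrightarrow> 0 \<le> f i"
  shows "log 2 (sum f S + 1) \<le> (\<Sum>i\<in>S. log 2 (f i + 1))"
  using assms
proof (induction S rule: finite_induct)
  case (insert i S)
  then have nn: "0 \<le> f i" "0 \<le> sum f S" by (auto simp: sum_nonneg)
  \<comment> \<open>One plus a sum of non-negative numbers is at most the product of the factors
    \<open>f i + 1\<close>, which the logarithm makes additive.\<close>
  have "sum f (insert i S) + 1 \<le> (f i + 1) * (sum f S + 1)"
    using insert nn by (simp add: algebra_simps)
  then have "log 2 (sum f (insert i S) + 1) \<le> log 2 ((f i + 1) * (sum f S + 1))"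
    using insert nn by (subst log_le_cancel_iff) (auto simp: add_nonneg_pos)
  also have "\<dots> = log 2 (f i + 1) + log 2 (sum f S + 1)"
    using nn by (intro log_mult_pos) auto
  finally show ?case using insert by simp
qed simp

context jsi
begin

definition input_size :: real where "input_size = real n + instance_size {..<n} B c"

text \<open>An element 0 contributes nothing to the size, but each \<open>B v\<close> contains it at
  most once, which the summand \<open>n\<close> pays for; every other element contributes at least
  1.\<close>

lemma L_le_input_size: "real L \<le> input_size"
proof -
  have "real (card (B v)) \<le> 1 + (\<Sum>\<alpha>\<in>B v. log 2 (real_of_int \<bar>\<alpha>\<bar> + 1))" if "v < n" for v
  proof -
    have fB: "finite (B v)" using B that by blast
    have "real (card (B v)) \<le> 1 + real (card (B v - {0}))"
      using fB by (cases "0 \<in> B v") (simp_all add: card_Diff_singleton_if)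
    also have "real (card (B v - {0})) = (\<Sum>\<alpha>\<in>B v - {0}. 1)" by simp
    also have "\<dots> \<le> (\<Sum>\<alpha>\<in>B v - {0}. log 2 (real_of_int \<bar>\<alpha>\<bar> + 1))"
    proof (rule sum_mono)
      fix \<alpha> assume "\<alpha> \<in> B v - {0}"
      then have "1 \<le> \<bar>\<alpha>\<bar>" by auto
      then have "2 \<le> real_of_int \<bar>\<alpha>\<bar> + 1" by linarith
      then show "1 \<le> log 2 (real_of_int \<bar>\<alpha>\<bar> + 1)" by (subst le_log_iff) auto
    qed
    also have "\<dots> \<le> (\<Sum>\<alpha>\<in>B v. log 2 (real_of_int \<bar>\<alpha>\<bar> + 1))"
      using fB by (intro sum_mono2) auto
    finally show ?thesis by simp
  qed
  then have "(\<Sum>v<n. real (card (B v))) \<le> (\<Sum>v<n. 1 + (\<Sum>\<alpha>\<in>B v. log 2 (real_of_int \<bar>\<alpha>\<bar> + 1)))"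
    by (intro sum_mono) auto
  also have "\<dots> = real n + (\<Sum>v<n. \<Sum>\<alpha>\<in>B v. log 2 (real_of_int \<bar>\<alpha>\<bar> + 1))"
    by (simp add: sum.distrib)
  also have "\<dots> \<le> input_size"
    by (simp add: input_size_def instance_size_def sum_nonneg)
  finally show ?thesis by (simp add: L_def)
qed

lemma abs_nonneg: "0 \<le> absB" "0 \<le> absc"
  by (simp_all add: absB_def absc_def sum_nonneg)

lemma log_abs_le_input_size: "log 2 (real_of_int absB + 1) + log 2 (real_of_int absc + 1) + real n \<le> input_size"
proof -
  have "log 2 (real_of_int absB + 1) \<le> (\<Sum>v<n. log 2 (real_of_int (\<Sum>\<alpha>\<in>B v. \<bar>\<alpha>\<bar>) + 1))"
    using log_sum_le[of "{..<n}" "\<lambda>v. real_of_int (\<Sum>\<alpha>\<in>B v. \<bar>\<alpha>\<bar>)"]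
    by (simp add: absB_def sum_nonneg)
  also have "\<dots> \<le> (\<Sum>v<n. \<Sum>\<alpha>\<in>B v. log 2 (real_of_int \<bar>\<alpha>\<bar> + 1))"
  proof (rule sum_mono)
    fix v assume "v \<in> {..<n}"
    then show "log 2 (real_of_int (\<Sum>\<alpha>\<in>B v. \<bar>\<alpha>\<bar>) + 1) \<le> (\<Sum>\<alpha>\<in>B v. log 2 (real_of_int \<bar>\<alpha>\<bar> + 1))"
      using log_sum_le[of "B v" "\<lambda>\<alpha>. real_of_int \<bar>\<alpha>\<bar>"] B by simp
  qed
  moreover have "log 2 (real_of_int absc + 1) \<le> (\<Sum>v<n. log 2 (real_of_int \<bar>c v\<bar> + 1))"
    using log_sum_le[of "{..<n}" "\<lambda>v. real_of_int \<bar>c v\<bar>"] by (simp add: absc_def)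
  ultimately show ?thesis by (simp add: input_size_def instance_size_def)
qed

lemma n_le_input_size: "real n \<le> input_size"
  by (simp add: input_size_def instance_size_def sum_nonneg)

text \<open>The linear part covers bit lengths: the largest number is at most
  \<open>n + L + 2\<close> times 2 to the power \<open>input_size\<close>, where \<open>n\<close>
  and \<open>L\<close> are at most \<open>input_size\<close>. The quadratic part covers the rounds,
  whose number is about \<open>L\<close> times a logarithm of linear size.\<close>

lemma jsi_cost_of_input_size:
  assumes Z: "4 + 4 * input_size + input_size ^ 2 \<le> real Z"
  shows "jsi_cost n J B c orc Z"
proof
  have s0: "0 \<le> input_size" using n_le_input_size by linarith
  have sq: "0 \<le> input_size ^ 2" by simp
  show "3 \<le> Z" using Z s0 sq by linarith
  show "n \<le> Z" using Z s0 sq n_le_input_size by linarith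
  show "L \<le> Z" using Z s0 sq L_le_input_size by linarith
  have A: "0 < real_of_int absB + 1" "0 < real_of_int absc + 1" using abs_nonneg by linarith+
  have lA: "real_of_int absB + 1 = 2 powr log 2 (real_of_int absB + 1)"
    "real_of_int absc + 1 = 2 powr log 2 (real_of_int absc + 1)" using A by simp_all
  have AC: "(real_of_int absB + 1) * (real_of_int absc + 1) \<le> 2 powr input_size"
  proof -
    have "(real_of_int absB + 1) * (real_of_int absc + 1) =
        2 powr (log 2 (real_of_int absB + 1) + log 2 (real_of_int absc + 1))"
      unfolding powr_add using lA by simp
    also have "\<dots> \<le> 2 powr input_size" using log_abs_le_input_size by (intro powr_mono) auto
    finally show ?thesis .
  qed
  show "int_len k \<le> Z" if k: "\<bar>k\<bar> \<le> int n + int L + 2 + absB + absc + absc * absB" for k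
  proof -
    let ?N = "real (n + L + 2)"
    have "real_of_int \<bar>k\<bar> \<le> real_of_int (int n + int L + 2 + absB + absc + absc * absB)"
      using k by (simp only: of_int_le_iff)
    also have "\<dots> = (?N - 1) * 1 + (real_of_int absB + 1) * (real_of_int absc + 1)"
      by (simp add: algebra_simps)
    also have "\<dots> \<le> (?N - 1) * ((real_of_int absB + 1) * (real_of_int absc + 1)) +
        (real_of_int absB + 1) * (real_of_int absc + 1)"
      using abs_nonneg by (intro add_right_mono mult_left_mono) (auto intro!: mult_ge1_I)
    also have "\<dots> = ?N * ((real_of_int absB + 1) * (real_of_int absc + 1))" by (simp add: algebra_simps)
    also have "\<dots> \<le> 2 powr ?N * 2 powr input_size"
    proof (rule mult_mono[OF _ AC])
      have "?N < 2 ^ (n + L + 2)" by (rule of_nat_less_two_power)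
      then show "?N \<le> 2 powr ?N" by (simp only: powr_realpow[OF zero_less_numeral])
    qed (use A in auto)
    also have "\<dots> = 2 powr (?N + input_size)" by (simp add: powr_add)
    also have "\<dots> < 2 powr real (Z - 1)"
    proof (rule powr_less_mono)
      have "?N \<le> 2 * input_size + 2" using n_le_input_size L_le_input_size by simp
      then have "?N + input_size < real Z - 1" using Z s0 sq by linarith
      then show "?N + input_size < real (Z - 1)" by linarith
    qed simp
    also have "\<dots> = real_of_int (2 ^ (Z - 1))" by (simp add: powr_realpow)
    finally have "\<bar>k\<bar> < 2 ^ (Z - 1)" by (simp only: of_int_less_iff)
    then have "int_len k \<le> Suc (Z - 1)" by (simp only: int_len_le_iff)
    then show ?thesis using \<open>3 \<le> Z\<close> by simp
  qed
  show "nat \<lceil>1 + real L * ln (real_of_int (2 * absc * absB) + 1)\<rceil> + 1 \<le> Z"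
  proof -
    have x1: "1 \<le> real_of_int (2 * absc * absB) + 1"
    proof -
      have "0 \<le> 2 * absc * absB" using abs_nonneg by simp
      then have "0 \<le> real_of_int (2 * absc * absB)" by (simp only: of_int_0_le_iff)
      then show ?thesis by linarith
    qed
    have "real_of_int (2 * absc * absB) + 1 \<le> 2 * ((real_of_int absB + 1) * (real_of_int absc + 1))"
      using abs_nonneg by (simp add: algebra_simps)
    also have "\<dots> \<le> 2 powr 1 * 2 powr input_size" using AC by simp
    also have "\<dots> = 2 powr (1 + input_size)" by (simp only: powr_add)
    finally have "ln (real_of_int (2 * absc * absB) + 1) \<le> ln (2 powr (1 + input_size))"
      using x1 by (intro ln_mono; linarith)
    also have "\<dots> = (1 + input_size) * ln 2" by (simp add: ln_powr)
    also have "\<dots> \<le> (1 + input_size) * 1" using s0 ln_2_less_1 by (intro mult_left_mono) auto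
    finally have "real L * ln (real_of_int (2 * absc * absB) + 1) \<le> input_size * (1 + input_size)"
      using x1 s0 L_le_input_size by (intro mult_mono) auto
    also have "\<dots> = input_size + input_size ^ 2" by (simp add: power2_eq_square algebra_simps)
    finally have "1 + real L * ln (real_of_int (2 * absc * absB) + 1) \<le> real Z - 1" using Z s0 by linarith
    then have "\<lceil>1 + real L * ln (real_of_int (2 * absc * absB) + 1)\<rceil> \<le> int Z - 1" by linarith
    then show ?thesis using \<open>3 \<le> Z\<close> by linarith
  qed
qed

end

theorem theorem1:
  shows "\<exists>(prog :: com) (p :: real poly).
    \<forall>(n :: nat) (J :: (nat \<Rightarrow> int) set) (B :: nat \<Rightarrow> int set) (c :: nat \<Rightarrow> int) (x\<^sub>0 :: nat \<Rightarrow> int)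
      (orc :: (nat \<Rightarrow> int) set \<Rightarrow> (nat \<Rightarrow> int) option).
      jump_system {..<n} J \<longrightarrow>
      (\<forall>v<n. finite (B v) \<and> jump_system_1d (B v)) \<longrightarrow>
      c \<in> int_vecs {..<n} \<longrightarrow>
      x\<^sub>0 \<in> J \<inter> direct_product {..<n} B \<longrightarrow>
      sbo_jump {..<n} J \<longrightarrow>
      optimization_oracle {..<n} J c orc \<longrightarrow>
      (\<exists>t s. exec n orc prog (input_state n B c x\<^sub>0) t s \<and>
         is_maximizer {..<n} c (J \<inter> direct_product {..<n} B) (read_vec n s ''x'') \<and>
         real t \<le> poly p (real n + instance_size {..<n} B c))"
proof (rule exI[of _ local_search], rule exI[of _ "time_bound [:5, 4, 1:] local_search"], intro allI impI)
  fix n :: nat and J :: "(nat \<Rightarrow> int) set" and B :: "nat \<Rightarrow> int set" and c x\<^sub>0 :: "nat \<Rightarrow> int"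
    and orc :: "(nat \<Rightarrow> int) set \<Rightarrow> (nat \<Rightarrow> int) option"
  assume hyps: "\<forall>v<n. finite (B v) \<and> jump_system_1d (B v)" "sbo_jump {..<n} J" "optimization_oracle {..<n} J c orc"
    and x0: "x\<^sub>0 \<in> J \<inter> direct_product {..<n} B"
  interpret inst: jsi n J B c orc by standard (use hyps in auto)
  \<comment> \<open>Rounding up adds at most 1, hence the constant coefficient 5 of the
    polynomial.\<close>
  define Z where "Z = nat \<lceil>4 + 4 * inst.input_size + inst.input_size ^ 2\<rceil>"
  have s0: "0 \<le> inst.input_size" using inst.n_le_input_size by linarith
  have Z: "4 + 4 * inst.input_size + inst.input_size ^ 2 \<le> real Z" "real Z \<le> 5 + 4 * inst.input_size + inst.input_size ^ 2"
    unfolding Z_def using s0 by (simp_all add: real_nat_ceiling_ge) linarith+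
  interpret jsi_cost n J B c orc Z by (rule inst.jsi_cost_of_input_size[OF Z(1)])
  obtain t s where ts: "exec n orc local_search (input_state n B c x\<^sub>0) t s" "t \<le> time_bound Z local_search"
    "is_maximizer {..<n} c (J \<inter> direct_product {..<n} B) (read_vec n s ''x'')"
    using wp_local_search[OF x0] unfolding wp_def by blast
  have "real t \<le> time_bound (real Z) local_search"
    using ts(2) by (simp flip: of_nat_time_bound)
  also have "\<dots> \<le> time_bound (5 + 4 * inst.input_size + inst.input_size ^ 2) local_search"
    using time_bound_mono[of "real Z"] Z(2) by simp
  also have "\<dots> = poly (time_bound [:5, 4, 1:] local_search) inst.input_size"
    by (simp add: poly_time_bound power2_eq_square algebra_simps)
  finally show "\<exists>t s. exec n orc local_search (input_state n B c x\<^sub>0) t s \<and>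
         is_maximizer {..<n} c (J \<inter> direct_product {..<n} B) (read_vec n s ''x'') \<and>
         real t \<le> poly (time_bound [:5, 4, 1:] local_search) (real n + instance_size {..<n} B c)"
    using ts by (auto simp: inst.input_size_def)
qed

end
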